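(* There exist constants $A$ and $t_0>1$ such that for every $s=\sigma+it$ in the closed set $$\{s=\sigma+it\in\mathbf{C}\colon t\ge t_0,\quad 1-\sigma\ge t^{3/7}\}$$ we have $$\mathcal R(s)=-\chi(s)\,\eta^{s-1}e^{-\pi i\eta^2}\,\frac{\sqrt2\,e^{3\pi i/8}\sin\pi\eta}{2\cos2\pi\eta}\,(1+U),\qquad |U|\le A\,t^{-\frac1{21}},$$ where $U=U(s)$ is a complex number depending on $s$.
   Context: For $s=\sigma+it$ with $\sigma,t$ real. Riemann's auxiliary function is the entire function $$\mathcal R(s)=\int_{0\swarrow1}\frac{x^{-s}e^{\pi i x^2}}{e^{\pi i x}-e^{-\pi i x}}\,dx,$$ where $0\swarrow1$ denotes a straight line parallel to the direction $e^{i\pi/4}$ crossing the real axis at a point strictly between $0$ and $1$, traversed from upper right to lower left (for instance $x=\frac12-ue^{i\pi/4}$, with $u$ going from $-\infty$ to $+\infty$), and $x^{-s}=\exp(-s\log x)$ with the principal logarithm on $\mathbf{C}\setminus(-\infty,0]$. $\chi(s)=\pi^{s-1/2}\,\Gamma\!\left(\frac{1-s}{2}\right)/\Gamma\!\left(\frac s2\right)$ is the factor in the functional equation $\zeta(s)=\chi(s)\zeta(1-s)$ of the Riemann zeta function. $\eta=\sqrt{\frac{s-1}{2\pi i}}=\eta_1+i\eta_2$ ($\eta_1,\eta_2$ real) is the square root chosen so that $\eta_1+\eta_2>0$. For $s$ with $t>0$ and $1-\sigma>0$ this gives $0<\arg\eta<\frac\pi4$, and $\eta^{s-1}=\exp((s-1)\log\eta)$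 with this principal argument. *)

theory Defs
  imports "HOL-Complex_Analysis.Complex_Analysis"
begin

text \<open>
  The contour of Riemann's auxiliary function, crossing the real axis at $1/2$. The integral does
  not depend on which crossing point in $(0,1)$ is taken. As \<open>u\<close> increases over the reals, the
  line is traversed from upper right to lower left.
\<close>
definition riemann_aux_line :: "real \<Rightarrow> complex" where
  "riemann_aux_line u = 1 / 2 - of_real u * exp (\<i> * of_real pi / 4)"

definition riemann_aux_integrand :: "complex \<Rightarrow> complex \<Rightarrow> complex" where
  "riemann_aux_integrand s x =
     x powr (- s) * exp (of_real pi * \<i> * x\<^sup>2) /
     (exp (of_real pi * \<i> * x) - exp (- (of_real pi * \<i> * x)))"

text \<open>
  The contour integral over the infinite line, written as a (Lebesgue) integral over the
  parameter; the last factor is the derivative of the parametrisation.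
  The integrand has Gaussian decay, so the integral converges absolutely.
\<close>
definition riemann_aux :: "complex \<Rightarrow> complex" where
  "riemann_aux s =
     (LINT u|lborel. riemann_aux_integrand s (riemann_aux_line u) * (- exp (\<i> * of_real pi / 4)))"

definition riemann_chi :: "complex \<Rightarrow> complex" where
  "riemann_chi s = of_real pi powr (s - 1 / 2) * Gamma ((1 - s) / 2) / Gamma (s / 2)"

text \<open>
  The square root is uniquely determined unless $s - 1$ is a nonnegative real number.
\<close>
definition riemann_eta :: "complex \<Rightarrow> complex" where
  "riemann_eta s = (THE z. z\<^sup>2 = (s - 1) / (2 * of_real pi * \<i>) \<and> Re z + Im z > 0)"

lemma riemann_aux_line_has_vector_derivative:
  "(riemann_aux_line has_vector_derivative (- exp (\<i> * of_real pi / 4))) (at u)"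
  unfolding riemann_aux_line_def
  by (auto intro!: derivative_eq_intros)

lemma riemann_eta_eq_csqrt:
  assumes "Im s > 0" "Re s < 1"
  shows "riemann_eta s = csqrt ((s - 1) / (2 * of_real pi * \<i>))"
    and "0 < Arg (riemann_eta s)" "Arg (riemann_eta s) < pi / 4"
proof -
  define w where "w = (s - 1) / (2 * of_real pi * \<i>)"
  have w: "w = Complex (Im s / (2 * pi)) ((1 - Re s) / (2 * pi))"
    unfolding w_def by (simp add: complex_eq_iff Re_divide Im_divide power2_eq_square field_simps)
  have Rew: "Re w > 0" and Imw: "Im w > 0" using assms unfolding w by auto
  have w0: "w \<noteq> 0" using Rew by auto
  have A: "0 < Arg w" "Arg w < pi / 2"
    using Arg_lt_pi[of w] Imw Rew Arg_Re_pos[of w] by (auto simp: abs_less_iff)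
  have "csqrt w = exp (Ln w / 2)" using w0 by (simp add: csqrt_exp_Ln)
  then have ArgS: "Arg (csqrt w) = Arg w / 2"
    using A w0 by (simp add: Arg_exp Arg_eq_Im_Ln)
  have ImS: "Im (csqrt w) > 0"
    using Arg_lt_pi[of "csqrt w"] ArgS A pi_gt_zero by linarith
  have sum: "Re (csqrt w) + Im (csqrt w) > 0"
    using csqrt_principal[of w] ImS by linarith
  have "riemann_eta s = csqrt w"
    unfolding riemann_eta_def w_def[symmetric]
  proof (rule the_equality)
    show "(csqrt w)\<^sup>2 = w \<and> Re (csqrt w) + Im (csqrt w) > 0" using sum by simp
    fix z assume z: "z\<^sup>2 = w \<and> Re z + Im z > 0"
    then have "z\<^sup>2 = (csqrt w)\<^sup>2" by simp
    then have "z = csqrt w \<or> z = - csqrt w" by (simp only: power2_eq_iff)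
    moreover have "z \<noteq> - csqrt w"
    proof
      assume "z = - csqrt w"
      then have "Re z = - Re (csqrt w)" "Im z = - Im (csqrt w)"
        by (simp_all only: uminus_complex.sel)
      then show False using z sum by linarith
    qed
    ultimately show "z = csqrt w" by blast
  qed
  then show "riemann_eta s = csqrt ((s - 1) / (2 * of_real pi * \<i>))"
    and "0 < Arg (riemann_eta s)" "Arg (riemann_eta s) < pi / 4"
    using ArgS A unfolding w_def by auto
qed

end

theory Submission
  imports Defs "HOL-Probability.Probability"
begin

text \<open>
  Moving the line of integration to the right until it passes near the saddle point \<open>\<eta>\<close> turns
  \<open>\<R>(s)\<close> into a sum of \<open>n\<^sup>-\<^sup>s\<close> over \<open>1 \<le> n \<le> N\<close>, with \<open>N\<close> the integer part of \<open>Re \<eta> - Im \<eta>\<close>, plus the integral over a line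
  through the saddle. Near \<open>\<eta>\<close> the numerator \<open>x\<^sup>-\<^sup>s exp (\<pi> i x\<^sup>2)\<close> is a constant times the Gaussian
  \<open>exp (2 \<pi> i (x - \<eta>)\<^sup>2)\<close>. For the Gaussian, the same combination (with the sum extended to all
  \<open>n \<le> N\<close>) is a Mordell integral, evaluated exactly by comparing the line with its
  translate by \<open>1\<close>; this yields the quotient \<open>sin \<pi>\<eta> / (2 cos 2\<pi>\<eta>)\<close>. The errors, in the sum as well as in the
  integral, are of relative size \<open>(1 + 1 / Im \<eta>)\<^sup>5 / |\<eta>|\<close>, where \<open>Im \<eta>\<close> is at least of order \<open>t\<close> to the power \<open>-1/14\<close>.
  Finally, Stirling's formula replaces the constant by \<open>\<chi>(s) \<eta>\<^sup>s\<^sup>-\<^sup>1 exp (- \<pi> i \<eta>\<^sup>2)\<close>.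
\<close>

section \<open>Stirling's formula in a right half-plane\<close>

text \<open>The difficulty is uniformity in \<open>Im \<eta>\<close>, which may tend to 0 or be
  large. When it is small, successive terms near n = N shrink only by about exp(-4 pi Im eta), so
  roughly 1 / \<open>Im \<eta>\<close> of them matter and no single residue dominates; the sum has
  to be compared with a whole geometric series. When it is large, the main term has size about
  exp(-pi Im eta), and both errors must carry this factor: on the line it comes from the growth of
  the sine, in the sum from Gaussian decay in \<open>Im \<eta>\<close>. The line actually used
  crosses the axis at N + 1/2 instead of passing exactly through the saddle. There the denominator
  has a lower bound independent of \<open>\<eta>\<close>, while the distance to the saddle stays
  bounded. In the fifth power, three factors come from the cubic remainder weighted over the series,
  one from summing it, one from dividing by the main term. With 1 / \<open>Im \<eta>\<close> of
  order at most t^(1/14) and |eta| of order at least t^(1/2), the exponent is 5/14 - 1/2 = -1/7,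
  below -1/21.\<close>

lemma norm_Ln_add_one_quadratic:
  fixes w :: complex
  assumes "norm w \<le> 1/2"
  shows "norm (Ln (1 + w) - w + w\<^sup>2 / 2) \<le> 2 * norm w ^ 3"
proof -
  define f where "f = (\<lambda>w::complex. Ln (1 + w) - w + w\<^sup>2 / 2)"
  have nz: "1 + z \<notin> \<real>\<^sub>\<le>\<^sub>0" "1/2 \<le> norm (1 + z)" if "z \<in> cball 0 (norm w)" for z :: complex
  proof -
    have "norm z \<le> 1/2" using that assms by simp
    then have "\<bar>Re z\<bar> \<le> 1/2" using abs_Re_le_cmod[of z] by linarith
    then show "1 + z \<notin> \<real>\<^sub>\<le>\<^sub>0" by (auto simp: complex_nonpos_Reals_iff)
    show "1/2 \<le> norm (1 + z)"
      using norm_triangle_ineq4[of "1 + z" z] \<open>norm z \<le> 1/2\<close> by simp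
  qed
  \<comment> \<open>The remainder vanishes at 0, and its derivative 1/(1+z) - 1 + z collapses to
    z^2/(1+z). On the disc |1+z| is at least 1/2, which produces the factor 2.\<close>
  have der: "(f has_field_derivative z\<^sup>2 / (1 + z)) (at z within cball 0 (norm w))"
    if "z \<in> cball 0 (norm w)" for z
  proof -
    have "1 + z \<noteq> 0" using nz(2)[OF that] by auto
    then have eq: "z\<^sup>2 / (1 + z) = 1 / (1 + z) - 1 + z"
      by (simp add: divide_simps power2_eq_square algebra_simps)
    show ?thesis unfolding f_def eq using nz(1)[OF that]
      by (auto intro!: derivative_eq_intros simp: inverse_eq_divide)
  qed
  have "norm (f w - f 0) \<le> (2 * norm w ^ 2) * norm (w - 0)"
  proof (rule field_differentiable_bound[of "cball 0 (norm w)"])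
    show "norm (z\<^sup>2 / (1 + z)) \<le> 2 * norm w ^ 2" if "z \<in> cball 0 (norm w)" for z :: complex
    proof -
      have "norm z ^ 2 \<le> norm w ^ 2" using that by (intro power_mono) auto
      moreover have "norm (z\<^sup>2 / (1 + z)) \<le> norm z ^ 2 / (1/2)"
        unfolding norm_divide norm_power using nz(2)[OF that] by (intro divide_left_mono) auto
      ultimately show ?thesis by (simp only: divide_divide_eq_right mult.commute div_by_1)
    qed
  qed (use der in auto)
  then show ?thesis unfolding f_def by (simp add: power2_eq_square power3_eq_cube)
qed

lemma norm_exp_minus_one_le:
  fixes z :: complex
  assumes "norm z \<le> 1"
  shows "norm (exp z - 1) \<le> 3 * norm z"
proof -
  have "norm (exp z - 1) \<le> exp \<bar>Re z\<bar> * norm z"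
    using Taylor_exp[of z 0] by simp
  also have "exp \<bar>Re z\<bar> \<le> exp 1" using abs_Re_le_cmod[of z] assms by simp
  also have "\<dots> \<le> (3::real)" by (rule exp_le)
  finally show ?thesis by (simp add: mult_right_mono)
qed

text \<open>Stirling's main term w^(w - 1/2) exp(-w) without the constant sqrt(2 pi), which
  reappears as the limit of \<open>stirling_quot\<close>.\<close>

definition stirling_term :: "complex \<Rightarrow> complex" where
  "stirling_term w = exp ((w - 1/2) * Ln w - w)"

text \<open>A logarithm of \<open>stirling_term (w + 1) / (w * stirling_term w)\<close>, that is,
  the amount by which Stirling's term fails the recurrence of Gamma.\<close>

definition stirling_diff :: "complex \<Rightarrow> complex" where
  "stirling_diff w = (w + 1/2) * (Ln (w + 1) - Ln w) - 1"

definition stirling_quot :: "complex \<Rightarrow> complex" where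
  "stirling_quot w = Gamma w / stirling_term w"

lemma stirling_term_nz [simp]: "stirling_term w \<noteq> 0"
  by (simp add: stirling_term_def)

lemma Re_pos_not_nonpos_Int: "Re w > 0 \<Longrightarrow> w \<notin> \<int>\<^sub>\<le>\<^sub>0"
  by (auto elim!: nonpos_Ints_cases)

lemma stirling_quot_plus1:
  assumes "Re w > 0"
  shows "stirling_quot w = stirling_quot (w + 1) * exp (stirling_diff w)"
proof -
  have w: "w \<noteq> 0" using assms by auto
  have "stirling_term (w + 1) = stirling_term w * (exp (stirling_diff w) * exp (Ln w))"
    unfolding stirling_term_def stirling_diff_def exp_add[symmetric]
    by (rule arg_cong[where f = exp]) (simp add: algebra_simps)
  then have "stirling_term (w + 1) = stirling_term w * exp (stirling_diff w) * w"
    using w by simp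
  then show ?thesis
    unfolding stirling_quot_def using w Gamma_plus1[OF Re_pos_not_nonpos_Int[OF assms]]
    by (simp add: field_simps)
qed

text \<open>Both w and w + z lie in the right half-plane, so their arguments differ by less than pi
  and no branch jump occurs.\<close>

lemma Ln_add_eq:
  assumes "Re w > 0" "Re z \<ge> 0"
  shows "Ln (w + z) = Ln w + Ln (1 + z / w)"
proof -
  have w0: "w \<noteq> 0" using assms by auto
  have nz: "w + z \<noteq> 0" using assms by (auto simp: complex_eq_iff)
  have a: "\<bar>Im (Ln (w + z))\<bar> < pi / 2" "\<bar>Im (Ln w)\<bar> < pi / 2"
    using assms Re_Ln_pos_lt[of w] Re_Ln_pos_lt[of "w + z"] w0 nz by auto
  have "Ln ((w + z) * (1 / w)) = Ln (w + z) + Ln (1 / w)"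
    using a w0 nz assms by (intro Ln_times_simple) (auto simp: Ln_inverse inverse_eq_divide[symmetric] complex_nonpos_Reals_iff)
  also have "Ln (1 / w) = - Ln w"
    using assms w0 by (simp add: Ln_inverse inverse_eq_divide[symmetric] complex_nonpos_Reals_iff)
  finally show ?thesis using w0 by (simp add: field_simps)
qed

lemma norm_stirling_diff_le:
  assumes "Re w \<ge> 2"
  shows "norm (stirling_diff w) \<le> 3 / (Re w)\<^sup>2"
proof -
  define u where "u = 1 / w"
  have w0: "w \<noteq> 0" using assms by auto
  have nw: "norm w \<ge> Re w" by (rule complex_Re_le_cmod)
  have u: "norm u \<le> 1/2" "u \<noteq> 0" "w = 1 / u"
    unfolding u_def using nw assms w0 by (auto simp: norm_divide field_simps)
  define r where "r = Ln (1 + u) - u + u\<^sup>2 / 2"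
  have r: "norm r \<le> 2 * norm u ^ 3" unfolding r_def by (rule norm_Ln_add_one_quadratic[OF u(1)])
  have L: "Ln (w + 1) - Ln w = u - u\<^sup>2 / 2 + r"
    using Ln_add_eq[of w 1] assms unfolding r_def u_def by simp
  \<comment> \<open>The shift 1/2 in \<open>stirling_diff\<close> is what cancels the terms of order
    u. Everything left is quadratic, since r is cubic.\<close>
  have "stirling_diff w = r / u - u\<^sup>2 / 4 + r / 2"
    unfolding stirling_diff_def L unfolding u(3) using u(2)
    by (simp add: field_simps power2_eq_square)
  also have "norm \<dots> \<le> norm (r / u) + norm (u\<^sup>2 / 4) + norm (r / 2)"
    using norm_triangle_ineq[of "r / u - u\<^sup>2 / 4" "r / 2"] norm_triangle_ineq4[of "r / u" "u\<^sup>2 / 4"]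
    by linarith
  also have "norm (r / u) \<le> 2 * norm u ^ 2"
    using r u(2) by (simp add: norm_divide divide_le_eq power2_eq_square power3_eq_cube)
  also have "norm (u\<^sup>2 / 4) = norm u ^ 2 / 4" by (simp add: norm_divide norm_power)
  also have "norm (r / 2) \<le> norm u ^ 2 / 2"
  proof -
    have "norm r \<le> 2 * norm u ^ 2 * norm u" using r by (simp add: power2_eq_square power3_eq_cube)
    also have "\<dots> \<le> 2 * norm u ^ 2 * (1/2)" using u(1) by (intro mult_left_mono) auto
    finally show ?thesis by (simp add: norm_divide)
  qed
  finally have "norm (stirling_diff w) \<le> 3 * norm u ^ 2"
    using zero_le_power2[of "norm u"] by linarith
  also have "norm u ^ 2 \<le> 1 / (Re w)\<^sup>2"
  proof -
    have "norm u ^ 2 = 1 / norm w ^ 2" unfolding u_def by (simp add: norm_divide power_divide)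
    also have "\<dots> \<le> 1 / (Re w)\<^sup>2" using nw assms w0 by (intro divide_left_mono power_mono mult_pos_pos) auto
    finally show ?thesis .
  qed
  finally show ?thesis by simp
qed

lemma stirling_quot_plus_of_nat:
  assumes "Re w > 0"
  shows "stirling_quot w = stirling_quot (w + of_nat n) * exp (\<Sum>k<n. stirling_diff (w + of_nat k))"
proof (induction n)
  case (Suc n)
  have "stirling_quot (w + of_nat n) = stirling_quot (w + of_nat n + 1) * exp (stirling_diff (w + of_nat n))"
    using assms by (intro stirling_quot_plus1) auto
  with Suc show ?case by (simp add: exp_add algebra_simps)
qed simp

text \<open>Comparing 1/y^2 with 1/(y - 1) - 1/y makes the bound telescope, so that it is uniform in
  n.\<close>

lemma norm_sum_stirling_diff_le:
  assumes "Re w \<ge> 2"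
  shows "norm (\<Sum>k<n. stirling_diff (w + of_nat k)) \<le> 3 * (1 / (Re w - 1) - 1 / (Re w - 1 + n))"
proof -
  have "norm (\<Sum>k<n. stirling_diff (w + of_nat k))
      \<le> (\<Sum>k<n. norm (stirling_diff (w + of_nat k)))" by (rule norm_sum)
  also have "\<dots> \<le> (\<Sum>k<n. 3 * (1 / (Re w - 1 + real k) - 1 / (Re w - 1 + real (Suc k))))"
  proof (rule sum_mono)
    fix k
    have "norm (stirling_diff (w + of_nat k)) \<le> 3 / (Re (w + of_nat k))\<^sup>2"
      using assms by (intro norm_stirling_diff_le) auto
    also have "\<dots> = 3 * (1 / (Re w + k)\<^sup>2)" by simp
    also have "1 / (Re w + k)\<^sup>2 \<le> 1 / (Re w - 1 + real k) - 1 / (Re w - 1 + real (Suc k))"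
    proof -
      define y where "y = Re w + real k"
      have y: "y > 1" using assms unfolding y_def by linarith
      have "1 / (y - 1) - 1 / y = 1 / ((y - 1) * y)" using y by (simp add: field_simps)
      moreover have "1 / y\<^sup>2 \<le> 1 / ((y - 1) * y)"
        using y by (intro divide_left_mono) (auto simp: power2_eq_square)
      ultimately show ?thesis unfolding y_def by (simp add: algebra_simps)
    qed
    finally show "norm (stirling_diff (w + of_nat k)) \<le> 3 * (1 / (Re w - 1 + real k) - 1 / (Re w - 1 + real (Suc k)))"
      by simp
  qed
  also have "\<dots> = 3 * (\<Sum>k<n. 1 / (Re w - 1 + real k) - 1 / (Re w - 1 + real (Suc k)))"
    by (simp add: sum_distrib_left)
  also have "(\<Sum>k<n. 1 / (Re w - 1 + real k) - 1 / (Re w - 1 + real (Suc k)))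
     = 1 / (Re w - 1) - 1 / (Re w - 1 + n)"
    using sum_lessThan_telescope'[of "\<lambda>k. 1 / (Re w - 1 + real k)" n] by simp
  finally show ?thesis .
qed

lemma tendsto_mult_Ln_one_plus_div:
  fixes w :: complex
  shows "(\<lambda>n. of_nat n * Ln (1 + w / of_nat n)) \<longlonglongrightarrow> w"
proof -
  have "((\<lambda>z. Ln (1 + w * z)) has_field_derivative w) (at 0)"
    by (auto intro!: derivative_eq_intros)
  then have "((\<lambda>z. (Ln (1 + w * z) - Ln (1 + w * 0)) / (z - 0)) \<longlongrightarrow> w) (at 0)"
    by (simp add: DERIV_def has_field_derivative_iff)
  moreover have "filterlim (\<lambda>n. 1 / of_nat n :: complex) (at 0) sequentially"
    unfolding filterlim_at
    by (auto intro: lim_1_over_n eventually_mono[OF eventually_gt_at_top[of 0]])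
  ultimately have "(\<lambda>n. (Ln (1 + w * (1 / of_nat n)) - Ln (1 + w * 0)) / (1 / of_nat n - 0)) \<longlonglongrightarrow> w"
    by (rule filterlim_compose)
  then show ?thesis by (simp add: mult.commute)
qed

text \<open>Gamma(w + n) / Gamma(n) and the corresponding quotient of Stirling terms are both
  asymptotic to n^w: the former by the limit of \<open>Gamma_series\<close>, the latter because n
  Ln(1 + w/n) tends to w.\<close>

lemma stirling_quot_shift_limit:
  assumes "Re w > 0"
  shows "(\<lambda>n. stirling_quot (w + of_nat n) / stirling_quot (of_nat n)) \<longlonglongrightarrow> 1"
proof -
  have w: "w \<notin> \<int>\<^sub>\<le>\<^sub>0" using assms by (rule Re_pos_not_nonpos_Int)
  have w0: "w \<noteq> 0" using assms by auto
  let ?a = "\<lambda>n. Gamma (w + of_nat n) / (Gamma (of_nat n) * exp (w * of_real (ln (of_nat n))))"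
  let ?b = "\<lambda>n. stirling_term (w + of_nat n) / (stirling_term (of_nat n) * exp (w * of_real (ln (of_nat n))))"
  have a: "?a \<longlonglongrightarrow> 1"
  proof -
    have "(\<lambda>n. (Gamma w / Gamma_series w n) * (of_nat n / (w + of_nat n))) \<longlonglongrightarrow> (Gamma w / Gamma w) * 1"
    proof (intro tendsto_mult tendsto_divide Gamma_series_LIMSEQ tendsto_const)
      show "Gamma w \<noteq> 0" using w by (simp add: Gamma_eq_zero_iff)
      have "(\<lambda>n. 1 / (w / of_nat n + 1)) \<longlonglongrightarrow> 1 / (0 + 1)"
        by (intro tendsto_intros lim_const_over_n) auto
      then have "(\<lambda>n. 1 / (w / of_nat n + 1)) \<longlonglongrightarrow> 1" by simp
      then show "(\<lambda>n. of_nat n / (w + of_nat n)) \<longlonglongrightarrow> 1"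
        by (rule Lim_transform_eventually)
          (auto intro!: eventually_mono[OF eventually_gt_at_top[of 0]] simp: divide_simps)
    qed
    then have "(\<lambda>n. (Gamma w / Gamma_series w n) * (of_nat n / (w + of_nat n))) \<longlonglongrightarrow> 1"
      using w by (simp add: Gamma_eq_zero_iff)
    then show ?thesis
    proof (rule Lim_transform_eventually)
      show "\<forall>\<^sub>F n in sequentially. (Gamma w / Gamma_series w n) * (of_nat n / (w + of_nat n)) = ?a n"
        using eventually_gt_at_top[of 0]
      proof eventually_elim
        case (elim n)
        have wn: "w + of_nat n \<noteq> 0" using assms by (auto simp: complex_eq_iff)
        have P: "pochhammer w n \<noteq> 0"
          using w pochhammer_eq_0_iff[of w n] by auto
        have G: "Gamma (w + of_nat n) = Gamma w * pochhammer w n"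
          using pochhammer_Gamma[OF w, of n] w by (simp add: Gamma_eq_zero_iff field_simps)
        have F: "fact n = of_nat n * (fact (n - 1) :: complex)"
          using elim by (simp add: fact_reduce)
        have Gn: "Gamma (of_nat n) = (fact (n - 1) :: complex)"
          using elim Gamma_fact[of "n - 1", where 'a = complex] by (simp add: of_nat_diff)
        show ?case
          unfolding Gamma_series_def G Gn F pochhammer_Suc
          using wn P elim by (simp add: pochhammer_Suc divide_simps)
      qed
    qed
  qed
  have b: "?b \<longlonglongrightarrow> 1"
  proof -
    have 1: "(\<lambda>n. Ln (1 + w / of_nat n)) \<longlonglongrightarrow> Ln (1 + 0)"
      by (intro tendsto_intros lim_const_over_n) auto
    have "(\<lambda>n. exp (of_nat n * Ln (1 + w / of_nat n) + (w - 1/2) * Ln (1 + w / of_nat n) - w))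
        \<longlonglongrightarrow> exp (w + (w - 1/2) * Ln (1 + 0) - w)"
      by (intro tendsto_intros tendsto_mult_Ln_one_plus_div 1)
    then have "(\<lambda>n. exp (of_nat n * Ln (1 + w / of_nat n) + (w - 1/2) * Ln (1 + w / of_nat n) - w)) \<longlonglongrightarrow> 1"
      by simp
    then show ?thesis
    proof (rule Lim_transform_eventually)
      show "\<forall>\<^sub>F n in sequentially. exp (of_nat n * Ln (1 + w / of_nat n) + (w - 1/2) * Ln (1 + w / of_nat n) - w) = ?b n"
        using eventually_gt_at_top[of 0]
      proof eventually_elim
        case (elim n)
        have "Ln (w + of_nat n) = of_real (ln (of_nat n)) + Ln (1 + w / of_nat n)"
          using Ln_add_eq[of "of_nat n" w] assms elim by (simp add: add.commute)
        then show ?case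
          unfolding stirling_term_def exp_add[symmetric] exp_diff[symmetric]
          using elim by (intro arg_cong[where f = exp]) (simp add: algebra_simps)
      qed
    qed
  qed
  have "(\<lambda>n. ?a n / ?b n) \<longlonglongrightarrow> 1 / 1" by (intro tendsto_divide a b) auto
  then show ?thesis unfolding stirling_quot_def by (simp add: field_simps)
qed

text \<open>A nonzero limit c exists because the logarithms of successive quotients are summable.
  Legendre duplication at n relates the values along n, n + 1/2 and 2 n, all tending to c, and
  yields c^2 = sqrt(2 pi) c.\<close>

lemma stirling_quot_of_nat_limit: "(\<lambda>n. stirling_quot (of_nat n)) \<longlonglongrightarrow> of_real (sqrt (2 * pi))"
proof -
  have nz: "stirling_quot (of_nat n) \<noteq> 0" if "n > 0" for n
    using that Re_pos_not_nonpos_Int[of "of_nat n"] unfolding stirling_quot_def by (auto simp: Gamma_eq_zero_iff)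
  have "summable (\<lambda>k. stirling_diff (2 + of_nat k))"
  proof (rule summable_norm_cancel, rule summable_comparison_test)
    show "\<exists>N. \<forall>k\<ge>N. norm (norm (stirling_diff (2 + of_nat k))) \<le> 3 * (1 / real k ^ 2)"
    proof (intro exI[of _ 1] allI impI)
      fix k :: nat assume k: "k \<ge> 1"
      have "norm (stirling_diff (2 + of_nat k)) \<le> 3 / (Re (2 + of_nat k))\<^sup>2"
        by (intro norm_stirling_diff_le) auto
      also have "\<dots> \<le> 3 / real k ^ 2" using k by (intro divide_left_mono power_mono) auto
      finally show "norm (norm (stirling_diff (2 + of_nat k))) \<le> 3 * (1 / real k ^ 2)" by simp
    qed
    show "summable (\<lambda>k. 3 * (1 / real k ^ 2))"
      using inverse_power_summable[of 2, where 'a = real] by (intro summable_mult) (simp add: inverse_eq_divide)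
  qed
  then have "(\<lambda>n. \<Sum>k<n. stirling_diff (2 + of_nat k)) \<longlonglongrightarrow> suminf (\<lambda>k. stirling_diff (2 + of_nat k))"
    by (simp add: summable_LIMSEQ)
  then have "(\<lambda>n. stirling_quot 2 * exp (- (\<Sum>k<n. stirling_diff (2 + of_nat k))))
     \<longlonglongrightarrow> stirling_quot 2 * exp (- suminf (\<lambda>k. stirling_diff (2 + of_nat k)))"
    by (intro tendsto_intros)
  moreover define c where "c = stirling_quot 2 * exp (- suminf (\<lambda>k. stirling_diff (2 + of_nat k)))"
  moreover have "stirling_quot 2 * exp (- (\<Sum>k<n. stirling_diff (2 + of_nat k))) = stirling_quot (of_nat (n + 2))" for n
    using stirling_quot_plus_of_nat[of 2 n] by (simp add: exp_minus field_simps)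
  ultimately have "(\<lambda>n. stirling_quot (of_nat (n + 2))) \<longlonglongrightarrow> c" by simp
  then have lim: "(\<lambda>n. stirling_quot (of_nat n)) \<longlonglongrightarrow> c" by (rule LIMSEQ_offset)
  have c0: "c \<noteq> 0" unfolding c_def using nz[of 2] by simp
  have lim2: "(\<lambda>n. stirling_quot (of_nat (2 * n))) \<longlonglongrightarrow> c"
    using LIMSEQ_subseq_LIMSEQ[OF lim, of "\<lambda>n. 2 * n"] by (auto simp: o_def strict_mono_def)
  have half: "(\<lambda>n. stirling_quot (1/2 + of_nat n)) \<longlonglongrightarrow> c"
  proof -
    have "(\<lambda>n. stirling_quot (1/2 + of_nat n) / stirling_quot (of_nat n) * stirling_quot (of_nat n)) \<longlonglongrightarrow> 1 * c"
      by (intro tendsto_mult stirling_quot_shift_limit lim) auto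
    then have "(\<lambda>n. stirling_quot (1/2 + of_nat n) / stirling_quot (of_nat n) * stirling_quot (of_nat n)) \<longlonglongrightarrow> c" by simp
    then show ?thesis
      by (rule Lim_transform_eventually)
         (auto intro!: eventually_mono[OF eventually_gt_at_top[of 0]] simp: nz)
  qed
  \<comment> \<open>The exponent by which the Stirling terms miss the duplication formula. It tends
    to (ln 2) / 2 and supplies the sqrt 2 in sqrt(2 pi).\<close>
  define h where "h n = 1/2 * ln 2 - n * ln (1 + 1 / (2 * n)) + 1/2" for n :: real
  have "((\<lambda>n. exp (h (real n))) \<longlongrightarrow> exp (1/2 * ln 2)) sequentially"
  proof -
    have "((\<lambda>n. h (real n)) \<longlongrightarrow> 1/2 * ln 2) sequentially"
      unfolding h_def by real_asymp
    then show ?thesis by (intro tendsto_exp)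
  qed
  then have "((\<lambda>n. of_real (exp (h (real n))) :: complex) \<longlongrightarrow> of_real (exp (1/2 * ln 2))) sequentially"
    by (intro tendsto_of_real)
  then have "(\<lambda>n. of_real (sqrt pi) * of_real (exp (h (real n))) * stirling_quot (of_nat (2 * n)))
      \<longlonglongrightarrow> of_real (sqrt pi) * of_real (exp (1/2 * ln 2)) * c"
    by (intro tendsto_mult tendsto_const lim2)
  moreover have "(\<lambda>n. stirling_quot (of_nat n) * stirling_quot (1/2 + of_nat n)) \<longlonglongrightarrow> c * c"
    by (intro tendsto_intros lim half)
  moreover have "\<forall>\<^sub>F n in sequentially. stirling_quot (of_nat n) * stirling_quot (1/2 + of_nat n)
      = of_real (sqrt pi) * of_real (exp (h (real n))) * stirling_quot (of_nat (2 * n))"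
    using eventually_gt_at_top[of 0]
  proof eventually_elim
    case (elim n)
    have L: "Gamma (of_nat n) * Gamma (1/2 + of_nat n :: complex)
        = exp ((1 - 2 * of_nat n) * of_real (ln 2)) * of_real (sqrt pi) * Gamma (of_nat (2 * n))"
    proof -
      have "(of_nat n + 1/2 :: complex) \<notin> \<int>\<^sub>\<le>\<^sub>0" "(of_nat n :: complex) \<notin> \<int>\<^sub>\<le>\<^sub>0" 
        using elim by (auto intro!: Re_pos_not_nonpos_Int)
      then show ?thesis using Gamma_legendre_duplication[of "of_nat n :: complex"]
        by (simp add: add.commute)
    qed
    have l1: "Ln (1/2 + of_nat n) = of_real (ln (real n)) + of_real (ln (1 + 1 / (2 * real n)))"
    proof -
      have "(1/2 + of_nat n :: complex) = of_real (real n * (1 + 1 / (2 * real n)))"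
        using elim by (simp add: field_simps)
      moreover have "ln (real n * (1 + 1 / (2 * real n))) = ln (real n) + ln (1 + 1 / (2 * real n))"
        using elim by (intro ln_mult_pos) (auto simp: add_pos_pos)
      ultimately show ?thesis using elim
        by (simp only: Ln_of_real add_pos_pos mult_pos_pos of_nat_0_less_iff zero_less_one zero_less_divide_iff zero_less_numeral of_real_add simp_thms)
    qed
    have l2: "Ln (of_nat (2 * n)) = of_real (ln 2) + of_real (ln (real n))"
      using elim Ln_of_nat[of "2 * n"] by (simp add: ln_mult del: Ln_of_nat)
    have l3: "Ln (of_nat n) = of_real (ln (real n))" using elim by simp
    have T: "stirling_term (of_nat n) * stirling_term (1/2 + of_nat n) * of_real (exp (h (real n)))
       = exp ((1 - 2 * of_nat n) * of_real (ln 2)) * stirling_term (of_nat (2 * n))"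
      unfolding stirling_term_def exp_of_real[symmetric] exp_add[symmetric] l1 l2 l3 h_def
      using elim by (intro arg_cong[where f = exp]) (simp add: algebra_simps)
    have cross: "a / (b * c) = p * e * (g / d)" if "b * c * e = k * d" "a = k * p * g" "b \<noteq> 0" "c \<noteq> 0" "d \<noteq> 0"
      for a b c d e g k p :: complex
    proof -
      have "a * d = (k * d) * (p * g)" unfolding that(2) by (simp add: mult_ac)
      also have "\<dots> = p * e * g * (b * c)" unfolding that(1)[symmetric] by (simp add: mult_ac)
      finally show ?thesis using that(3-5) by (simp add: frac_eq_eq)
    qed
    show ?case
      unfolding stirling_quot_def times_divide_times_eq
      by (rule cross[OF T L]) simp_all
  qed
  ultimately have "c * c = of_real (sqrt pi) * of_real (exp (1/2 * ln 2)) * c"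
    by (intro LIMSEQ_unique[OF Lim_transform_eventually])
  then have "c = of_real (sqrt pi * exp (1/2 * ln 2))" using c0 by simp
  moreover have "exp (1/2 * ln 2) = sqrt (2::real)"
    using powr_half_sqrt[of 2] by (simp add: powr_def)
  ultimately show ?thesis using lim by (simp add: real_sqrt_mult mult.commute)
qed

text \<open>Move w to infinity through w + n: \<open>stirling_quot\<close> changes by a factor exp D
  with |D| <= 3 / (Re w - 1) <= 1. The factor 3 of \<open>norm_exp_minus_one_le\<close> gives 9 /
  (Re w - 1), and Re w >= 4 turns this into 12 / Re w.\<close>

lemma stirling_bound:
  assumes "Re w \<ge> 4"
  shows "\<exists>E. Gamma w = of_real (sqrt (2 * pi)) * stirling_term w * (1 + E) \<and> norm E \<le> 12 / Re w"
proof -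
  define x where "x = Re w - 1"
  have x: "x \<ge> 3" using assms unfolding x_def by linarith
  define E where "E = stirling_quot w / of_real (sqrt (2 * pi)) - 1"
  have nz: "stirling_quot (w + of_nat n) \<noteq> 0" for n
    unfolding stirling_quot_def using assms Re_pos_not_nonpos_Int[of "w + of_nat n"]
    by (auto simp: Gamma_eq_zero_iff)
  have "(\<lambda>n. stirling_quot (w + of_nat n) / stirling_quot (of_nat n) * stirling_quot (of_nat n))
     \<longlonglongrightarrow> 1 * of_real (sqrt (2 * pi))"
    using assms by (intro tendsto_mult stirling_quot_shift_limit stirling_quot_of_nat_limit) auto
  then have "(\<lambda>n. stirling_quot (w + of_nat n) / stirling_quot (of_nat n) * stirling_quot (of_nat n))
     \<longlonglongrightarrow> of_real (sqrt (2 * pi))" by simp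
  then have lim: "(\<lambda>n. stirling_quot (w + of_nat n)) \<longlonglongrightarrow> of_real (sqrt (2 * pi))"
  proof (rule Lim_transform_eventually, intro eventually_mono[OF eventually_gt_at_top[of 0]])
    fix n :: nat assume "n > 0"
    then have "(of_nat n :: complex) \<notin> \<int>\<^sub>\<le>\<^sub>0" by (intro Re_pos_not_nonpos_Int) auto
    then show "stirling_quot (w + of_nat n) / stirling_quot (of_nat n) * stirling_quot (of_nat n) = stirling_quot (w + of_nat n)"
      by (simp add: stirling_quot_def Gamma_eq_zero_iff)
  qed
  have "(\<lambda>n. stirling_quot w / stirling_quot (w + of_nat n) - 1) \<longlonglongrightarrow> E"
    unfolding E_def by (intro tendsto_intros lim) auto
  moreover have "norm (stirling_quot w / stirling_quot (w + of_nat n) - 1) \<le> 9 / x" for n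
  proof -
    define D where "D = (\<Sum>k<n. stirling_diff (w + of_nat k))"
    have "norm D \<le> 3 * (1 / (Re w - 1) - 1 / (Re w - 1 + n))"
      unfolding D_def using assms by (intro norm_sum_stirling_diff_le) auto
    also have "\<dots> \<le> 3 / x" using x unfolding x_def by simp
    finally have D: "norm D \<le> 3 / x" .
    then have "norm D \<le> 1" using x by (simp add: order_trans[OF D])
    then have "norm (exp D - 1) \<le> 3 * norm D" by (rule norm_exp_minus_one_le)
    moreover have "stirling_quot w / stirling_quot (w + of_nat n) = exp D"
      unfolding D_def using stirling_quot_plus_of_nat[of w n] assms nz[of n] by simp
    ultimately show ?thesis using D by simp
  qed
  ultimately have "norm E \<le> 9 / x" by (intro LIMSEQ_le_const2[OF tendsto_norm]) auto
  also have "\<dots> \<le> 12 / Re w" using x unfolding x_def by (simp add: field_simps)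
  finally have "norm E \<le> 12 / Re w" .
  moreover have "Gamma w = of_real (sqrt (2 * pi)) * stirling_term w * (1 + E)"
    unfolding E_def stirling_quot_def by simp
  ultimately show ?thesis by blast
qed

section \<open>The factor chi at s = 1 + 2 pi i eta^2\<close>

lemma riemann_chi_alt:
  assumes "Re s < 1"
  shows "riemann_chi s = of_real pi powr (s - 1/2) * (exp (s * of_real (ln 2)) * of_real (sqrt pi) * Gamma (1 - s))
           * (sin (of_real pi * (s / 2)) / of_real pi)"
proof -
  \<comment> \<open>Reflection replaces 1 / Gamma(s/2) by Gamma(1 - s/2) times a sine. As 1 - s/2 =
    z + 1/2, duplication then merges the two Gamma factors into Gamma(1 - s), whose argument lies in
    the right half-plane.\<close>
  define z where "z = (1 - s) / 2"
  have z: "Re z > 0" unfolding z_def using assms by simp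
  have nz: "z \<notin> \<int>\<^sub>\<le>\<^sub>0" "z + 1/2 \<notin> \<int>\<^sub>\<le>\<^sub>0" using z by (auto intro!: Re_pos_not_nonpos_Int)
  have "rGamma (s / 2) * rGamma (1 - s / 2) = sin (of_real pi * (s / 2)) / of_real pi"
    by (rule rGamma_reflection_complex)
  moreover have "1 - s / 2 = z + 1/2" unfolding z_def by (simp add: field_simps)
  ultimately have "rGamma (s / 2) * rGamma (z + 1/2) = sin (of_real pi * (s / 2)) / of_real pi" by simp
  moreover have "rGamma (z + 1/2) \<noteq> 0" using nz by (simp add: rGamma_eq_zero_iff)
  ultimately have r: "rGamma (s / 2) = Gamma (z + 1/2) * (sin (of_real pi * (s / 2)) / of_real pi)"
    unfolding Gamma_def by (metis nonzero_mult_div_cancel_right divide_inverse mult.commute)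
  have l: "Gamma z * Gamma (z + 1/2) = exp (s * of_real (ln 2)) * of_real (sqrt pi) * Gamma (1 - s)"
  proof -
    have "2 * z = 1 - s" "1 - (1 - s) = s" unfolding z_def by simp_all
    then show ?thesis using Gamma_legendre_duplication[OF nz] by (simp only:)
  qed
  have "riemann_chi s = of_real pi powr (s - 1/2) * Gamma z * rGamma (s / 2)"
    unfolding riemann_chi_def z_def Gamma_def[of "s / 2"] by (simp only: divide_inverse inverse_inverse_eq)
  also have "\<dots> = of_real pi powr (s - 1/2) * (Gamma z * Gamma (z + 1/2)) * (sin (of_real pi * (s / 2)) / of_real pi)"
    unfolding r by (simp only: mult.assoc)
  finally show ?thesis unfolding l .
qed

text \<open>Since 1 - s = -2 pi i eta^2, Stirling's term for Gamma(1 - s) is expressed by powers of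
  eta. All exponentials merge into one; what is left over is the Stirling error and the smaller
  exponential d of the sine, of size exp(-pi t).\<close>

lemma riemann_chi_asymptotic:
  assumes eta: "0 < Im \<eta>" "Im \<eta> < Re \<eta>"
    and s: "s = 1 + 2 * of_real pi * \<i> * \<eta>\<^sup>2"
    and big: "1 - Re s \<ge> 4"
  shows "\<exists>V. riemann_chi s * \<eta> powr (s - 1) * exp (- (of_real pi * \<i> * \<eta>\<^sup>2))
       = exp (\<i> * of_real pi / 4) * (\<eta> powr (- s) * exp (of_real pi * \<i> * \<eta>\<^sup>2)) * (1 + V)
       \<and> norm V \<le> 12 / (1 - Re s) + 4 * exp (- pi * Im s)"
proof -
  have eta0: "\<eta> \<noteq> 0" using eta by auto
  let ?lhs = "riemann_chi s * \<eta> powr (s - 1) * exp (- (of_real pi * \<i> * \<eta>\<^sup>2))"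
  let ?h = "\<i> * of_real pi * s / 2"
  let ?c = "of_real (ln 2) + of_real (ln pi) + 2 * Ln \<eta> - \<i> * of_real pi / 2"
  obtain E where E: "Gamma (1 - s) = of_real (sqrt (2 * pi)) * stirling_term (1 - s) * (1 + E)"
    "norm E \<le> 12 / Re (1 - s)"
    using stirling_bound[of "1 - s"] big by auto
  define d where "d = exp (\<i> * of_real pi * s)"
  define V where "V = (1 + E) * (1 - d) - 1"
  have d: "norm d = exp (- pi * Im s)" unfolding d_def by simp
  have E3: "norm E \<le> 3"
  proof -
    have "12 / Re (1 - s) \<le> 3" using big by (simp add: field_simps)
    then show ?thesis using E(2) by linarith
  qed
  have Vle: "norm V \<le> 12 / (1 - Re s) + 4 * exp (- pi * Im s)"
  proof -
    have "V = E - (1 + E) * d" unfolding V_def by (simp add: algebra_simps)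
    then have "norm V \<le> norm E + norm ((1 + E) * d)" by (simp add: norm_triangle_ineq4)
    also have "norm ((1 + E) * d) \<le> 4 * norm d"
      using E3 norm_triangle_ineq[of 1 E] by (simp add: norm_mult mult_right_mono)
    finally show ?thesis using E(2) d by simp
  qed
  \<comment> \<open>The argument of eta^2 lies between 0 and pi; the factor -i brings it into
    (-pi/2, pi/2), so this is the principal logarithm.\<close>
  have ln1s: "Ln (1 - s) = ?c"
  proof (rule Ln_unique)
    show "exp (?c) = 1 - s"
    proof -
      have "exp (2 * Ln \<eta>) = \<eta>\<^sup>2" using eta0 by (simp add: exp_double)
      moreover have "exp (\<i> * of_real pi / 2) = \<i>"
        using cis_pi_half by (simp add: cis_conv_exp)
      ultimately show ?thesis unfolding s
        by (simp add: exp_add exp_diff exp_of_real divide_i)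
    qed
    have "0 < Im (Ln \<eta>)" using eta eta0 Im_Ln_pos_lt[of \<eta>] by blast
    moreover have "Re \<eta> > 0" using eta by linarith
    then have "Im (Ln \<eta>) < pi / 2" using eta0 Re_Ln_pos_lt[of \<eta>] by linarith
    ultimately have "0 < Im (Ln \<eta>)" "Im (Ln \<eta>) < pi / 2" by auto
    then show "- pi < Im (?c)"
      "Im (?c) \<le> pi"
      using pi_gt_zero by (simp_all add: Im_divide_numeral)
  qed
  \<comment> \<open>In the upper half-plane exp(-i pi s / 2) dominates; it is pulled out, and the
    other exponential becomes the relative correction d.\<close>
  have sin: "sin (of_real pi * (s / 2)) = \<i> / 2 * exp (- (?h)) * (1 - d)"
  proof -
    have "d = exp (?h) * exp (?h)"
      unfolding d_def exp_add[symmetric] by (simp add: mult_ac)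
    moreover have "exp (- (?h)) * exp (?h) = 1"
      unfolding exp_add[symmetric] by simp
    ultimately have "exp (- (?h)) * (1 - d) = exp (- (?h)) - exp (?h)"
      by (simp add: algebra_simps)
    moreover have "sin (of_real pi * (s / 2)) = (exp (?h) - exp (- (?h))) / (2 * \<i>)"
      unfolding sin_exp_eq by (simp add: mult_ac)
    ultimately show ?thesis by (simp add: divide_simps) (simp add: algebra_simps)
  qed
  have ihalf: "\<i> / 2 = exp (\<i> * of_real pi / 2 - of_real (ln 2))"
    using cis_pi_half by (simp add: exp_diff cis_conv_exp exp_of_real)
  have sqpi: "sqrt pi = exp (ln pi / 2)" "sqrt (2 * pi) = exp ((ln 2 + ln pi) / 2)"
    using powr_half_sqrt[of pi] powr_half_sqrt[of "2 * pi"] by (simp_all add: powr_def ln_mult)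
  have pip: "of_real pi powr (s - 1/2) = exp ((s - 1/2) * of_real (ln pi))"
    by (simp add: powr_def Ln_of_real)
  have ipi: "1 / of_real pi = exp (- of_real (ln pi) :: complex)"
    by (simp add: exp_minus exp_of_real inverse_eq_divide)
  have comb: "?lhs
     = (exp ((s - 1/2) * of_real (ln pi)) * exp (s * of_real (ln 2)) * exp (of_real (ln pi / 2))
        * exp (of_real ((ln 2 + ln pi) / 2)) * stirling_term (1 - s) * exp (\<i> * of_real pi / 2 - of_real (ln 2))
        * exp (- (?h)) * exp (- of_real (ln pi)) * exp ((s - 1) * Ln \<eta>)
        * exp (- (of_real pi * \<i> * \<eta>\<^sup>2))) * ((1 + E) * (1 - d))"
  proof -
    have "Re s < 1" using big by simp
    note chi = riemann_chi_alt[OF this]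
    have gen: "A * (B * S * (G * T * u)) * (h * x * v / p) * w * f
        = A * B * S * G * T * h * x * (1 / p) * w * f * (u * v)"
      for A B S G T u h x v p w f :: complex
      by (simp add: divide_inverse mult_ac)
    have "?lhs
     = of_real pi powr (s - 1/2) * exp (s * of_real (ln 2)) * of_real (sqrt pi) 
        * of_real (sqrt (2 * pi)) * stirling_term (1 - s) * (\<i> / 2)
        * exp (- (?h)) * (1 / of_real pi) * (\<eta> powr (s - 1))
        * exp (- (of_real pi * \<i> * \<eta>\<^sup>2)) * ((1 + E) * (1 - d))"
      unfolding chi E(1) sin by (rule gen)
    moreover have "\<eta> powr (s - 1) = exp ((s - 1) * Ln \<eta>)" using eta0 by (simp add: powr_def)
    ultimately show ?thesis unfolding pip ihalf ipi sqpi by (simp only: exp_of_real[symmetric])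
  qed
  have collect: "exp a1 * exp a2 * exp a3 * exp a4 * exp a5 * exp a6 * exp a7 * exp a8 * exp a9 * exp a10 = exp b"
    if "a1 + a2 + a3 + a4 + a5 + a6 + a7 + a8 + a9 + a10 = b" for a1 a2 a3 a4 a5 a6 a7 a8 a9 a10 b :: complex
    unfolding that[symmetric] exp_add ..
  define P where "P = (of_real (ln pi) :: complex)"
  define T where "T = (of_real (ln 2) :: complex)"
  define Q where "Q = \<i> * (of_real pi :: complex)"
  define L where "L = Ln \<eta>"
  have q: "of_real pi * \<i> * \<eta>\<^sup>2 = (s - 1) / 2" unfolding s by simp
  have r: "of_real (ln pi / 2) = P / 2" "of_real ((ln 2 + ln pi) / 2) = (T + P) / 2"
    unfolding P_def T_def by simp_all
  \<comment> \<open>The summands are the exponents of \<open>comb\<close> in order, with Ln(1 - s) =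
    T + P + 2 L - Q / 2. P and T cancel entirely, and Q leaves the phase pi / 4.\<close>
  have "(s - 1 / 2) * P + s * T + P / 2 + (T + P) / 2
      + ((1 - s - 1 / 2) * (T + P + 2 * L - Q / 2) - (1 - s)) + (Q / 2 - T) + - (Q * s / 2) + - P
      + (s - 1) * L + - ((s - 1) / 2) = Q / 4 + - s * L + (s - 1) / 2"
    by (simp add: field_simps)
  note expo = collect[OF this]
  have "?lhs
      = exp (\<i> * of_real pi / 4 + - s * Ln \<eta> + of_real pi * \<i> * \<eta>\<^sup>2) * ((1 + E) * (1 - d))"
    unfolding comb stirling_term_def ln1s unfolding q r P_def[symmetric] T_def[symmetric] Q_def[symmetric] L_def[symmetric]
    unfolding expo ..
  also have "\<dots> = exp (\<i> * of_real pi / 4) * (\<eta> powr (- s) * exp (of_real pi * \<i> * \<eta>\<^sup>2)) * (1 + V)"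
  proof -
    have "\<eta> powr (- s) = exp (- s * Ln \<eta>)" using eta0 by (simp add: powr_def)
    moreover have "(1 + E) * (1 - d) = 1 + V" unfolding V_def by simp
    ultimately show ?thesis by (simp only: exp_add mult.assoc)
  qed
  finally show ?thesis using Vle by (intro exI[of _ V] conjI)
qed

section \<open>Residues between parallel lines\<close>

text \<open>
  Rotated coordinates: \<open>line_pt b q\<close> is \<open>exp (i \<pi> / 4) (q - i b)\<close>. For fixed \<open>b\<close> it runs along the line of
  direction \<open>exp (i \<pi> / 4)\<close> that crosses the real axis at \<open>b\<close> times the square root of \<open>2\<close>.
\<close>
definition line_pt :: "real \<Rightarrow> real \<Rightarrow> complex" where
  "line_pt b q = Complex ((q + b) / sqrt 2) ((q - b) / sqrt 2)"

definition two_i_sin :: "complex \<Rightarrow> complex" where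
  "two_i_sin x = exp (of_real pi * \<i> * x) - exp (- (of_real pi * \<i> * x))"

text \<open>The sign records the orientation from upper right to lower left, opposite to increasing
  q; the exponential is dx/dq.\<close>

definition line_int :: "(complex \<Rightarrow> complex) \<Rightarrow> real \<Rightarrow> complex" where
  "line_int F b = - exp (\<i> * of_real pi / 4) * (LINT q|lborel. F (line_pt b q))"

lemma Re_line_pt [simp]: "Re (line_pt b q) = (q + b) / sqrt 2"
  and Im_line_pt [simp]: "Im (line_pt b q) = (q - b) / sqrt 2"
  by (simp_all add: line_pt_def)

lemma exp_i_pi_4: "exp (\<i> * of_real pi / 4) = Complex (1 / sqrt 2) (1 / sqrt 2)"
proof -
  have "exp (\<i> * of_real pi / 4) = cis (pi / 4)" by (simp add: cis_conv_exp)
  also have "\<dots> = Complex (1 / sqrt 2) (1 / sqrt 2)"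
    by (simp add: complex_eq_iff cos_45 sin_45 real_div_sqrt field_simps)
  finally show ?thesis .
qed

lemma line_pt_eq: "line_pt b q = Complex (1 / sqrt 2) (- (1 / sqrt 2)) * Complex b q"
  by (simp add: complex_eq_iff field_simps)

lemma two_i_sin_eq: "two_i_sin x = 2 * \<i> * sin (of_real pi * x)"
  unfolding two_i_sin_def sin_exp_eq by (simp add: mult_ac)

lemma two_i_sin_eq_0_iff: "two_i_sin x = 0 \<longleftrightarrow> (\<exists>m::int. x = of_int m)"
  unfolding two_i_sin_eq by (auto simp: sin_eq_0)

lemma norm_two_i_sin_sq: "(norm (two_i_sin x))\<^sup>2 = exp (2 * pi * Im x) + exp (- (2 * pi * Im x)) - 2 * cos (2 * pi * Re x)"
proof -
  have "(norm (two_i_sin x))\<^sup>2 = 4 * (norm (sin (of_real pi * x)))\<^sup>2"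
    unfolding two_i_sin_eq by (simp add: norm_mult power_mult_distrib)
  also have "\<dots> = exp (2 * pi * Im x) + exp (- (2 * pi * Im x)) - 2 * cos (2 * pi * Re x)"
    unfolding norm_sin_squared by (simp add: exp_minus mult.assoc)
  finally show ?thesis .
qed

lemma norm_two_i_sin_ge_1:
  assumes "\<bar>Im x\<bar> \<ge> 1"
  shows "norm (two_i_sin x) \<ge> 1"
proof -
  have "exp (2 * pi * \<bar>Im x\<bar>) \<ge> 1 + 2 * pi * \<bar>Im x\<bar>" by (rule exp_ge_add_one_self)
  moreover have "2 * pi * \<bar>Im x\<bar> \<ge> 2 * 3 * 1" using assms pi_gt3 by (intro mult_mono) auto
  moreover have "exp (2 * pi * Im x) + exp (- (2 * pi * Im x)) \<ge> exp (2 * pi * \<bar>Im x\<bar>)"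
    by (cases "Im x \<ge> 0") auto
  moreover have "cos (2 * pi * Re x) \<le> 1" by simp
  ultimately have "(norm (two_i_sin x))\<^sup>2 \<ge> 1\<^sup>2" unfolding norm_two_i_sin_sq one_power2 by linarith
  then show ?thesis by (rule power2_le_imp_le) simp
qed

text \<open>The left-hand side is the squared norm of \<open>two_i_sin\<close> on a half-integer
  line. If exp |y| >= 4, then cos y >= -1 suffices; otherwise |y| is small enough for the quadratic
  bounds on exp and cos.\<close>

lemma cosh_plus_cos_ge: "exp y + exp (- y) + 2 * cos y \<ge> exp \<bar>y\<bar> / (2::real)"
proof -
  define z where "z = \<bar>y\<bar>"
  have z: "z \<ge> 0" "exp y + exp (- y) = exp z + exp (- z)" "cos y = cos z"
    unfolding z_def by (auto simp: abs_if)
  have 1: "exp z \<ge> 1 + z + z\<^sup>2 / 2" "exp (- z) \<ge> 1 + - z"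
    using exp_lower_Taylor_quadratic[OF z(1)] exp_ge_add_one_self[of "- z"] by simp_all
  have 2: "cos z \<ge> 1 - z\<^sup>2 / 2"
  proof -
    have "\<bar>sin (z / 2)\<bar> \<le> \<bar>z / 2\<bar>" by (rule abs_sin_x_le_abs_x)
    then have "(sin (z / 2))\<^sup>2 \<le> (z / 2)\<^sup>2" by (simp only: abs_le_square_iff)
    moreover have "cos z = 1 - 2 * (sin (z / 2))\<^sup>2" using cos_double_sin[of "z / 2"] by simp
    ultimately show ?thesis by (simp add: power_divide)
  qed
  show ?thesis
  proof (cases "exp z \<ge> 4")
    case True
    have "cos z \<ge> -1" by simp
    then show ?thesis unfolding z using True exp_gt_zero[of "-z"] unfolding z_def[symmetric] by linarith
  next
    case False
    have "z\<^sup>2 / 2 \<le> 2"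
    proof (cases "z \<ge> 1")
      case False
      then have "z\<^sup>2 \<le> 1\<^sup>2" using z by (intro power_mono) auto
      then show ?thesis by simp
    qed (use 1 \<open>\<not> exp z \<ge> 4\<close> in linarith)
    then show ?thesis using False unfolding z using 1 2 unfolding z_def[symmetric] by linarith
  qed
qed

text \<open>Here Re x - Im x = n + 1/2, so 2 pi Re x and 2 pi Im x differ by an odd multiple of pi
  and the cosine in \<open>norm_two_i_sin_sq\<close> changes sign. The line thus stays away from the
  zeros, with exponential growth in both directions.\<close>

lemma norm_two_i_sin_half_integer_line:
  assumes "sqrt 2 * b = of_int n + 1/2"
  shows "norm (two_i_sin (line_pt b q)) \<ge> exp (pi * \<bar>q - b\<bar> / sqrt 2) / 2"
proof -
  define y where "y = 2 * pi * ((q - b) / sqrt 2)"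
  let ?t = "(norm (two_i_sin (line_pt b q)))\<^sup>2"
  have eq: "2 * pi * ((q + b) / sqrt 2) = y + (2 * pi * of_int n + pi)"
  proof -
    have "(q + b) / sqrt 2 = (q - b) / sqrt 2 + sqrt 2 * b"
      by (simp add: field_simps)
    then show ?thesis unfolding y_def assms by (simp add: algebra_simps)
  qed
  have "cos (2 * pi * ((q + b) / sqrt 2)) = - cos y"
    unfolding eq cos_add sin_add cos_int_2pin sin_int_2pin cos_pi sin_pi by simp
  then have "?t = exp y + exp (- y) + 2 * cos y"
    unfolding norm_two_i_sin_sq Re_line_pt Im_line_pt y_def[symmetric] by (simp only: mult_minus_right diff_minus_eq_add)
  also have "\<dots> \<ge> exp \<bar>y\<bar> / 2" by (rule cosh_plus_cos_ge)
  finally have "exp \<bar>y\<bar> / 2 \<le> ?t" .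
  moreover have "(exp (pi * \<bar>q - b\<bar> / sqrt 2) / 2)\<^sup>2 \<le> exp \<bar>y\<bar> / 2"
  proof -
    have "exp (pi * \<bar>q - b\<bar> / sqrt 2) ^ 2 = exp \<bar>y\<bar>"
      unfolding y_def exp_double[symmetric]
      by (rule arg_cong[where f = exp]) (simp add: abs_mult)
    then show ?thesis by (simp add: power_divide)
  qed
  ultimately have "(exp (pi * \<bar>q - b\<bar> / sqrt 2) / 2)\<^sup>2 \<le> ?t" by linarith
  then show ?thesis by (rule power2_le_imp_le) simp
qed

lemma integrable_gaussian: "integrable lborel (\<lambda>x::real. exp (- x\<^sup>2))"
proof -
  have "has_bochner_integral lborel (\<lambda>x::real. exp (- x\<^sup>2)) (2 * (sqrt pi / 2))"
    using has_bochner_integral_even_function[OF gaussian_moment_0] by simp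
  then show ?thesis by (rule integrable.intros)
qed

text \<open>Links the Lebesgue integral over a whole line with the truncated integrals that occur as
  sides of rectangles.\<close>

lemma integral_truncation_limit:
  fixes f :: "real \<Rightarrow> complex"
  assumes "integrable lborel f"
  shows "(\<lambda>N. integral {- real N..real N} f) \<longlonglongrightarrow> integral\<^sup>L lborel f"
proof -
  have "(f has_integral integral\<^sup>L lborel f) UNIV" by (rule has_integral_integral_lborel[OF assms])
  then have *: "\<And>e. e > 0 \<Longrightarrow> \<exists>B>0. \<forall>a b. ball 0 B \<subseteq> cbox a b \<longrightarrow> norm (integral (cbox a b) f - integral\<^sup>L lborel f) < e"
    unfolding has_integral_alt'[of f] by simp
  show ?thesis
  proof (rule LIMSEQ_I)
    fix r :: real assume "r > 0"
    then obtain B where B: "B > 0" "\<And>a b. ball 0 B \<subseteq> cbox a b \<Longrightarrow> norm (integral (cbox a b) f - integral\<^sup>L lborel f) < r"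
      using * by blast
    show "\<exists>no. \<forall>n\<ge>no. norm (integral {- real n..real n} f - integral\<^sup>L lborel f) < r"
    proof (intro exI allI impI)
      fix n assume "n \<ge> nat \<lceil>B\<rceil>"
      then have "B \<le> real n" by linarith
      then have "ball 0 B \<subseteq> cbox (- real n) (real n)" by (auto simp: dist_real_def)
      from B(2)[OF this] show "norm (integral {- real n..real n} f - integral\<^sup>L lborel f) < r" by simp
    qed
  qed
qed

lemma continuous_on_line_pt [continuous_intros]: "continuous_on A (line_pt b)"
  unfolding line_pt_def[abs_def] Complex_eq by (intro continuous_intros) auto

lemma integrable_line:
  assumes b: "sqrt 2 * b = of_int n + 1/2"
    and cont: "continuous_on (range (line_pt b)) P"
    and bound: "\<And>q. norm (P (line_pt b q)) \<le> C * exp (- q\<^sup>2)"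
  shows "integrable lborel (\<lambda>q. P (line_pt b q) / two_i_sin (line_pt b q))"
proof (rule Bochner_Integration.integrable_bound)
  have C0: "C \<ge> 0" using order_trans[OF norm_ge_zero bound[of 0]] by simp
  show "integrable lborel (\<lambda>q. 2 * C * exp (- q\<^sup>2))" by (intro integrable_mult_right integrable_gaussian)
  have nz: "two_i_sin (line_pt b q) \<noteq> 0" for q
    using norm_two_i_sin_half_integer_line[OF b, of q] exp_gt_zero[of "pi * \<bar>q - b\<bar> / sqrt 2"] by (auto simp del: exp_gt_zero)
  have c: "continuous_on UNIV (\<lambda>q. P (line_pt b q) / two_i_sin (line_pt b q))"
  proof (intro continuous_intros)
    show "continuous_on UNIV (\<lambda>q. P (line_pt b q))"
      by (rule continuous_on_compose2[OF cont continuous_on_line_pt]) auto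
    show "continuous_on UNIV (\<lambda>q. two_i_sin (line_pt b q))"
      unfolding two_i_sin_def by (intro continuous_intros)
  qed (use nz in auto)
  have "(\<lambda>q. P (line_pt b q) / two_i_sin (line_pt b q)) \<in> borel_measurable borel"
    by (rule borel_measurable_continuous_onI[OF c])
  then show "(\<lambda>q. P (line_pt b q) / two_i_sin (line_pt b q)) \<in> borel_measurable lborel"
    by simp
  show "AE q in lborel. norm (P (line_pt b q) / two_i_sin (line_pt b q)) \<le> norm (2 * C * exp (- q\<^sup>2))"
  proof (rule AE_I2)
    fix q
    have "norm (two_i_sin (line_pt b q)) \<ge> 1 / 2"
      using norm_two_i_sin_half_integer_line[OF b, of q] by (rule order_trans[rotated]) simp
    then have "norm (P (line_pt b q) / two_i_sin (line_pt b q)) \<le> (C * exp (- q\<^sup>2)) / (1 / 2)"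
      unfolding norm_divide using bound[of q] C0 by (intro frac_le) auto
    then show "norm (P (line_pt b q) / two_i_sin (line_pt b q)) \<le> norm (2 * C * exp (- q\<^sup>2))"
      using C0 by (simp add: abs_mult)
  qed
qed

lemma cos_pi_of_int: "cos (of_real pi * of_int n) = (if even n then 1 else (-1::complex))"
proof -
  have "of_real pi * of_int n = (of_real (pi * of_int n) :: complex)" by simp
  then have "cos (of_real pi * of_int n) = (of_real (cos (pi * of_int n)) :: complex)"
    by (simp only: cos_of_real)
  then show ?thesis by (cases "even n") simp_all
qed

text \<open>The residue theorem on a rectangle in rotated coordinates, where the two lines become
  vertical sides and the only pole inside is the point z0 corresponding to n. The Gaussian bound
  makes the horizontal sides vanish in the limit.\<close>

lemma line_shift_residue:
  fixes n :: int
  assumes hol: "P holomorphic_on {x. of_int n - 3/4 < Re x - Im x \<and> Re x - Im x < of_int n + 3/4}"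
    and bound: "\<And>b q. \<bar>sqrt 2 * b - of_int n\<bar> \<le> 1/2 \<Longrightarrow> norm (P (line_pt b q)) \<le> C * exp (- q\<^sup>2)"
  shows "line_int (\<lambda>x. P x / two_i_sin x) ((of_int n - 1/2) / sqrt 2)
       = line_int (\<lambda>x. P x / two_i_sin x) ((of_int n + 1/2) / sqrt 2) + cos (of_real pi * of_int n) * P (of_int n)"
proof -
  define \<kappa> where "\<kappa> = Complex (1 / sqrt 2) (- (1 / sqrt 2))"
  have lp: "line_pt b q = \<kappa> * Complex b q" for b q unfolding \<kappa>_def by (rule line_pt_eq)
  have \<kappa>i: "\<kappa> * exp (\<i> * of_real pi / 4) = 1" "exp (\<i> * of_real pi / 4) = \<i> * \<kappa>"
    unfolding \<kappa>_def exp_i_pi_4 by (simp_all add: complex_eq_iff)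
  then have \<kappa>0: "\<kappa> \<noteq> 0" by auto
  define h where "h \<zeta> = P (\<kappa> * \<zeta>) / two_i_sin (\<kappa> * \<zeta>)" for \<zeta>
  \<comment> \<open>A strip slightly wider than the rectangle: 3/4 exceeds the half-width 1/2 but
    stays below the distance 1 to the neighbouring poles.\<close>
  define S where "S = {\<zeta>::complex. of_int n - 3/4 < sqrt 2 * Re \<zeta> \<and> sqrt 2 * Re \<zeta> < of_int n + 3/4}"
  define z0 where "z0 = of_int n * exp (\<i> * of_real pi / 4)"
  let ?D = "\<kappa> * (2 * of_real pi * \<i> * cos (of_real pi * of_int n))"
  have kz0: "\<kappa> * z0 = of_int n" unfolding z0_def using \<kappa>i(1) by (simp add: mult.left_commute)
  have Rek: "Re (\<kappa> * \<zeta>) - Im (\<kappa> * \<zeta>) = sqrt 2 * Re \<zeta>" for \<zeta>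
    unfolding \<kappa>_def by (simp add: field_simps)
  have openS: "open S" unfolding S_def
    by (intro open_Collect_conj open_Collect_less continuous_intros)
  have convS: "convex S"
  proof -
    have "S = {\<zeta>. (of_int n - 3/4) / sqrt 2 < Re \<zeta>} \<inter> {\<zeta>. Re \<zeta> < (of_int n + 3/4) / sqrt 2}"
      unfolding S_def by (auto simp: field_simps)
    then show ?thesis by (auto intro: convex_Int convex_halfspace_Re_lt convex_halfspace_Re_gt)
  qed
  have holP: "(\<lambda>\<zeta>. P (\<kappa> * \<zeta>)) holomorphic_on S"
  proof -
    have "(\<lambda>\<zeta>. \<kappa> * \<zeta>) holomorphic_on S" by (intro holomorphic_intros)
    moreover have "(\<lambda>\<zeta>. \<kappa> * \<zeta>) ` S \<subseteq> {x. of_int n - 3/4 < Re x - Im x \<and> Re x - Im x < of_int n + 3/4}"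
      by (rule image_subsetI) (simp only: Rek S_def mem_Collect_eq)
    ultimately show ?thesis using holomorphic_on_compose_gen[OF _ hol] unfolding o_def by blast
  qed
  have zS: "z0 \<in> S" unfolding S_def z0_def exp_i_pi_4 by simp
  have nz: "two_i_sin (\<kappa> * \<zeta>) \<noteq> 0" if "\<zeta> \<in> S" "\<zeta> \<noteq> z0" for \<zeta>
  proof
    assume "two_i_sin (\<kappa> * \<zeta>) = 0"
    then obtain m :: int where m: "\<kappa> * \<zeta> = of_int m" by (auto simp: two_i_sin_eq_0_iff)
    have "sqrt 2 * Re \<zeta> = of_int m" using Rek[of \<zeta>] unfolding m by simp
    then have "m = n" using that(1) unfolding S_def by auto
    then have "\<kappa> * \<zeta> = \<kappa> * z0" using m kz0 by simp
    then show False using \<kappa>0 that(2) by simp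
  qed
  have holh: "h holomorphic_on (S - {z0})"
    unfolding h_def
  proof (rule holomorphic_on_divide)
    show "(\<lambda>\<zeta>. P (\<kappa> * \<zeta>)) holomorphic_on S - {z0}"
      by (rule holomorphic_on_subset[OF holP]) blast
    show "(\<lambda>\<zeta>. two_i_sin (\<kappa> * \<zeta>)) holomorphic_on S - {z0}"
      unfolding two_i_sin_def by (intro holomorphic_intros)
  qed (use nz in blast)
  have sincos: "(?D) \<noteq> (0::complex)"
    using \<kappa>0 by (simp add: cos_pi_of_int)
  have res: "residue h z0 = P (of_int n) / (?D)"
  proof (rule residue_simple'[OF openS zS holh])
    have "((\<lambda>\<zeta>. two_i_sin (\<kappa> * \<zeta>)) has_field_derivative (\<kappa> * (2 * of_real pi * \<i> * cos (of_real pi * (\<kappa> * z0))))) (at z0)"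
      unfolding two_i_sin_eq by (auto intro!: derivative_eq_intros simp: mult_ac)
    then have "((\<lambda>\<zeta>. (two_i_sin (\<kappa> * \<zeta>) - two_i_sin (\<kappa> * z0)) / (\<zeta> - z0)) \<longlongrightarrow> ?D) (at z0)"
      unfolding has_field_derivative_iff kz0 .
    moreover have "two_i_sin (\<kappa> * z0) = 0" unfolding kz0 two_i_sin_eq_0_iff by blast
    ultimately have l1: "((\<lambda>\<zeta>. two_i_sin (\<kappa> * \<zeta>) / (\<zeta> - z0)) \<longlongrightarrow> ?D) (at z0)"
      by simp
    have "isCont (\<lambda>\<zeta>. P (\<kappa> * \<zeta>)) z0"
      using holP openS zS by (metis continuous_on_eq_continuous_at holomorphic_on_imp_continuous_on)
    then have "((\<lambda>\<zeta>. P (\<kappa> * \<zeta>)) \<longlongrightarrow> P (of_int n)) (at z0)" by (simp add: isCont_def kz0)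
    from tendsto_divide[OF this l1 sincos]
    show "((\<lambda>\<zeta>. h \<zeta> * (\<zeta> - z0)) \<longlongrightarrow> P (of_int n) / (?D)) (at z0)"
      unfolding h_def by simp
  qed
  define b1 where "b1 = (of_int n - 1/2) / sqrt 2"
  define b2 where "b2 = (of_int n + 1/2) / sqrt 2"
  have b12: "b1 < b2" unfolding b1_def b2_def by (intro divide_strict_right_mono) auto
  have sb: "sqrt 2 * b1 = of_int n - 1/2" "sqrt 2 * b2 = of_int n + 1/2" unfolding b1_def b2_def by simp_all
  have bb: "\<bar>sqrt 2 * b - of_int n\<bar> \<le> 1/2" if "b \<in> {b1..b2}" for b
  proof -
    have "sqrt 2 * b1 \<le> sqrt 2 * b" "sqrt 2 * b \<le> sqrt 2 * b2" using that by auto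
    then show ?thesis unfolding sb by linarith
  qed
  have C0: "C \<ge> 0"
    using order_trans[OF norm_ge_zero bound[OF bb[of b1], of 0]] b12 by simp
  have conth: "continuous_on (S - {z0}) h" using holh by (rule holomorphic_on_imp_continuous_on)
  have inS: "\<zeta> \<in> S - {z0}" if "Re \<zeta> \<in> {b1..b2}" "\<zeta> \<noteq> z0" for \<zeta>
  proof -
    have "of_int n - 3/4 < sqrt 2 * Re \<zeta>" "sqrt 2 * Re \<zeta> < of_int n + 3/4"
      using bb[OF that(1)] unfolding abs_le_iff by linarith+
    then show ?thesis using that(2) unfolding S_def by blast
  qed
  define I1 where "I1 R = integral {- R..R} (\<lambda>q. h (Complex b1 q))" for R
  define I2 where "I2 R = integral {- R..R} (\<lambda>q. h (Complex b2 q))" for R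
  \<comment> \<open>For R beyond this value, points of the horizontal sides satisfy |r - b| >= 2,
    hence |Im x| >= 1, where the denominator is at least 1.\<close>
  define R0 where "R0 = \<bar>b1\<bar> + \<bar>b2\<bar> + \<bar>Im z0\<bar> + 2"
  let ?r = "2 * of_real pi * \<i> * residue h z0"
  let ?L1 = "(LINT q|lborel. h (Complex b1 q))"
  let ?L2 = "(LINT q|lborel. h (Complex b2 q))"
  have Rez0: "sqrt 2 * Re z0 = of_int n" unfolding z0_def exp_i_pi_4 by simp
  have key: "norm (\<i> * (I2 R - I1 R) - ?r) \<le> 2 * (C * exp (- R\<^sup>2) * (b2 - b1))"
    if R: "R \<ge> R0" for R
  proof -
    define a1 where "a1 = Complex b1 (- R)"
    define a2 where "a2 = Complex b2 (- R)"
    define a3 where "a3 = Complex b2 R"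
    define a4 where "a4 = Complex b1 R"
    have R2: "R \<ge> 2" "R > \<bar>Im z0\<bar>" using R unfolding R0_def by auto
    have rect: "rectpath a1 a3 = linepath a1 a2 +++ linepath a2 a3 +++ linepath a3 a4 +++ linepath a4 a1"
      unfolding rectpath_def Let_def a1_def a2_def a3_def a4_def by simp
    have z0b: "z0 \<in> box a1 a3"
    proof -
      have "sqrt 2 * b1 < sqrt 2 * Re z0" "sqrt 2 * Re z0 < sqrt 2 * b2" unfolding sb Rez0 by auto
      then show ?thesis using R2 unfolding a1_def a3_def by (auto simp: in_box_complex_iff)
    qed
    have z0n: "z0 \<notin> path_image (rectpath a1 a3)"
      using z0b b12 R2 unfolding a1_def a3_def by (subst path_image_rectpath_cbox_minus_box) auto
    have subcb: "path_image (rectpath a1 a3) \<subseteq> cbox a1 a3"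
      using b12 R2 unfolding a1_def a3_def by (intro path_image_rectpath_subset_cbox) auto
    have cbS: "cbox a1 a3 - {z0} \<subseteq> S - {z0}"
    proof
      fix \<zeta> assume "\<zeta> \<in> cbox a1 a3 - {z0}"
      then show "\<zeta> \<in> S - {z0}" by (intro inS) (auto simp: in_cbox_complex_iff a1_def a3_def)
    qed
    have piS: "path_image (rectpath a1 a3) \<subseteq> S - {z0}" using subcb cbS z0n by blast
    have cbS': "cbox a1 a3 \<subseteq> S" using cbS zS by auto
    have "contour_integral (rectpath a1 a3) h = 2 * pi * \<i> * (\<Sum>p\<in>{z0}. winding_number (rectpath a1 a3) p * residue h p)"
    proof (rule Residue_theorem[OF openS convex_connected[OF convS] _ holh])
      show "\<forall>z. z \<notin> S \<longrightarrow> winding_number (rectpath a1 a3) z = 0"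
        using cbS' b12 R2 by (auto intro!: winding_number_rectpath_outside simp: a1_def a3_def)
    qed (use piS in auto)
    then have CI: "contour_integral (rectpath a1 a3) h = ?r"
      using winding_number_rectpath[OF z0b] by simp
    have segs: "closed_segment a1 a2 \<subseteq> S - {z0}" "closed_segment a2 a3 \<subseteq> S - {z0}"
       "closed_segment a3 a4 \<subseteq> S - {z0}" "closed_segment a4 a1 \<subseteq> S - {z0}"
      using piS unfolding rect by (auto simp: path_image_join)
    have ci: "h contour_integrable_on linepath a1 a2" "h contour_integrable_on linepath a2 a3"
       "h contour_integrable_on linepath a3 a4" "h contour_integrable_on linepath a4 a1"
      using segs by (auto intro!: contour_integrable_continuous_linepath continuous_on_subset[OF conth])
    have sum: "contour_integral (rectpath a1 a3) h = contour_integral (linepath a1 a2) h + 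
       (contour_integral (linepath a2 a3) h + (contour_integral (linepath a3 a4) h + contour_integral (linepath a4 a1) h))"
      unfolding rect using ci by (simp add: contour_integrable_joinI valid_path_join)
    have right: "contour_integral (linepath a2 a3) h = \<i> * I2 R"
      unfolding I2_def by (rule contour_integral_linepath_same_Re) (use R2 in \<open>auto simp: a2_def a3_def\<close>)
    have "contour_integral (linepath a1 a4) h = \<i> * I1 R"
      unfolding I1_def by (rule contour_integral_linepath_same_Re) (use R2 in \<open>auto simp: a1_def a4_def\<close>)
    then have left: "contour_integral (linepath a4 a1) h = - (\<i> * I1 R)"
      using contour_integral_reverse_linepath[of a4 a1 h] segs(4) by (auto intro: continuous_on_subset[OF conth])
    have hb: "norm (h (Complex b r)) \<le> C * exp (- R\<^sup>2)" if "b \<in> {b1..b2}" "\<bar>r\<bar> = R" for b r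
    proof -
      have "\<bar>b\<bar> \<le> R - 2" using that(1) R unfolding R0_def by auto
      then have "2 \<le> \<bar>r - b\<bar>" using that(2) by linarith
      moreover have "sqrt 2 \<le> 2" by (rule real_le_lsqrt) auto
      ultimately have "1 \<le> \<bar>(r - b) / sqrt 2\<bar>" by (simp add: field_simps)
      then have "norm (two_i_sin (line_pt b r)) \<ge> 1" by (intro norm_two_i_sin_ge_1) simp
      moreover have "norm (P (line_pt b r)) \<le> C * exp (- r\<^sup>2)" by (intro bound bb that)
      moreover have "r\<^sup>2 = R\<^sup>2" using that(2) by (metis power2_abs)
      ultimately have "norm (P (line_pt b r)) / norm (two_i_sin (line_pt b r)) \<le> (C * exp (- R\<^sup>2)) / 1"
        using C0 by (intro frac_le) auto
      then show ?thesis unfolding h_def lp[symmetric] by (simp add: norm_divide)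
    qed
    have bot: "norm (contour_integral (linepath a1 a2) h) \<le> C * exp (- R\<^sup>2) * norm (a2 - a1)"
    proof (rule contour_integral_bound_linepath[OF ci(1)])
      fix x assume "x \<in> closed_segment a1 a2"
      then have "x = Complex (Re x) (- R)" "Re x \<in> {b1..b2}"
        using b12 by (auto simp: a1_def a2_def closed_segment_same_Im closed_segment_eq_real_ivl complex_eq_iff)
      then show "norm (h x) \<le> C * exp (- R\<^sup>2)" using hb[of "Re x" "- R"] R2 by simp
    qed (use C0 in auto)
    have top: "norm (contour_integral (linepath a3 a4) h) \<le> C * exp (- R\<^sup>2) * norm (a4 - a3)"
    proof (rule contour_integral_bound_linepath[OF ci(3)])
      fix x assume "x \<in> closed_segment a3 a4"
      then have "x = Complex (Re x) R" "Re x \<in> {b1..b2}"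
        using b12 by (auto simp: a3_def a4_def closed_segment_same_Im closed_segment_eq_real_ivl complex_eq_iff)
      then show "norm (h x) \<le> C * exp (- R\<^sup>2)" using hb[of "Re x" "R"] R2 by simp
    qed (use C0 in auto)
    have n12: "norm (a2 - a1) = b2 - b1" "norm (a4 - a3) = b2 - b1"
      unfolding a1_def a2_def a3_def a4_def using b12 by (simp_all add: cmod_def)
    have "\<i> * (I2 R - I1 R) - ?r
       = - (contour_integral (linepath a1 a2) h + contour_integral (linepath a3 a4) h)"
      unfolding CI[symmetric] sum right left by (simp add: algebra_simps)
    then have "norm (\<i> * (I2 R - I1 R) - ?r)
      \<le> norm (contour_integral (linepath a1 a2) h) + norm (contour_integral (linepath a3 a4) h)"
      by (simp only: norm_minus_cancel norm_triangle_ineq)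
    then show ?thesis using bot top unfolding n12 by linarith
  qed
  have cont1: "continuous_on (range (line_pt b)) P" if "b \<in> {b1..b2}" for b
  proof (rule continuous_on_subset[OF holomorphic_on_imp_continuous_on[OF hol]])
    show "range (line_pt b) \<subseteq> {x. of_int n - 3/4 < Re x - Im x \<and> Re x - Im x < of_int n + 3/4}"
  proof (rule image_subsetI, unfold lp mem_Collect_eq Rek complex.sel)
      show "of_int n - 3/4 < sqrt 2 * b \<and> sqrt 2 * b < of_int n + 3/4"
        using bb[OF that] unfolding abs_le_iff by (intro conjI; linarith)
    qed
  qed
  have int: "integrable lborel (\<lambda>q. h (Complex b1 q))" "integrable lborel (\<lambda>q. h (Complex b2 q))"
    unfolding h_def lp[symmetric]
    using integrable_line[of b1 "n - 1" P C] integrable_line[of b2 n P C] cont1 bound bb b12 sb by auto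
  have lims: "(\<lambda>N. I1 (real N)) \<longlonglongrightarrow> ?L1"
      "(\<lambda>N. I2 (real N)) \<longlonglongrightarrow> ?L2"
    unfolding I1_def I2_def by (intro integral_truncation_limit int)+
  have "(\<lambda>N. \<i> * (I2 (real N) - I1 (real N)) - ?r) \<longlonglongrightarrow> 0"
  proof (rule Lim_null_comparison)
    show "\<forall>\<^sub>F N in sequentially. norm (\<i> * (I2 (real N) - I1 (real N)) - ?r)
        \<le> 2 * (C * exp (- (real N)\<^sup>2) * (b2 - b1))"
      using eventually_ge_at_top[of "nat \<lceil>R0\<rceil>"]
      by eventually_elim (intro key, linarith)
    have "(\<lambda>N. exp (- (real N)\<^sup>2)) \<longlonglongrightarrow> 0" by real_asymp
    then have "(\<lambda>N. 2 * (C * exp (- (real N)\<^sup>2) * (b2 - b1))) \<longlonglongrightarrow> 2 * (C * 0 * (b2 - b1))"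
      by (intro tendsto_mult tendsto_const)
    then show "(\<lambda>N. 2 * (C * exp (- (real N)\<^sup>2) * (b2 - b1))) \<longlonglongrightarrow> 0" by simp
  qed
  moreover have "(\<lambda>N. \<i> * (I2 (real N) - I1 (real N)) - ?r)
     \<longlonglongrightarrow> \<i> * (?L2 - ?L1) - ?r"
    by (intro tendsto_intros lims)
  ultimately have "\<i> * (?L2 - ?L1) - ?r = 0"
    by (intro LIMSEQ_unique)
  then have "\<kappa> * (\<i> * (?L2 - ?L1)) = \<kappa> * (?r)"
    by simp
  also have "\<dots> = P (of_int n) / cos (of_real pi * of_int n)"
  proof -
    have "\<kappa> * (w * (p / (\<kappa> * (w * c)))) = p / c" if "w \<noteq> 0" for w p c
      using that \<kappa>0 by (simp add: divide_simps)
    from this[of "2 * of_real pi * \<i>"] show ?thesis unfolding res by simp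
  qed
  also have "\<dots> = cos (of_real pi * of_int n) * P (of_int n)"
    by (simp add: cos_pi_of_int)
  finally have fin: "\<kappa> * (\<i> * (?L2 - ?L1))
      = cos (of_real pi * of_int n) * P (of_int n)" .
  have li: "line_int (\<lambda>x. P x / two_i_sin x) b = - (\<i> * \<kappa>) * (LINT q|lborel. h (Complex b q))" for b
    unfolding line_int_def h_def lp \<kappa>i(2) ..
  show ?thesis
    unfolding b1_def[symmetric] b2_def[symmetric] li fin[symmetric]
  proof -
    have "- (i * k) * x = - (i * k) * y + k * (i * (y - x))" for i k x y :: complex
      by (simp add: algebra_simps)
    then show "- (\<i> * \<kappa>) * ?L1 = - (\<i> * \<kappa>) * ?L2
       + \<kappa> * (\<i> * (?L2 - ?L1))" .
  qed
qed

section \<open>The Mordell integral\<close>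

text \<open>The characteristic function of the standard normal distribution, rescaled by x = 2
  sqrt(pi) p.\<close>

lemma gaussian_fourier:
  fixes c :: real
  shows "integrable lborel (\<lambda>p. exp (complex_of_real (- 2 * pi * p\<^sup>2) + \<i> * of_real (c * p)))" (is ?A)
    and "(LINT p|lborel. exp (complex_of_real (- 2 * pi * p\<^sup>2) + \<i> * of_real (c * p))) = of_real (exp (- (c\<^sup>2) / (8 * pi)) / sqrt 2)" (is ?B)
proof -
  define t where "t = c / (2 * sqrt pi)"
  define h where "h x = std_normal_density x *\<^sub>R iexp (t * x)" for x
  have "char std_normal_distribution t = of_real (exp (- (t\<^sup>2) / 2))"
    by (simp add: char_std_normal_distribution)
  then have h1: "(LINT x|lborel. h x) = of_real (exp (- (t\<^sup>2) / 2))"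
    unfolding char_def h_def by (subst (asm) integral_density) (auto simp: normal_density_nonneg)
  have hi: "integrable lborel h"
  proof -
    interpret prob_space std_normal_distribution by (rule prob_space_normal_density) simp
    have "integrable std_normal_distribution (\<lambda>x. iexp (t * x))"
      by (intro integrable_const_bound[of _ 1]) auto
    then show ?thesis unfolding h_def by (subst (asm) integrable_density) (auto simp: normal_density_nonneg)
  qed
  have s: "2 * sqrt pi \<noteq> 0" by simp
  have hp: "h (2 * sqrt pi * p) = of_real (1 / sqrt (2 * pi)) * exp (complex_of_real (- 2 * pi * p\<^sup>2) + \<i> * of_real (c * p))" for p
  proof -
    have 1: "t * (2 * sqrt pi * p) = c * p" unfolding t_def by simp
    have 2: "std_normal_density (2 * sqrt pi * p) = 1 / sqrt (2 * pi) * exp (- 2 * pi * p\<^sup>2)"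
      unfolding normal_density_def by (simp add: power_mult_distrib)
    show ?thesis unfolding h_def 1 2 exp_add exp_of_real by (simp add: scaleR_conv_of_real)
  qed
  have hi2: "integrable lborel (\<lambda>p. h (2 * sqrt pi * p))"
    using lborel_integrable_real_affine[OF hi s, of 0] by simp
  have h2: "(LINT p|lborel. h (2 * sqrt pi * p)) = of_real (exp (- (t\<^sup>2) / 2)) / of_real (2 * sqrt pi)"
    using lborel_integral_real_affine[OF s, of h 0] h1 by (simp add: scaleR_conv_of_real field_simps)
  have "integrable lborel (\<lambda>p. of_real (sqrt (2 * pi)) * h (2 * sqrt pi * p))"
    by (intro integrable_mult_right hi2)
  moreover have "complex_of_real (sqrt (2 * pi)) * of_real (1 / sqrt (2 * pi)) = 1"
    by (simp flip: of_real_mult)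
  ultimately show ?A unfolding hp mult.assoc[symmetric] by (simp only: mult_1_left)
  have "of_real (1 / sqrt (2 * pi)) * (LINT p|lborel. exp (complex_of_real (- 2 * pi * p\<^sup>2) + \<i> * of_real (c * p)))
     = of_real (exp (- (t\<^sup>2) / 2)) / of_real (2 * sqrt pi)"
    using h2 unfolding hp by simp
  then have "(LINT p|lborel. exp (complex_of_real (- 2 * pi * p\<^sup>2) + \<i> * of_real (c * p)))
     = of_real (sqrt (2 * pi) * (exp (- (t\<^sup>2) / 2) / (2 * sqrt pi)))"
    by (simp add: field_simps)
  also have "sqrt (2 * pi) * (exp (- (t\<^sup>2) / 2) / (2 * sqrt pi)) = exp (- (c\<^sup>2) / (8 * pi)) / sqrt 2"
  proof -
    have "t\<^sup>2 / 2 = c\<^sup>2 / (8 * pi)" unfolding t_def by (simp add: power_divide power_mult_distrib)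
    then have ex: "exp (- (t\<^sup>2) / 2) = exp (- (c\<^sup>2) / (8 * pi))" by simp
    have "sqrt (2 * pi) * (x / (2 * sqrt pi)) = x * (sqrt 2 / 2)" for x
      by (simp add: real_sqrt_mult)
    moreover have "sqrt 2 / 2 = 1 / sqrt (2::real)" by (simp add: field_simps)
    ultimately show ?thesis unfolding ex by simp
  qed
  finally show ?B .
qed

text \<open>Completing the square with the real shift a = Re c / (4 pi) leaves a purely oscillating
  linear term, so no contour has to be moved.\<close>

lemma gaussian_integral_complex:
  fixes c :: complex
  shows "integrable lborel (\<lambda>p. exp (of_real (- 2 * pi * p\<^sup>2) + c * of_real p))" (is ?A)
    and "(LINT p|lborel. exp (of_real (- 2 * pi * p\<^sup>2) + c * of_real p)) = exp (c\<^sup>2 / of_real (8 * pi)) / of_real (sqrt 2)" (is ?B)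
proof -
  define a where "a = Re c / (4 * pi)"
  define f where "f p = exp (of_real (- 2 * pi * p\<^sup>2) + c * of_real p)" for p :: real
  define k where "k = exp (of_real (2 * pi * a\<^sup>2) + \<i> * of_real (Im c * a))"
  have fa: "f (a + 1 * p) = k * exp (complex_of_real (- 2 * pi * p\<^sup>2) + \<i> * of_real (Im c * p))" for p
  proof -
    have c: "c = of_real (4 * pi * a) + \<i> * of_real (Im c)"
      unfolding a_def by (simp add: complex_eq_iff)
    show ?thesis unfolding f_def k_def exp_add[symmetric]
      by (rule arg_cong[where f = exp], subst c)
         (simp add: complex_eq_iff power2_eq_square algebra_simps)
  qed
  have "integrable lborel (\<lambda>p. f (a + 1 * p))"
    unfolding fa by (intro integrable_mult_right gaussian_fourier)
  then have fi: "integrable lborel f"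
    using lborel_integrable_real_affine_iff[of 1 f a] by simp
  then show ?A unfolding f_def .
  have "integral\<^sup>L lborel f = (LINT p|lborel. f (a + 1 * p))"
    using lborel_integral_real_affine[of 1 f a] by simp
  also have "\<dots> = k * of_real (exp (- ((Im c)\<^sup>2) / (8 * pi)) / sqrt 2)"
    unfolding fa gaussian_fourier(2)[symmetric] by simp
  also have "\<dots> = exp (c\<^sup>2 / of_real (8 * pi)) / of_real (sqrt 2)"
  proof -
    have e: "c\<^sup>2 / of_real (8 * pi) = of_real (2 * pi * a\<^sup>2) + \<i> * of_real (Im c * a) + of_real (- ((Im c)\<^sup>2) / (8 * pi))"
      unfolding a_def by (simp add: complex_eq_iff Re_divide_of_real Im_divide_of_real power2_eq_square field_simps del: of_real_mult of_real_divide)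
    show ?thesis unfolding k_def e exp_add exp_of_real by simp
  qed
  finally show ?B unfolding f_def .
qed

definition saddle_gauss :: "complex \<Rightarrow> complex \<Rightarrow> complex" where
  "saddle_gauss \<eta> x = exp (2 * of_real pi * \<i> * (x - \<eta>)\<^sup>2)"

lemma exp_i_pi_4_sq: "(exp (\<i> * of_real pi / 4))\<^sup>2 = \<i>"
  unfolding exp_i_pi_4 by (simp add: complex_eq_iff power2_eq_square)

lemma line_pt_eq_exp: "line_pt b q = exp (\<i> * of_real pi / 4) * (of_real q - \<i> * of_real b)"
  unfolding exp_i_pi_4 by (simp add: complex_eq_iff field_simps)

lemma saddle_gauss_line:
  "integrable lborel (\<lambda>q. saddle_gauss \<eta> (line_pt b q) * exp (of_real k * of_real pi * \<i> * line_pt b q))" (is ?A)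
  "(LINT q|lborel. saddle_gauss \<eta> (line_pt b q) * exp (of_real k * of_real pi * \<i> * line_pt b q))
     = exp (of_real k * of_real pi * \<i> * \<eta> - \<i> * of_real pi * (of_real k)\<^sup>2 / 8) / of_real (sqrt 2)" (is ?B)
proof -
  define e where "e = exp (\<i> * of_real pi / 4)"
  have e2: "e * e = \<i>" using exp_i_pi_4_sq unfolding e_def power2_eq_square .
  have e0: "e \<noteq> 0" unfolding e_def by simp
  define y where "y = \<eta> / e"
  have y: "\<eta> = e * y" unfolding y_def using e0 by simp
  define c where "c = 4 * of_real pi * (\<i> * of_real b + y) + of_real k * of_real pi * \<i> * e"
  define d where "d = - 2 * of_real pi * (\<i> * of_real b + y)\<^sup>2 + of_real k * of_real pi * of_real b * e"
  have eq: "saddle_gauss \<eta> (line_pt b q) * exp (of_real k * of_real pi * \<i> * line_pt b q)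
     = exp d * exp (of_real (- 2 * pi * q\<^sup>2) + c * of_real q)" for q
  proof -
    define Q where "Q = (of_real q :: complex)"
    define B where "B = (of_real b :: complex)"
    have "2 * of_real pi * \<i> * (line_pt b q - \<eta>)\<^sup>2 = 2 * of_real pi * (\<i> * (e * e)) * (Q - (\<i> * B + y))\<^sup>2"
      unfolding line_pt_eq_exp e_def[symmetric] y Q_def B_def by (simp add: power2_eq_square algebra_simps)
    also have "\<dots> = - 2 * of_real pi * (Q - (\<i> * B + y))\<^sup>2" unfolding e2 by simp
    finally have 1: "2 * of_real pi * \<i> * (line_pt b q - \<eta>)\<^sup>2 = - 2 * of_real pi * (Q - (\<i> * B + y))\<^sup>2" .
    have 2: "of_real k * of_real pi * \<i> * line_pt b q = of_real k * of_real pi * \<i> * e * Q + of_real k * of_real pi * B * e"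
      unfolding line_pt_eq_exp e_def[symmetric] Q_def B_def by (simp add: algebra_simps)
    have 3: "complex_of_real (- 2 * pi * q\<^sup>2) = - 2 * of_real pi * Q\<^sup>2" unfolding Q_def by simp
    show ?thesis unfolding saddle_gauss_def exp_add[symmetric] 1 2 3 c_def d_def
      unfolding Q_def[symmetric] B_def[symmetric]
      by (rule arg_cong[where f = exp]) (simp add: power2_eq_square algebra_simps)
  qed
  show ?A unfolding eq by (intro integrable_mult_right gaussian_integral_complex)
  have "d + c\<^sup>2 / of_real (8 * pi) = of_real k * of_real pi * \<i> * \<eta> - \<i> * of_real pi * (of_real k)\<^sup>2 / 8"
  proof -
    define K where "K = (of_real k :: complex)"
    define p where "p = (of_real pi :: complex)"
    define w where "w = \<i> * of_real b + y"
    have p0: "p \<noteq> 0" unfolding p_def by simp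
    have "c\<^sup>2 / (8 * p) = 2 * p * w\<^sup>2 + K * p * \<i> * e * w + K\<^sup>2 * p * (\<i> * \<i>) * (e * e) / 8"
      unfolding c_def w_def[symmetric] K_def[symmetric] p_def[symmetric]
      using p0 by (simp add: power2_eq_square field_simps)
    also have "\<dots> = 2 * p * w\<^sup>2 + K * p * \<i> * e * w - \<i> * p * K\<^sup>2 / 8" unfolding e2 by simp
    finally have "d + c\<^sup>2 / (8 * p) = K * p * \<i> * e * w + K * p * of_real b * e - \<i> * p * K\<^sup>2 / 8"
      unfolding d_def w_def[symmetric] K_def[symmetric] p_def[symmetric] by simp
    also have "K * p * \<i> * e * w + K * p * of_real b * e = K * p * \<i> * \<eta>"
      unfolding w_def y by (simp add: algebra_simps)
    finally show ?thesis unfolding K_def p_def by simp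
  qed
  then have "exp d * exp (c\<^sup>2 / of_real (8 * pi)) = exp (of_real k * of_real pi * \<i> * \<eta> - \<i> * of_real pi * (of_real k)\<^sup>2 / 8)"
    by (simp only: exp_add[symmetric])
  then show ?B unfolding eq integral_mult_right_zero gaussian_integral_complex(2)
    by (simp only: times_divide_eq_right)
qed

lemma line_int_shift: "line_int F (b + 1 / sqrt 2) = line_int (\<lambda>x. F (x + 1)) b"
proof -
  have "line_pt (b + 1 / sqrt 2) (1 / sqrt 2 + 1 * q) = line_pt b q + 1" for q
    by (simp add: complex_eq_iff field_simps)
  then have "(LINT q|lborel. F (line_pt (b + 1 / sqrt 2) q)) = (LINT q|lborel. F (line_pt b q + 1))"
    using lborel_integral_real_affine[of 1 "\<lambda>q. F (line_pt (b + 1 / sqrt 2) q)" "1 / sqrt 2"] by simp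
  then show ?thesis unfolding line_int_def by simp
qed

text \<open>With x - eta = X + i Y the exponent has real part -4 pi X Y, which in rotated
  coordinates is a difference of squares: decay along the line, growth across it.\<close>

lemma norm_saddle_gauss:
  "norm (saddle_gauss \<eta> (line_pt b q))
    = exp (- 2 * pi * (q - (Re \<eta> + Im \<eta>) / sqrt 2)\<^sup>2 + 2 * pi * (b - (Re \<eta> - Im \<eta>) / sqrt 2)\<^sup>2)"
proof -
  have "Re (2 * of_real pi * \<i> * (line_pt b q - \<eta>)\<^sup>2) = - 4 * pi * (((q + b) / sqrt 2 - Re \<eta>) * ((q - b) / sqrt 2 - Im \<eta>))"
  proof -
    have "Re (2 * of_real pi * \<i> * (Complex X Y - \<eta>)\<^sup>2) = - 4 * pi * ((X - Re \<eta>) * (Y - Im \<eta>))" for X Y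
      by (simp add: power2_eq_square algebra_simps)
    then show ?thesis unfolding line_pt_def .
  qed
  also have "\<dots> = - 2 * pi * (q - (Re \<eta> + Im \<eta>) / sqrt 2)\<^sup>2 + 2 * pi * (b - (Re \<eta> - Im \<eta>) / sqrt 2)\<^sup>2"
  proof -
    define r where "r = 1 / sqrt 2"
    have r: "r * r = 1/2" unfolding r_def by simp
    have "4 * (((q + b) * r - Re \<eta>) * ((q - b) * r - Im \<eta>))
        = 4 * (r * r) * (q * q - b * b) - 4 * r * (q + b) * Im \<eta> - 4 * r * (q - b) * Re \<eta> + 4 * Re \<eta> * Im \<eta>"
      by (simp add: algebra_simps)
    also have "\<dots> = 2 * (q * q - b * b) - 4 * r * (q + b) * Im \<eta> - 4 * r * (q - b) * Re \<eta> + 8 * (r * r) * (Re \<eta> * Im \<eta>)"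
      unfolding r by simp
    also have "\<dots> = 2 * (q - (Re \<eta> + Im \<eta>) * r)\<^sup>2 - 2 * (b - (Re \<eta> - Im \<eta>) * r)\<^sup>2"
      by (simp add: power2_eq_square algebra_simps)
    finally have "4 * (((q + b) * r - Re \<eta>) * ((q - b) * r - Im \<eta>))
       = 2 * (q - (Re \<eta> + Im \<eta>) * r)\<^sup>2 - 2 * (b - (Re \<eta> - Im \<eta>) * r)\<^sup>2" .
    then have "- pi * (4 * (((q + b) * r - Re \<eta>) * ((q - b) * r - Im \<eta>)))
       = - pi * (2 * (q - (Re \<eta> + Im \<eta>) * r)\<^sup>2 - 2 * (b - (Re \<eta> - Im \<eta>) * r)\<^sup>2)" by simp
    moreover have "x / sqrt 2 = x * r" for x unfolding r_def by simp
    ultimately show ?thesis by (simp only:) (simp add: algebra_simps)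
  qed
  finally show ?thesis unfolding saddle_gauss_def by simp
qed

lemma saddle_gauss_decay:
  assumes "\<bar>b\<bar> \<le> B"
  shows "norm (saddle_gauss \<eta> (line_pt b q))
    \<le> exp (2 * ((Re \<eta> + Im \<eta>) / sqrt 2)\<^sup>2 + 2 * pi * (B + \<bar>(Re \<eta> - Im \<eta>) / sqrt 2\<bar>)\<^sup>2) * exp (- q\<^sup>2)"
proof -
  define q0 where "q0 = (Re \<eta> + Im \<eta>) / sqrt 2"
  define b0 where "b0 = (Re \<eta> - Im \<eta>) / sqrt 2"
  have "(b - b0)\<^sup>2 \<le> (B + \<bar>b0\<bar>)\<^sup>2" using assms by (intro abs_le_square_iff[THEN iffD1]) auto
  then have 1: "2 * pi * (b - b0)\<^sup>2 \<le> 2 * pi * (B + \<bar>b0\<bar>)\<^sup>2" by simp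
  have "2 * (q - q0)\<^sup>2 + 2 * q0\<^sup>2 - q\<^sup>2 = (q - 2 * q0)\<^sup>2" by (simp add: power2_eq_square algebra_simps)
  then have "q\<^sup>2 \<le> 2 * (q - q0)\<^sup>2 + 2 * q0\<^sup>2" using zero_le_power2[of "q - 2 * q0"] by linarith
  moreover have "2 * (q - q0)\<^sup>2 \<le> 2 * pi * (q - q0)\<^sup>2" using pi_gt3 by (intro mult_right_mono) auto
  ultimately have 2: "- 2 * pi * (q - q0)\<^sup>2 \<le> 2 * q0\<^sup>2 - q\<^sup>2" by linarith
  show ?thesis unfolding norm_saddle_gauss exp_add[symmetric] q0_def[symmetric] b0_def[symmetric]
    unfolding exp_le_cancel_iff using 1 2 by linarith
qed

text \<open>The integrals over the lines at n - 1/2 and n + 1/2 satisfy two linear relations, one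
  from the residue at n and one from the substitution of x + 1 for x. Eliminating the second
  integral gives the value.\<close>

lemma mordell_integral:
  assumes "Im \<eta> > 0"
  shows "line_int (\<lambda>x. saddle_gauss \<eta> x / two_i_sin x) ((of_int n - 1/2) / sqrt 2) * (1 + exp (- (4 * of_real pi * \<i> * \<eta>)))
     = - (of_real (sqrt 2) * exp (5 * of_real pi * \<i> / 8) * sin (of_real pi * \<eta>) * exp (- (2 * of_real pi * \<i> * \<eta>)))
       + cos (of_real pi * of_int n) * saddle_gauss \<eta> (of_int n)" (is "?J1 * _ = ?M + ?r")
proof -
  define b where "b = (of_int n - 1/2) / sqrt 2"
  define E where "E = exp (- (4 * of_real pi * \<i> * \<eta>))"
  let ?G = "\<lambda>x. saddle_gauss \<eta> x / two_i_sin x"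
  define J2 where "J2 = line_int ?G ((of_int n + 1/2) / sqrt 2)"
  have sb: "sqrt 2 * b = of_int (n - 1) + 1/2" unfolding b_def by simp
  have r: "?J1 = J2 + ?r"
    unfolding J2_def
  proof (rule line_shift_residue)
    show "saddle_gauss \<eta> holomorphic_on {x. of_int n - 3/4 < Re x - Im x \<and> Re x - Im x < of_int n + 3/4}"
      unfolding saddle_gauss_def[abs_def] by (intro holomorphic_intros)
    fix b q :: real assume "\<bar>sqrt 2 * b - of_int n\<bar> \<le> 1/2"
    then have "\<bar>sqrt 2 * b\<bar> \<le> \<bar>of_int n\<bar> + 1/2" by linarith
    moreover have "\<bar>b\<bar> \<le> \<bar>sqrt 2 * b\<bar>" by (simp add: abs_mult mult_le_cancel_right1)
    ultimately have "\<bar>b\<bar> \<le> \<bar>of_int n\<bar> + 1/2" by linarith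
    then show "norm (saddle_gauss \<eta> (line_pt b q)) \<le> exp (2 * ((Re \<eta> + Im \<eta>) / sqrt 2)\<^sup>2 + 2 * pi * ((\<bar>of_int n\<bar> + 1/2) + \<bar>(Re \<eta> - Im \<eta>) / sqrt 2\<bar>)\<^sup>2) * exp (- q\<^sup>2)"
      by (rule saddle_gauss_decay)
  qed
  have intG: "integrable lborel (\<lambda>q. ?G (line_pt b q))"
  proof (rule integrable_line[OF sb])
    show "continuous_on (range (line_pt b)) (saddle_gauss \<eta>)"
      unfolding saddle_gauss_def[abs_def] by (intro continuous_intros)
    show "norm (saddle_gauss \<eta> (line_pt b q)) \<le> exp (2 * ((Re \<eta> + Im \<eta>) / sqrt 2)\<^sup>2 + 2 * pi * (\<bar>b\<bar> + \<bar>(Re \<eta> - Im \<eta>) / sqrt 2\<bar>)\<^sup>2) * exp (- q\<^sup>2)" for q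
      by (rule saddle_gauss_decay) simp
  qed
  have nz: "two_i_sin (line_pt b q) \<noteq> 0" for q
    using norm_two_i_sin_half_integer_line[OF sb, of q] exp_gt_zero[of "pi * \<bar>q - b\<bar> / sqrt 2"] by (auto simp del: exp_gt_zero)
  \<comment> \<open>Translation multiplies the Gaussian by u^4 E and reverses the sign of the
    denominator u - 1/u. Dividing u^4 by u - 1/u leaves remainder 1 and quotient u^3 + u, whose
    integrals are pure Gaussians.\<close>
  have shiftG: "?G (x + 1) = - E * (?G x + saddle_gauss \<eta> x * exp (of_real 3 * of_real pi * \<i> * x)
       + saddle_gauss \<eta> x * exp (of_real 1 * of_real pi * \<i> * x))" if "two_i_sin x \<noteq> 0" for x
  proof -
    have epi: "exp (of_real pi * \<i>) = -1" "exp (- (of_real pi * \<i>)) = -1"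
      by (simp_all add: exp_minus)
    define u where "u = exp (of_real pi * \<i> * x)"
    have u0: "u \<noteq> 0" unfolding u_def by simp
    have ts: "two_i_sin (x + 1) = - two_i_sin x"
      unfolding two_i_sin_def by (simp add: distrib_left exp_add epi exp_diff exp_minus)
    have tu: "two_i_sin x = u - 1 / u" unfolding two_i_sin_def u_def by (simp add: exp_minus inverse_eq_divide)
    have u3: "exp (of_real 3 * of_real pi * \<i> * x) = u ^ 3" "exp (of_real 1 * of_real pi * \<i> * x) = u"
      unfolding u_def exp_of_nat_mult[symmetric] by (simp_all add: mult_ac)
    have "2 * of_real pi * \<i> * (x + 1 - \<eta>)\<^sup>2 = 2 * of_real pi * \<i> * (x - \<eta>)\<^sup>2 + of_nat 4 * (of_real pi * \<i> * x) + - (4 * of_real pi * \<i> * \<eta>) + 2 * (of_real pi * \<i>)"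
      by (simp add: power2_eq_square algebra_simps)
    then have "saddle_gauss \<eta> (x + 1) = saddle_gauss \<eta> x * u ^ 4 * E * (exp (of_real pi * \<i>))\<^sup>2"
      unfolding saddle_gauss_def E_def u_def exp_of_nat_mult[symmetric] exp_double[symmetric] exp_add[symmetric] by simp
    then have sg: "saddle_gauss \<eta> (x + 1) = saddle_gauss \<eta> x * u ^ 4 * E" by (simp add: epi)
    have nz2: "u - 1 / u \<noteq> 0" using that unfolding tu .
    have alg: "g * u ^ 4 * E / - (u - 1 / u) = - E * (g / (u - 1 / u) + g * u ^ 3 + g * u)" for g
    proof -
      have "u ^ 4 = 1 + (u ^ 3 + u) * (u - 1 / u)" using u0 by (simp add: field_simps power4_eq_xxxx power3_eq_cube)
      then have 1: "g * u ^ 4 * E = E * (g + (g * u ^ 3 + g * u) * (u - 1 / u))" by (simp only:) (simp add: algebra_simps)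
      have "E * (g + k * w) / - w = - E * (g / w + k)" if "w \<noteq> 0" for k w
        using that by (simp add: field_simps)
      from this[OF nz2] show ?thesis unfolding 1 by (simp only: add.assoc)
    qed
    show ?thesis unfolding ts sg u3 unfolding tu by (rule alg)
  qed
  define k3 where "k3 = (LINT q|lborel. saddle_gauss \<eta> (line_pt b q) * exp (of_real 3 * of_real pi * \<i> * line_pt b q))"
  define k1 where "k1 = (LINT q|lborel. saddle_gauss \<eta> (line_pt b q) * exp (of_real 1 * of_real pi * \<i> * line_pt b q))"
  have "J2 = line_int ?G (b + 1 / sqrt 2)"
  proof -
    have "(of_int n + 1/2) / sqrt 2 = b + 1 / sqrt 2" unfolding b_def by (simp add: field_simps)
    then show ?thesis unfolding J2_def by simp
  qed
  also have "\<dots> = line_int (\<lambda>x. ?G (x + 1)) b" by (rule line_int_shift)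
  also have "\<dots> = - exp (\<i> * of_real pi / 4) * (- E * ((LINT q|lborel. ?G (line_pt b q)) + k3 + k1))"
    unfolding line_int_def shiftG[OF nz] k3_def k1_def
    using intG saddle_gauss_line(1)[of \<eta> b 3] saddle_gauss_line(1)[of \<eta> b 1] by simp
  also have "\<dots> = - E * ?J1 + E * (exp (\<i> * of_real pi / 4) * (k3 + k1))"
    unfolding line_int_def b_def[symmetric] by (simp add: algebra_simps)
  finally have J2: "J2 = - E * ?J1 + E * (exp (\<i> * of_real pi / 4) * (k3 + k1))" .
  have "E * (exp (\<i> * of_real pi / 4) * (k3 + k1)) = ?M"
  proof -
    define v where "v = exp (of_real pi * \<i> * \<eta>)"
    have v0: "v \<noteq> 0" unfolding v_def by simp
    have epi: "exp (\<i> * of_real pi) = -1" by simp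
    \<comment> \<open>The phase exp(-9 pi i / 8) equals -exp(-pi i / 8), so k3 and k1 enter with
      opposite signs; their combination v - v^3 is what yields the sine.\<close>
    have "exp (of_real 3 * of_real pi * \<i> * \<eta> - \<i> * of_real pi * (of_real 3)\<^sup>2 / 8)
        = v ^ 3 * exp (- (\<i> * of_real pi / 8)) / exp (\<i> * of_real pi)"
      unfolding v_def exp_of_nat_mult[symmetric] exp_add[symmetric] exp_diff[symmetric]
      by (rule arg_cong[where f = exp]) (simp add: field_simps)
    then have k3: "k3 = - (v ^ 3 * exp (- (\<i> * of_real pi / 8))) / of_real (sqrt 2)"
      unfolding k3_def saddle_gauss_line(2) epi by simp
    have "exp (of_real 1 * of_real pi * \<i> * \<eta> - \<i> * of_real pi * (of_real 1)\<^sup>2 / 8) = v * exp (- (\<i> * of_real pi / 8))"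
      unfolding v_def exp_add[symmetric] by (rule arg_cong[where f = exp]) (simp add: field_simps)
    then have k1: "k1 = v * exp (- (\<i> * of_real pi / 8)) / of_real (sqrt 2)"
      unfolding k1_def saddle_gauss_line(2) by simp
    have E: "E = 1 / v ^ 4"
      unfolding E_def v_def exp_of_nat_mult[symmetric] by (simp add: exp_minus inverse_eq_divide mult_ac)
    have e2: "exp (- (2 * of_real pi * \<i> * \<eta>)) = 1 / v ^ 2"
      unfolding v_def exp_of_nat_mult[symmetric] by (simp add: exp_minus inverse_eq_divide mult_ac)
    have sin: "sin (of_real pi * \<eta>) = (v - 1 / v) / (2 * \<i>)"
      unfolding sin_exp_eq v_def by (simp add: exp_minus inverse_eq_divide mult_ac)
    have ph: "exp (\<i> * of_real pi / 4) * exp (- (\<i> * of_real pi / 8)) = - \<i> * exp (5 * of_real pi * \<i> / 8)"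
    proof -
      have "- \<i> = exp (- (\<i> * of_real pi / 2))"
        using cis_pi_half cis_cnj[of "pi / 2"] by (simp add: cis_conv_exp exp_minus)
      then show ?thesis unfolding exp_add[symmetric]
        by (simp only: exp_add[symmetric]) (rule arg_cong[where f = exp], simp add: field_simps)
    qed
    define s2 where "s2 = complex_of_real (sqrt 2)"
    have s2: "s2 * s2 = 2" unfolding s2_def by (simp flip: of_real_mult)
    then have s20: "s2 \<noteq> 0" by auto
    have s2i: "1 / s2 = s2 / 2" using s2 s20 by (simp add: field_simps)
    have "E * (exp (\<i> * of_real pi / 4) * (k3 + k1))
      = (exp (\<i> * of_real pi / 4) * exp (- (\<i> * of_real pi / 8))) * (1 / s2) * ((v - v ^ 3) / v ^ 4)"
      unfolding k3 k1 E s2_def[symmetric] using v0 s20 by (simp add: field_simps)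
    also have "\<dots> = - \<i> * exp (5 * of_real pi * \<i> / 8) * (s2 / 2) * ((v - v ^ 3) / v ^ 4)"
      unfolding ph s2i ..
    also have "\<dots> = - (s2 * exp (5 * of_real pi * \<i> / 8) * ((v - 1 / v) / (2 * \<i>)) * (1 / v ^ 2))"
      using v0 by (simp add: divide_simps power4_eq_xxxx power3_eq_cube power2_eq_square) (simp add: algebra_simps)
    finally show ?thesis unfolding sin e2 s2_def .
  qed
  moreover have "x * (1 + e) = m + r" if "x = y + r" "y = - e * x + m" for x y e m r :: complex
    using that by (simp add: algebra_simps)
  from this[OF r J2] have "?J1 * (1 + E) = E * (exp (\<i> * of_real pi / 4) * (k3 + k1)) + ?r" .
  ultimately show ?thesis unfolding E_def by simp
qed

section \<open>The numerator on lines of slope one\<close>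

definition aux_num :: "complex \<Rightarrow> complex \<Rightarrow> complex" where
  "aux_num s x = x powr (- s) * exp (of_real pi * \<i> * x\<^sup>2)"

text \<open>With m = -Re s and t = Im s, this is the logarithm of the modulus of x^(-s) exp(pi i
  x^2) at x = \<open>line_pt b q\<close>, where |x|^2 = q^2 + b^2 and arg x = arctan(q / b) - pi /
  4.\<close>

definition log_modulus :: "real \<Rightarrow> real \<Rightarrow> real \<Rightarrow> real \<Rightarrow> real" where
  "log_modulus m t b q = m / 2 * ln (q\<^sup>2 + b\<^sup>2) + t * (arctan (q / b) - pi / 4) - pi * (q\<^sup>2 - b\<^sup>2)"

lemma line_pt_polar:
  assumes "b > 0"
  shows "line_pt b q = of_real (sqrt (q\<^sup>2 + b\<^sup>2)) * exp (\<i> * of_real (arctan (q / b) - pi / 4))"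
proof -
  define r where "r = sqrt (q\<^sup>2 + b\<^sup>2)"
  have r0: "r > 0" unfolding r_def using assms by (simp add: sum_power2_gt_zero_iff)
  have "sqrt (1 + (q / b)\<^sup>2) = sqrt ((q\<^sup>2 + b\<^sup>2) / b\<^sup>2)"
    using assms by (simp add: power_divide field_simps)
  then have sq: "sqrt (1 + (q / b)\<^sup>2) = r / b" using assms unfolding r_def by (simp add: real_sqrt_divide)
  have c: "cos (arctan (q / b)) = b / r" "sin (arctan (q / b)) = q / r"
    unfolding cos_arctan sin_arctan sq using assms by simp_all
  have h: "sqrt 2 / 2 = 1 / sqrt (2::real)" by (simp add: field_simps)
  have "exp (\<i> * of_real (arctan (q / b) - pi / 4)) = cis (arctan (q / b) - pi / 4)" by (simp add: cis_conv_exp)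
  also have "of_real r * \<dots> = line_pt b q"
    using r0 by (simp add: complex_eq_iff cos_diff sin_diff c cos_45 sin_45 h) (simp add: field_simps)
  finally show ?thesis unfolding r_def by simp
qed

lemma norm_aux_num_line:
  assumes "b > 0"
  shows "norm (aux_num s (line_pt b q)) = exp (log_modulus (- Re s) (Im s) b q)"
proof -
  define r where "r = sqrt (q\<^sup>2 + b\<^sup>2)"
  define \<theta> where "\<theta> = arctan (q / b) - pi / 4"
  have r0: "r > 0" unfolding r_def using assms by (simp add: sum_power2_gt_zero_iff)
  have lp: "line_pt b q = of_real r * exp (\<i> * of_real \<theta>)"
    unfolding r_def \<theta>_def by (rule line_pt_polar[OF assms])
  have nz: "line_pt b q \<noteq> 0" unfolding lp using r0 by simp
  have Ln: "Ln (line_pt b q) = of_real (ln r) + \<i> * of_real \<theta>"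
  proof (rule Ln_unique)
    show "exp (of_real (ln r) + \<i> * of_real \<theta>) = line_pt b q"
      unfolding lp exp_add exp_of_real using r0 by simp
    show "- pi < Im (of_real (ln r) + \<i> * of_real \<theta>)" "Im (of_real (ln r) + \<i> * of_real \<theta>) \<le> pi"
      using arctan_bounded[of "q / b"] pi_gt_zero unfolding \<theta>_def by auto
  qed
  have lnr: "ln r = ln (q\<^sup>2 + b\<^sup>2) / 2"
    unfolding r_def using assms by (intro ln_sqrt) (simp add: sum_power2_gt_zero_iff)
  have n1: "norm (line_pt b q powr (- s)) = exp (- Re s / 2 * ln (q\<^sup>2 + b\<^sup>2) + Im s * \<theta>)"
    using nz unfolding powr_def Ln by (simp add: lnr)
  have "Re (of_real pi * \<i> * (line_pt b q)\<^sup>2) = - pi * (q\<^sup>2 - b\<^sup>2)"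
    by (simp add: power2_eq_square field_simps)
  then have n2: "norm (exp (of_real pi * \<i> * (line_pt b q)\<^sup>2)) = exp (- pi * (q\<^sup>2 - b\<^sup>2))"
    by (simp only: norm_exp_eq_Re)
  show ?thesis unfolding aux_num_def norm_mult n1 n2 exp_add[symmetric] log_modulus_def \<theta>_def by simp
qed

text \<open>A crude bound for integrability and for moving lines. The estimate ln y <= y / (m + 1) +
  ln (m + 1) lets the logarithm cost at most one copy of y = q^2 + b^2, and pi q^2 leaves room for
  that.\<close>

lemma log_modulus_decay:
  assumes "b > 0" "b \<le> B" "m \<ge> 0"
  shows "log_modulus m t b q \<le> (m / 2 * ln (m + 1) + \<bar>t\<bar> * pi + (pi + 1) * B\<^sup>2) - q\<^sup>2"
proof -
  define y where "y = q\<^sup>2 + b\<^sup>2"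
  have y: "y > 0" unfolding y_def using assms by (simp add: sum_power2_gt_zero_iff)
  have "ln y = ln (y / (m + 1)) + ln (m + 1)" using y assms by (simp add: ln_div)
  also have "ln (y / (m + 1)) \<le> y / (m + 1)"
    using ln_le_minus_one[of "y / (m + 1)"] y assms by (simp add: divide_pos_pos)
  finally have "m / 2 * ln y \<le> m / 2 * (y / (m + 1) + ln (m + 1))"
    using assms by (intro mult_left_mono) auto
  also have "\<dots> = m / (2 * (m + 1)) * y + m / 2 * ln (m + 1)" by (simp add: distrib_left)
  also have "m / (2 * (m + 1)) * y \<le> 1 * y" using y assms by (intro mult_right_mono) auto
  finally have 1: "m / 2 * ln y \<le> y + m / 2 * ln (m + 1)" by simp
  have "\<bar>arctan (q / b) - pi / 4\<bar> \<le> pi" using arctan_bounded[of "q / b"] by linarith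
  then have "\<bar>t\<bar> * \<bar>arctan (q / b) - pi / 4\<bar> \<le> \<bar>t\<bar> * pi" by (intro mult_left_mono) auto
  then have 2: "t * (arctan (q / b) - pi / 4) \<le> \<bar>t\<bar> * pi" by (metis abs_le_D1 abs_mult)
  have b2: "b\<^sup>2 \<le> B\<^sup>2" using assms by (intro power_mono) auto
  have 3: "(pi + 1) * b\<^sup>2 \<le> (pi + 1) * B\<^sup>2" using b2 by (intro mult_left_mono) auto
  have 4: "2 * q\<^sup>2 \<le> pi * q\<^sup>2" using pi_gt3 by (intro mult_right_mono) auto
  have "y - pi * (q\<^sup>2 - b\<^sup>2) = q\<^sup>2 - pi * q\<^sup>2 + (pi + 1) * b\<^sup>2" unfolding y_def by (simp add: algebra_simps)
  then show ?thesis unfolding log_modulus_def y_def[symmetric] using 1 2 3 4 by linarith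
qed

lemma aux_num_holomorphic:
  assumes "a \<ge> 0"
  shows "aux_num s holomorphic_on {x. a < Re x - Im x}"
  unfolding aux_num_def[abs_def] using assms
  by (intro holomorphic_intros) (auto simp: complex_nonpos_Reals_iff)

lemma aux_num_decay:
  assumes "0 < b" "b \<le> B" "Re s \<le> 0"
  shows "norm (aux_num s (line_pt b q))
     \<le> exp (- Re s / 2 * ln (- Re s + 1) + \<bar>Im s\<bar> * pi + (pi + 1) * B\<^sup>2) * exp (- q\<^sup>2)"
  unfolding norm_aux_num_line[OF assms(1)] exp_add[symmetric]
  using log_modulus_decay[OF assms(1,2), of "- Re s"] assms(3) by simp

lemma integrable_aux_line:
  assumes "Re s \<le> 0"
  shows "integrable lborel (\<lambda>q. aux_num s (line_pt ((real N + 1/2) / sqrt 2) q) / two_i_sin (line_pt ((real N + 1/2) / sqrt 2) q))"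
proof (rule integrable_line[of _ "int N"])
  define b where "b = (real N + 1/2) / sqrt 2"
  have sb: "sqrt 2 * b = real N + 1/2" unfolding b_def by simp
  have b: "b > 0" unfolding b_def by (simp add: divide_pos_pos add_nonneg_pos)
  show "continuous_on (range (line_pt b)) (aux_num s)"
  proof (rule continuous_on_subset[OF holomorphic_on_imp_continuous_on[OF aux_num_holomorphic[of 0]]])
    show "range (line_pt b) \<subseteq> {x. 0 < Re x - Im x}"
    proof (rule image_subsetI)
      fix q
      have "Re (line_pt b q) - Im (line_pt b q) = sqrt 2 * b" by (simp add: field_simps)
      moreover have "0 < sqrt 2 * b" using b by simp
      ultimately show "line_pt b q \<in> {x. 0 < Re x - Im x}" unfolding mem_Collect_eq by (simp only:)
    qed
  qed simp
  show "sqrt 2 * b = of_int (int N) + 1/2" using sb by simp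
  show "norm (aux_num s (line_pt b q)) \<le> exp (- Re s / 2 * ln (- Re s + 1) + \<bar>Im s\<bar> * pi + (pi + 1) * b\<^sup>2) * exp (- q\<^sup>2)" for q
    using b assms by (intro aux_num_decay) auto
qed

text \<open>The line of the definition is this one run backwards, q = b - u. Reflecting the
  parameter does not change the Lebesgue integral, and the factor -exp(i pi / 4) is the same on both
  sides.\<close>

lemma riemann_aux_eq_line_int:
  "riemann_aux s = line_int (\<lambda>x. aux_num s x / two_i_sin x) ((1/2) / sqrt 2)"
proof -
  define b where "b = (1/2) / sqrt (2::real)"
  have rl: "riemann_aux_line q = line_pt b (b + -1 * q)" for q
    unfolding riemann_aux_line_def exp_i_pi_4 b_def by (simp add: complex_eq_iff field_simps)
  have "(LINT q|lborel. aux_num s (line_pt b q) / two_i_sin (line_pt b q))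
     = (LINT q|lborel. aux_num s (line_pt b (b + -1 * q)) / two_i_sin (line_pt b (b + -1 * q)))"
    using lborel_integral_real_affine[of "-1" "\<lambda>q. aux_num s (line_pt b q) / two_i_sin (line_pt b q)" b] by simp
  then have "line_int (\<lambda>x. aux_num s x / two_i_sin x) b = - exp (\<i> * of_real pi / 4) *
      (LINT q|lborel. aux_num s (line_pt b (b + -1 * q)) / two_i_sin (line_pt b (b + -1 * q)))"
    unfolding line_int_def by (simp only:)
  also have "\<dots> = riemann_aux s"
    unfolding riemann_aux_def riemann_aux_integrand_def rl aux_num_def two_i_sin_def integral_mult_left_zero
    by (rule mult.commute)
  finally show ?thesis unfolding b_def by (rule sym)
qed

lemma riemann_aux_eq_sum_line_int:
  assumes "Re s \<le> 0"
  shows "riemann_aux s = (\<Sum>n=1..N. cos (of_real pi * of_nat n) * aux_num s (of_nat n))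
           + line_int (\<lambda>x. aux_num s x / two_i_sin x) ((real N + 1/2) / sqrt 2)"
proof (induction N)
  case 0
  show ?case by (simp add: riemann_aux_eq_line_int)
next
  case (Suc N)
  define n where "n = int (Suc N)"
  have "line_int (\<lambda>x. aux_num s x / two_i_sin x) ((of_int n - 1/2) / sqrt 2)
     = line_int (\<lambda>x. aux_num s x / two_i_sin x) ((of_int n + 1/2) / sqrt 2) + cos (of_real pi * of_int n) * aux_num s (of_int n)"
  proof (rule line_shift_residue)
    have "of_int n - 3/4 \<ge> (0::real)" unfolding n_def by simp
    from aux_num_holomorphic[OF this]
    show "aux_num s holomorphic_on {x. of_int n - 3/4 < Re x - Im x \<and> Re x - Im x < of_int n + 3/4}"
      by (rule holomorphic_on_subset) auto
  next
    fix b q :: real assume b: "\<bar>sqrt 2 * b - of_int n\<bar> \<le> 1/2"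
    have n1: "of_int n \<ge> (1::real)" unfolding n_def by simp
    then have "sqrt 2 * b > 0" using b by linarith
    then have b0: "b > 0" by (simp add: zero_less_mult_iff)
    have "b \<le> sqrt 2 * b" using b0 by simp
    then have "b \<le> of_int n + 1/2" using b by linarith
    then show "norm (aux_num s (line_pt b q)) \<le> exp (- Re s / 2 * ln (- Re s + 1) + \<bar>Im s\<bar> * pi + (pi + 1) * (of_int n + 1/2)\<^sup>2) * exp (- q\<^sup>2)"
      using b0 assms by (intro aux_num_decay)
  qed
  moreover have "of_int n - 1/2 = real N + 1/2" "of_int n + 1/2 = real (Suc N) + 1/2" unfolding n_def by simp_all
  moreover have "of_int n = (of_nat (Suc N) :: complex)" unfolding n_def by simp
  ultimately have "line_int (\<lambda>x. aux_num s x / two_i_sin x) ((real N + 1/2) / sqrt 2)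
     = line_int (\<lambda>x. aux_num s x / two_i_sin x) ((real (Suc N) + 1/2) / sqrt 2) + cos (of_real pi * of_nat (Suc N)) * aux_num s (of_nat (Suc N))"
    by (simp only:)
  moreover have "(\<Sum>n=1..Suc N. f n) = (\<Sum>n=1..N. f n) + f (Suc N)" for f :: "nat \<Rightarrow> complex"
    by simp
  ultimately show ?case using Suc by (simp only: ac_simps)
qed

text \<open>The two parameters are -Re s and Im s for s = 1 + 2 pi i eta^2 and eta =
  \<open>line_pt b0 q0\<close>. The numerator is arranged to isolate the zero at q0. The remaining
  drift has two sources: (b - b0)^2 from leaving the line of the saddle, and 1 / (2 pi) from the
  exponent -s in place of 1 - s.\<close>

lemma DERIV_log_modulus:
  assumes "b > 0"
  shows "((\<lambda>q. log_modulus (2 * pi * (q0\<^sup>2 - b0\<^sup>2) - 1) (4 * pi * (q0 * b0)) b q) has_real_derivative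
     2 * pi * (((q0 - q) * (q\<^sup>2 + q0 * q + 2 * b0 * b) - ((b - b0)\<^sup>2 + 1 / (2 * pi)) * q) / (q\<^sup>2 + b\<^sup>2))) (at q)"
proof -
  have S: "q\<^sup>2 + b\<^sup>2 > 0" using assms by (simp add: sum_power2_gt_zero_iff)
  define S where "S = q\<^sup>2 + b\<^sup>2"
  define m where "m = 2 * pi * (q0\<^sup>2 - b0\<^sup>2) - 1"
  have a: "((\<lambda>q. arctan (q / b)) has_real_derivative b / S) (at q)"
  proof -
    have "inverse (1 + (q / b)\<^sup>2) * (1 / b) = b / S"
      unfolding S_def using assms S by (simp add: power_divide field_simps power2_eq_square)
    then show ?thesis using assms by (auto intro!: derivative_eq_intros)
  qed
  have l: "((\<lambda>q. ln (q\<^sup>2 + b\<^sup>2)) has_real_derivative 2 * q / S) (at q)"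
    unfolding S_def using S by (auto intro!: derivative_eq_intros simp: field_simps)
  have d: "((\<lambda>q. log_modulus m t b q) has_real_derivative (m / 2 * (2 * q / S) + t * (b / S) - pi * (2 * q))) (at q)" for t
  proof -
    have d3: "((\<lambda>q. pi * (q\<^sup>2 - b\<^sup>2)) has_real_derivative pi * (2 * q)) (at q)"
      by (auto intro!: derivative_eq_intros)
    from DERIV_diff[OF DERIV_add[OF DERIV_cmult[OF l, of "m / 2"] DERIV_cmult[OF DERIV_diff[OF a DERIV_const[of "pi / 4"]], of t]] d3]
    show ?thesis unfolding log_modulus_def by (simp only: diff_0_right)
  qed
  have "m / 2 * (2 * q / S) + 4 * pi * (q0 * b0) * (b / S) - pi * (2 * q)
     = (m * q + 4 * pi * (q0 * b0) * b - 2 * pi * q * S) / S"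
    using S unfolding S_def[symmetric] by (simp add: field_simps)
  also have "m * q + 4 * pi * (q0 * b0) * b - 2 * pi * q * S
     = 2 * pi * ((q0 - q) * (q\<^sup>2 + q0 * q + 2 * b0 * b) - ((b - b0)\<^sup>2 + 1 / (2 * pi)) * q)"
    unfolding m_def S_def by (simp add: power2_eq_square algebra_simps)
  finally have "m / 2 * (2 * q / S) + 4 * pi * (q0 * b0) * (b / S) - pi * (2 * q)
     = 2 * pi * (((q0 - q) * (q\<^sup>2 + q0 * q + 2 * b0 * b) - ((b - b0)\<^sup>2 + 1 / (2 * pi)) * q) / S)" by simp
  with d[of "4 * pi * (q0 * b0)"] show ?thesis unfolding m_def S_def by simp
qed

text \<open>
  In the rotated coordinates the saddle is \<open>(q0, b0)\<close>, and the derivative along a nearby line factors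
  as \<open>q0 - q\<close> times a positive quantity, up to a bounded perturbation. This gives Gaussian decay away
  from \<open>q0\<close>, uniformly in \<open>b0\<close>, even when the line passes close to \<open>0\<close>.
\<close>
lemma log_modulus_gaussian_bound:
  fixes q0 b0 b q :: real
  assumes b0: "0 < b0" "b0 \<le> q0" and q0: "q0 \<ge> 8" and b: "b > 0" "\<bar>b - b0\<bar> \<le> 3/4" and q: "q \<ge> 0"
  defines "L \<equiv> log_modulus (2 * pi * (q0\<^sup>2 - b0\<^sup>2) - 1) (4 * pi * (q0 * b0)) b"
  shows "L q \<le> L q0 + 5 - pi / 8 * (q - q0)\<^sup>2"
proof -
  define D where "D = (b - b0)\<^sup>2 + 1 / (2 * pi)"
  define N where "N q = q\<^sup>2 + q0 * q + 2 * b0 * b" for q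
  define S where "S q = q\<^sup>2 + b\<^sup>2" for q
  define L' where "L' q = 2 * pi * (((q0 - q) * N q - D * q) / S q)" for q
  have der: "(L has_real_derivative L' q) (at q)" for q
    unfolding L_def L'_def N_def S_def D_def by (rule DERIV_log_modulus[OF b(1)])
  have D: "0 \<le> D" "D \<le> 3/4"
  proof -
    show "0 \<le> D" unfolding D_def by simp
    have "(b - b0)\<^sup>2 \<le> (3/4)\<^sup>2" using b(2) by (intro abs_le_square_iff[THEN iffD1]) simp
    moreover have "1 / (2 * pi) \<le> 1 / (2 * 3)" using pi_gt3 by (intro divide_left_mono) auto
    moreover have "(3/4)\<^sup>2 = (9/16 :: real)" by (simp add: power2_eq_square)
    ultimately show "D \<le> 3/4" unfolding D_def by linarith
  qed
  have S0: "S q > 0" for q unfolding S_def using b by (simp add: sum_power2_gt_zero_iff)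
  have bb: "b0 * b \<ge> 0" using b0 b by simp
  \<comment> \<open>On this range q is comparable to q0 and b <= q0 + 3/4, so the positive factor is
    at least half the denominator: apart from the drift, the slope is at least that of a
    Gaussian.\<close>
  have N: "N q \<ge> S q / 2" if "q \<ge> q0 / 2" for q
  proof -
    have "b \<le> q0 + 3/4" using b b0 by linarith
    then have "b\<^sup>2 \<le> (q0 + 3/4)\<^sup>2" using b by (intro power_mono) auto
    also have "\<dots> = q0\<^sup>2 + 3/2 * q0 + 9/16" by (simp add: power2_eq_square algebra_simps)
    also have "\<dots> \<le> 5/4 * q0\<^sup>2"
    proof -
      have "8 * q0 \<le> q0\<^sup>2" using q0 by (simp add: power2_eq_square)
      then show ?thesis using q0 by linarith
    qed
    finally have 1: "b\<^sup>2 \<le> 5/4 * q0\<^sup>2" .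
    have "(q0 / 2)\<^sup>2 \<le> q\<^sup>2" using that q0 by (intro power_mono) auto
    then have 2: "q0\<^sup>2 \<le> 4 * q\<^sup>2" by (simp add: power_divide)
    have "q0 * (q0 / 2) \<le> q0 * q" using that q0 by (intro mult_left_mono) auto
    then have 3: "q0\<^sup>2 \<le> 2 * (q0 * q)" by (simp add: power2_eq_square)
    show ?thesis unfolding N_def S_def using 1 2 3 bb by simp
  qed
  have upper: "L q \<le> L q0 - pi / 2 * (q - q0)\<^sup>2" if "q \<ge> q0" for q
  proof -
    have "L q + pi / 2 * (q - q0)\<^sup>2 \<le> L q0 + pi / 2 * (q0 - q0)\<^sup>2"
    proof (rule DERIV_nonpos_imp_nonincreasing[OF that])
      fix x assume x: "q0 \<le> x" "x \<le> q"
      have "((\<lambda>x. L x + pi / 2 * (x - q0)\<^sup>2) has_real_derivative L' x + pi * (x - q0)) (at x)"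
        by (auto intro!: derivative_eq_intros der)
      moreover have "L' x + pi * (x - q0) \<le> 0"
      proof -
        have "(q0 - x) * N x \<le> (q0 - x) * (S x / 2)" using N[of x] x q0 by (intro mult_left_mono_neg) auto
        moreover have "D * x \<ge> 0" using D x q0 by simp
        ultimately have "(q0 - x) * N x - D * x \<le> (q0 - x) / 2 * S x" by simp
        then have "((q0 - x) * N x - D * x) / S x \<le> (q0 - x) / 2" using S0[of x] by (simp add: divide_le_eq)
        then have "2 * pi * (((q0 - x) * N x - D * x) / S x) \<le> 2 * pi * ((q0 - x) / 2)" by (intro mult_left_mono) auto
        moreover have "2 * pi * ((q0 - x) / 2) = - (pi * (x - q0))"
          by (simp add: right_diff_distrib field_simps)
        ultimately show ?thesis unfolding L'_def by linarith
      qed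
      ultimately show "\<exists>y. ((\<lambda>x. L x + pi / 2 * (x - q0)\<^sup>2) has_real_derivative y) (at x) \<and> y \<le> 0" by blast
    qed
    then show ?thesis by simp
  qed
  have qnz: "q0 \<noteq> 0" using q0 by auto
  \<comment> \<open>To the left of q0 the drift has the wrong sign. The added term 10 / q0 * q pays
    for it, and over an interval of length at most q0 / 2 it amounts to at most 5, the constant of
    the statement.\<close>
  have middle: "L q \<le> L q0 + 5 - pi / 2 * (q - q0)\<^sup>2" if "q0 / 2 \<le> q" "q \<le> q0" for q
  proof -
    have "L q + pi / 2 * (q - q0)\<^sup>2 + 10 / q0 * q \<le> L q0 + pi / 2 * (q0 - q0)\<^sup>2 + 10 / q0 * q0"
    proof (rule DERIV_nonneg_imp_nondecreasing[OF that(2)])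
      fix x assume x: "q \<le> x" "x \<le> q0"
      have x2: "q0 / 2 \<le> x" using x that by linarith
      have "((\<lambda>x. L x + pi / 2 * (x - q0)\<^sup>2 + 10 / q0 * x) has_real_derivative L' x + pi * (x - q0) + 10 / q0) (at x)"
        using qnz by (auto intro!: derivative_eq_intros der)
      moreover have "L' x + pi * (x - q0) + 10 / q0 \<ge> 0"
      proof -
        have 1: "(q0 - x) * N x \<ge> (q0 - x) * (S x / 2)" using N[OF x2] x by (intro mult_left_mono) auto
        have x0: "x > 0" using x2 q0 by linarith
        have "D * x \<le> 3/4 * x" using D x0 by (intro mult_right_mono) auto
        also have "3/4 * x \<le> 3 / (2 * q0) * S x"
        proof -
          have qpos: "q0 > 0" using q0 by linarith
          have "q0 * x \<le> 2 * x * x" using x2 x0 by (intro mult_right_mono) auto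
          also have "2 * x * x \<le> 2 * S x" unfolding S_def by (simp add: power2_eq_square)
          finally have "q0 * x \<le> 2 * S x" .
          then have "q0 * (3/4 * x) \<le> 3/2 * S x" by simp
          then have "3/4 * x \<le> (3/2 * S x) / q0" using qpos by (simp only: pos_le_divide_eq mult.commute)
          then show ?thesis by simp
        qed
        finally have "D * x \<le> 3 / (2 * q0) * S x" .
        moreover have "((q0 - x) / 2 - 3 / (2 * q0)) * S x = (q0 - x) * (S x / 2) - 3 / (2 * q0) * S x"
          by (simp add: left_diff_distrib)
        ultimately have "((q0 - x) / 2 - 3 / (2 * q0)) * S x \<le> (q0 - x) * N x - D * x" using 1 by linarith
        then have "(q0 - x) / 2 - 3 / (2 * q0) \<le> ((q0 - x) * N x - D * x) / S x" using S0[of x] by (simp add: le_divide_eq)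
        then have "2 * pi * ((q0 - x) / 2 - 3 / (2 * q0)) \<le> L' x" unfolding L'_def by (intro mult_left_mono) auto
        moreover have "2 * pi * (3 / (2 * q0)) \<le> 10 / q0" using pi_less_4 pi_approx q0 by (simp add: divide_right_mono)
        moreover have "2 * pi * ((q0 - x) / 2 - 3 / (2 * q0)) = 2 * pi * ((q0 - x) / 2) - 2 * pi * (3 / (2 * q0))"
          by (rule right_diff_distrib)
        moreover have "2 * pi * ((q0 - x) / 2) = - (pi * (x - q0))"
          by (simp add: right_diff_distrib field_simps)
        ultimately show ?thesis by linarith
      qed
      ultimately show "\<exists>y. ((\<lambda>x. L x + pi / 2 * (x - q0)\<^sup>2 + 10 / q0 * x) has_real_derivative y) (at x) \<and> 0 \<le> y" by blast
    qed
    moreover have "10 / q0 * q \<ge> 10 / q0 * (q0 / 2)" using that q0 by (intro mult_left_mono) auto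
    ultimately show ?thesis using q0 by simp
  qed
  \<comment> \<open>Left of q0 / 2 monotonicity is enough: the bound at q0 / 2 already provides pi /
    2 * (q0 / 2)^2 = pi / 8 * \<open>q0\<^sup>2\<close>, which is at least pi / 8 * (q - q0)^2. This
    is the origin of pi / 8.\<close>
  have low: "L q \<le> L (q0 / 2)" if "0 \<le> q" "q \<le> q0 / 2" for q
  proof (rule DERIV_nonneg_imp_nondecreasing[OF that(2)])
    fix x assume x: "q \<le> x" "x \<le> q0 / 2"
    have x0: "x \<ge> 0" using x that by linarith
    have "D * x \<le> (q0 - x) * N x"
    proof -
      have "D * x \<le> (q0 / 2) * (q0 * x)"
      proof -
        have "8 * 8 \<le> q0 * q0" using q0 by (intro mult_mono) auto
        then have "D \<le> q0 / 2 * q0" using D by simp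
        then have "D * x \<le> q0 / 2 * q0 * x" using x0 by (intro mult_right_mono) auto
        then show ?thesis by (simp only: mult.assoc)
      qed
      also have "\<dots> \<le> (q0 - x) * N x"
      proof (intro mult_mono)
        have "2 * b0 * b \<ge> 0" using bb by (simp add: mult.assoc)
        then show "q0 * x \<le> N x" unfolding N_def using zero_le_power2[of x] by linarith
      qed (use x x0 q0 in auto)
      finally show ?thesis .
    qed
    then have "L' x \<ge> 0" unfolding L'_def using S0[of x] by simp
    then show "\<exists>y. (L has_real_derivative y) (at x) \<and> 0 \<le> y" using der by blast
  qed
  consider "q \<ge> q0" | "q0 / 2 \<le> q" "q \<le> q0" | "q \<le> q0 / 2" by linarith
  then show ?thesis
  proof cases
    case 1
    have "pi / 8 * (q - q0)\<^sup>2 \<le> pi / 2 * (q - q0)\<^sup>2" by (intro mult_right_mono) auto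
    then show ?thesis using upper[OF 1] by linarith
  next
    case 2
    have "pi / 8 * (q - q0)\<^sup>2 \<le> pi / 2 * (q - q0)\<^sup>2" by (intro mult_right_mono) auto
    then show ?thesis using middle[OF 2] by linarith
  next
    case 3
    have "L q \<le> L q0 + 5 - pi / 2 * (q0 / 2 - q0)\<^sup>2"
      using low[OF q 3] middle[of "q0 / 2"] q0 by simp
    also have "pi / 2 * (q0 / 2 - q0)\<^sup>2 = pi / 8 * q0\<^sup>2" by (simp add: power2_eq_square)
    finally have "L q \<le> L q0 + 5 - pi / 8 * q0\<^sup>2" .
    moreover have "pi / 8 * (q - q0)\<^sup>2 \<le> pi / 8 * q0\<^sup>2"
    proof -
      have "(q - q0)\<^sup>2 \<le> q0\<^sup>2" using q 3 by (intro abs_le_square_iff[THEN iffD1]) auto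
      then show ?thesis by (intro mult_left_mono) auto
    qed
    ultimately show ?thesis by linarith
  qed
qed

text \<open>Reflection in q only affects the arctangent. For t > 0 the negative half of a line is
  therefore smaller by an explicit exponential, and bounds for q >= 0 carry over.\<close>

lemma log_modulus_neg:
  "log_modulus m t b (- q) = log_modulus m t b q - 2 * t * arctan (q / b)"
  unfolding log_modulus_def by (simp add: arctan_minus algebra_simps)

section \<open>The saddle point\<close>

text \<open>Put p = pi i eta^2, so that s = 1 + 2 p. In -2 p Ln(1 + w) + p (1 + w)^2 the terms
  linear in w cancel and the quadratic ones form the Gaussian; only the cubic remainder of the
  logarithm stays in the exponent, and 1 / (1 + w) is the leftover of s = 1 + 2 p.\<close>

lemma aux_num_eq_saddle:
  assumes eta: "0 < Im \<eta>" "Im \<eta> < Re \<eta>"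
    and s: "s = 1 + 2 * of_real pi * \<i> * \<eta>\<^sup>2"
    and w: "norm w \<le> 1/2" and x: "x = \<eta> * (1 + w)"
  shows "aux_num s x = \<eta> powr (- s) * exp (of_real pi * \<i> * \<eta>\<^sup>2) * saddle_gauss \<eta> x
     * (exp (- (2 * of_real pi * \<i> * \<eta>\<^sup>2 * (Ln (1 + w) - w + w\<^sup>2 / 2))) / (1 + w))"
proof -
  have eta0: "\<eta> \<noteq> 0" using eta by auto
  have Rew: "\<bar>Re w\<bar> \<le> 1/2" using w abs_Re_le_cmod[of w] by linarith
  then have y0: "1 + w \<noteq> 0" by (auto simp: complex_eq_iff)
  have x0: "x \<noteq> 0" unfolding x using eta0 y0 by simp
  have Ly: "\<bar>Im (Ln (1 + w))\<bar> < pi / 2" using Re_Ln_pos_lt[OF y0] Rew by simp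
  have Le: "\<bar>Im (Ln \<eta>)\<bar> < pi / 2" using Re_Ln_pos_lt[OF eta0] eta by linarith
  have Lx: "Ln x = Ln \<eta> + Ln (1 + w)"
    unfolding x using Ly Le by (intro Ln_times_simple eta0 y0) linarith+
  define L where "L = Ln (1 + w)"
  define p where "p = of_real pi * \<i> * \<eta>\<^sup>2"
  have s': "s = 1 + 2 * p" unfolding s p_def by simp
  have "aux_num s x = exp (- s * (Ln \<eta> + L)) * exp (of_real pi * \<i> * x\<^sup>2)"
    unfolding aux_num_def using x0 by (simp add: powr_def Lx L_def)
  also have "of_real pi * \<i> * x\<^sup>2 = p * (1 + w)\<^sup>2" unfolding x p_def by (simp add: power2_eq_square)
  also have "exp (- s * (Ln \<eta> + L)) * exp (p * (1 + w)\<^sup>2)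
     = exp (- s * Ln \<eta>) * exp p * exp (2 * p * w\<^sup>2) * (exp (- (2 * p * (L - w + w\<^sup>2 / 2))) * exp (- L))"
    unfolding exp_add[symmetric]
    by (rule arg_cong[where f = exp]) (simp add: s' power2_eq_square algebra_simps)
  also have "exp (- s * Ln \<eta>) = \<eta> powr (- s)" using eta0 by (simp add: powr_def)
  also have "exp (- L) = 1 / (1 + w)" unfolding L_def using y0 by (simp add: exp_minus inverse_eq_divide)
  also have "exp (2 * p * w\<^sup>2) = saddle_gauss \<eta> x"
    unfolding saddle_gauss_def x p_def by (rule arg_cong[where f = exp]) (simp add: power2_eq_square algebra_simps)
  finally show ?thesis unfolding p_def L_def by (simp add: mult.assoc)
qed

text \<open>The leftover exponent has size about |eta|^2 |w|^3 = |x - eta|^3 / |eta|. The threshold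
  27 makes |w| <= 1/3 and this exponent at most 16/27, so that exp can be linearised.\<close>

lemma aux_num_near_saddle:
  assumes eta: "0 < Im \<eta>" "Im \<eta> < Re \<eta>" "norm \<eta> \<ge> 1"
    and s: "s = 1 + 2 * of_real pi * \<i> * \<eta>\<^sup>2"
    and near: "27 * norm (x - \<eta>) ^ 3 \<le> norm \<eta>"
  defines "M \<equiv> \<eta> powr (- s) * exp (of_real pi * \<i> * \<eta>\<^sup>2)"
  shows "norm (aux_num s x - M * saddle_gauss \<eta> x)
    \<le> norm M * norm (saddle_gauss \<eta> x) * (60 * (norm (x - \<eta>) ^ 3 + norm (x - \<eta>)) / norm \<eta>)"
proof -
  have eta0: "\<eta> \<noteq> 0" using eta by auto
  define h where "h = norm \<eta>"
  have h1: "h \<ge> 1" unfolding h_def by (rule eta)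
  define z where "z = norm (x - \<eta>)"
  define w where "w = (x - \<eta>) / \<eta>"
  let ?g = "saddle_gauss \<eta> x"
  have x: "x = \<eta> * (1 + w)" unfolding w_def using eta0 by (simp add: field_simps)
  have nw: "norm w = z / h" unfolding w_def z_def h_def by (simp add: norm_divide)
  have z0: "z \<ge> 0" unfolding z_def by simp
  have "(3 * z) ^ 3 \<le> h ^ 3"
  proof -
    have "(3 * z) ^ 3 \<le> h" using near unfolding z_def h_def by (simp add: power_mult_distrib)
    also have "h \<le> h ^ 3" using h1 by (intro self_le_power) auto
    finally show ?thesis .
  qed
  then have z3: "3 * z \<le> h" using power_mono_iff[of "3 * z" h 3] z0 h1 by simp
  have w3: "norm w \<le> 1/3" unfolding nw using z3 h1 by (simp add: divide_le_eq)
  then have w2: "norm w \<le> 1/2" by simp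
  define a where "a = - (2 * of_real pi * \<i> * \<eta>\<^sup>2 * (Ln (1 + w) - w + w\<^sup>2 / 2))"
  have na: "norm a \<le> 4 * pi * (z ^ 3 / h)"
  proof -
    have "norm a = 2 * pi * h\<^sup>2 * norm (Ln (1 + w) - w + w\<^sup>2 / 2)"
      unfolding a_def h_def by (simp add: norm_mult norm_power)
    also have "\<dots> \<le> 2 * pi * h\<^sup>2 * (2 * norm w ^ 3)"
      by (intro mult_left_mono norm_Ln_add_one_quadratic w2) auto
    also have "\<dots> = 4 * pi * (z ^ 3 / h)"
      unfolding nw using h1 by (simp add: power_divide field_simps power2_eq_square power3_eq_cube)
    finally show ?thesis .
  qed
  have z3h: "z ^ 3 / h \<le> 1/27" using near h1 unfolding z_def h_def by (simp add: divide_le_eq)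
  have "4 * pi * (z ^ 3 / h) \<le> 4 * 4 * (1/27)" using z3h z0 h1 pi_less_4 by (intro mult_mono) auto
  then have "norm a \<le> 1" using na by linarith
  then have ea: "norm (exp a - 1) \<le> 3 * norm a" by (rule norm_exp_minus_one_le)
  have y: "norm (1 + w) \<ge> 2/3" using norm_diff_ineq[of 1 w] w3 by simp
  then have y0: "1 + w \<noteq> 0" by auto
  have "norm (exp a / (1 + w) - 1) = norm ((exp a - 1) - w) / norm (1 + w)"
  proof -
    have "exp a / (1 + w) - 1 = ((exp a - 1) - w) / (1 + w)"
    proof -
      have "exp a / (1 + w) - 1 = exp a / (1 + w) - (1 + w) / (1 + w)" using y0 by simp
      also have "\<dots> = (exp a - (1 + w)) / (1 + w)" by (simp only: diff_divide_distrib)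
      finally show ?thesis by (simp only: diff_diff_eq)
    qed
    then show ?thesis by (simp only: norm_divide)
  qed
  also have "\<dots> \<le> (3 * (4 * pi * (z ^ 3 / h)) + z / h) / (2/3)"
  proof (intro frac_le)
    show "norm ((exp a - 1) - w) \<le> 3 * (4 * pi * (z ^ 3 / h)) + z / h"
      using norm_triangle_ineq4[of "exp a - 1" w] ea na nw by linarith
  qed (use y z0 h1 in auto)
  also have "\<dots> = 18 * pi * (z ^ 3 / h) + 3/2 * (z / h)" by simp
  also have "\<dots> \<le> 60 * (z ^ 3 / h) + 60 * (z / h)"
  proof (intro add_mono mult_right_mono)
    show "18 * pi \<le> 60" using pi_approx by simp
  qed (use z0 h1 in auto)
  also have "\<dots> = 60 * (z ^ 3 + z) / h" by (simp add: add_divide_distrib distrib_left)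
  finally have k: "norm (exp a / (1 + w) - 1) \<le> 60 * (z ^ 3 + z) / h" .
  have "aux_num s x - M * ?g = M * ?g * (exp a / (1 + w) - 1)"
    unfolding aux_num_eq_saddle[OF eta(1,2) s w2 x] M_def a_def[symmetric]
    by (simp add: right_diff_distrib)
  then have "norm (aux_num s x - M * ?g) = norm M * norm (?g) * norm (exp a / (1 + w) - 1)"
    by (simp only: norm_mult)
  also have "\<dots> \<le> norm M * norm (?g) * (60 * (z ^ 3 + z) / h)"
    by (intro mult_left_mono k) auto
  finally show ?thesis unfolding z_def h_def .
qed

section \<open>Elementary inequalities for the error terms\<close>

lemma one_add_abs_cube_le_exp: "(1 + \<bar>v\<bar>) ^ 3 \<le> exp (3 * \<bar>v::real\<bar>)"
proof -
  have "(1 + \<bar>v\<bar>) ^ 3 \<le> exp \<bar>v\<bar> ^ 3" by (intro power_mono exp_ge_add_one_self) auto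
  also have "\<dots> = exp (3 * \<bar>v\<bar>)" using exp_of_nat_mult[of 3 "\<bar>v\<bar>"] by simp
  finally show ?thesis .
qed

text \<open>The weight 6 |v| collects 3 |v| from the cubic factor and 3 |v| from the sine. Half of a
  Gaussian of rate 1/25 absorbs it at the cost of exp 450.\<close>

lemma linear_le_quadratic: "6 * \<bar>v\<bar> \<le> v\<^sup>2 / 50 + (450::real)"
proof -
  have "0 \<le> (\<bar>v\<bar> - 150)\<^sup>2" by simp
  also have "\<dots> = v\<^sup>2 - 300 * \<bar>v\<bar> + 22500" by (simp add: power2_eq_square algebra_simps)
  finally show ?thesis by simp
qed

lemma integrable_gaussian50: "integrable lborel (\<lambda>v::real. exp (- (v + a)\<^sup>2 / 50))"
proof -
  have "integrable lborel (\<lambda>x::real. exp (- (0 + 1 / sqrt 50 * x)\<^sup>2))"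
    by (rule lborel_integrable_real_affine[OF integrable_gaussian]) simp
  then have "integrable lborel (\<lambda>x::real. exp (- x\<^sup>2 / 50))"
    by (simp add: power_mult_distrib power_divide)
  from lborel_integrable_real_affine[OF this, of 1 a] show ?thesis by (simp add: add.commute)
qed

lemma integral_gaussian50_shift:
  "(LINT v|lborel. exp (- (v + a)\<^sup>2 / 50)) = (LINT v|lborel. exp (- v\<^sup>2 / 50 :: real))"
  using lborel_integral_real_affine[of 1 "\<lambda>v. exp (- v\<^sup>2 / 50 :: real)" a] by (simp add: add.commute)

text \<open>Serves the far left part of a line, where -q / b >= 2/5: there the reflection factor
  exp(-2 t arctan(-q / b)) is at most exp(-t / 2).\<close>

lemma arctan_ge_quarter:
  assumes "x \<ge> (2/5 :: real)"
  shows "arctan x \<ge> 1/4"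
proof -
  have "sin (1/4) \<le> (1/4::real)" using sin_x_le_x[of "1/4"] by simp
  moreover have "sin (1/8) \<le> (1/8::real)" using sin_x_le_x[of "1/8"] by simp
  moreover have "sin (1/8) \<ge> (0::real)" using pi_gt3 by (intro sin_ge_zero) auto
  ultimately have s: "sin (1/4) \<le> (1/4::real)" "(sin (1/8))\<^sup>2 \<le> ((1/8)\<^sup>2::real)" by (auto intro: power_mono)
  have "cos (1/4) = 1 - 2 * (sin (1/8::real))\<^sup>2" using cos_double_sin[of "1/8::real"] by simp
  then have c: "cos (1/4) \<ge> (31/32::real)" using s(2) by (simp add: power2_eq_square)
  have "tan (1/4) \<le> (2/5::real)"
  proof -
    have "sin (1/4) \<le> (2/5) * cos (1/4::real)" using s(1) c by linarith
    then show ?thesis unfolding tan_def using c by (simp add: divide_le_eq)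
  qed
  then have "arctan (tan (1/4)) \<le> arctan x" using assms by (intro arctan_monotone') linarith
  moreover have "arctan (tan (1/4)) = (1/4::real)" using pi_gt3 by (intro arctan_tan) auto
  ultimately show ?thesis by simp
qed

section \<open>The numerator and the integrand on lines near the saddle\<close>

locale saddle_setup =
  fixes \<eta> s :: complex
  assumes eta: "0 < Im \<eta>" "Im \<eta> < Re \<eta>"
    and s: "s = 1 + 2 * of_real pi * \<i> * \<eta>\<^sup>2"
    and big: "norm \<eta> \<ge> 12" "Re \<eta> * Im \<eta> \<ge> 1"
begin

text \<open>Together with \<open>b0\<close>, the rotated coordinates of the saddle:
  \<open>\<eta> = line_pt b0 q0\<close>. The condition 0 < Im eta < Re eta becomes 0 < b0 <
  q0.\<close>

definition q0 :: real where "q0 = (Re \<eta> + Im \<eta>) / sqrt 2"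
definition b0 :: real where "b0 = (Re \<eta> - Im \<eta>) / sqrt 2"
definition M :: complex where "M = \<eta> powr (- s) * exp (of_real pi * \<i> * \<eta>\<^sup>2)"

lemma b0_pos: "0 < b0" and b0_less: "b0 < q0"
  unfolding b0_def q0_def using eta by (auto intro: divide_strict_right_mono)

lemma norm_eta_sq: "(norm \<eta>)\<^sup>2 = q0\<^sup>2 + b0\<^sup>2"
  unfolding cmod_power2 q0_def b0_def by (simp add: power_divide power2_eq_square field_simps)

lemma norm_eta_le: "norm \<eta> \<le> sqrt 2 * q0"
proof (rule power2_le_imp_le)
  have "b0\<^sup>2 \<le> q0\<^sup>2" using b0_pos b0_less by (intro power_mono) auto
  then show "(norm \<eta>)\<^sup>2 \<le> (sqrt 2 * q0)\<^sup>2" using norm_eta_sq by (simp add: power_mult_distrib)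
qed (use b0_pos b0_less in auto)

text \<open>From |eta| >= 12 and sqrt 2 <= 3/2 comes exactly the 8 that
  \<open>log_modulus_gaussian_bound\<close> asks for.\<close>

lemma q0_ge: "q0 \<ge> 8"
proof -
  have "sqrt 2 \<le> 3/2" by (rule real_le_lsqrt) (auto simp: power2_eq_square)
  then have "sqrt 2 * q0 \<le> 3/2 * q0" using b0_pos b0_less by (intro mult_right_mono) auto
  then show ?thesis using norm_eta_le big(1) by linarith
qed

lemma eta2_eq: "Im \<eta> = (q0 - b0) / sqrt 2"
  unfolding q0_def b0_def by (simp add: field_simps)

lemma minus_Re_s: "- Re s = 2 * pi * (q0\<^sup>2 - b0\<^sup>2) - 1"
  and Im_s: "Im s = 4 * pi * (q0 * b0)"
  and Re_s_eq: "- Re s = 4 * pi * (Re \<eta> * Im \<eta>) - 1"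
proof -
  have 1: "q0\<^sup>2 - b0\<^sup>2 = 2 * (Re \<eta> * Im \<eta>)" unfolding q0_def b0_def
    by (simp add: power_divide power2_eq_square field_simps)
  have 2: "2 * (q0 * b0) = (Re \<eta>)\<^sup>2 - (Im \<eta>)\<^sup>2" unfolding q0_def b0_def
    by (simp add: power2_eq_square field_simps)
  show 3: "- Re s = 4 * pi * (Re \<eta> * Im \<eta>) - 1" unfolding s by (simp add: power2_eq_square algebra_simps)
  show "- Re s = 2 * pi * (q0\<^sup>2 - b0\<^sup>2) - 1" unfolding 1 3 by simp
  have "Im s = 2 * pi * (2 * (q0 * b0))" unfolding 2 unfolding s by (simp add: power2_eq_square algebra_simps)
  then show "Im s = 4 * pi * (q0 * b0)" by simp
qed

lemma Re_s_le: "Re s \<le> 0"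
proof -
  have "4 * pi * 1 \<le> 4 * pi * (Re \<eta> * Im \<eta>)" using big(2) by (intro mult_left_mono) auto
  then show ?thesis using Re_s_eq pi_gt3 by linarith
qed

lemma Im_s_pos: "Im s > 0" unfolding Im_s using b0_pos b0_less by simp

lemma eta_line: "\<eta> = line_pt b0 q0"
  unfolding q0_def b0_def by (simp add: complex_eq_iff field_simps)

lemma norm_line_pt_diff_sq: "(norm (line_pt b q - \<eta>))\<^sup>2 = (q - q0)\<^sup>2 + (b - b0)\<^sup>2"
proof -
  have "line_pt b q - line_pt b0 q0 = line_pt (b - b0) (q - q0)"
    by (simp add: complex_eq_iff diff_divide_distrib add_divide_distrib)
  then have "line_pt b q - \<eta> = line_pt (b - b0) (q - q0)" by (simp only: eta_line[symmetric])
  moreover have "(norm (line_pt x y))\<^sup>2 = y\<^sup>2 + x\<^sup>2" for x y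
    unfolding cmod_power2 by (simp add: power_divide power2_eq_square field_simps)
  ultimately show ?thesis by simp
qed

lemma norm_line_pt_diff_le: "norm (line_pt b q - \<eta>) \<le> \<bar>q - q0\<bar> + \<bar>b - b0\<bar>"
  by (rule power2_le_imp_le) (auto simp: norm_line_pt_diff_sq power2_sum)

lemma norm_saddle_gauss_le:
  assumes "\<bar>b - b0\<bar> \<le> 3/4"
  shows "norm (saddle_gauss \<eta> (line_pt b q)) \<le> exp 4 * exp (- 2 * pi * (q - q0)\<^sup>2)"
proof -
  have "(b - b0)\<^sup>2 \<le> (3/4)\<^sup>2" using assms by (intro abs_le_square_iff[THEN iffD1]) simp
  then have "2 * pi * (b - b0)\<^sup>2 \<le> 2 * pi * (9/16)" by (intro mult_left_mono) (auto simp: power2_eq_square)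
  also have "\<dots> \<le> 4" using pi_approx by simp
  finally show ?thesis unfolding norm_saddle_gauss q0_def[symmetric] b0_def[symmetric] exp_add[symmetric] by simp
qed

lemma aux_num_near:
  assumes "27 * norm (x - \<eta>) ^ 3 \<le> norm \<eta>"
  shows "norm (aux_num s x - M * saddle_gauss \<eta> x)
    \<le> norm M * norm (saddle_gauss \<eta> x) * (60 * (norm (x - \<eta>) ^ 3 + norm (x - \<eta>)) / norm \<eta>)"
  unfolding M_def using aux_num_near_saddle[OF eta _ s assms] big(1) by simp

lemma aux_num_center:
  assumes b: "b > 0" "\<bar>b - b0\<bar> \<le> 3/4"
  shows "norm (aux_num s (line_pt b q0)) \<le> norm M * (7 * exp 4)"
proof -
  define x where "x = line_pt b q0"
  define z where "z = norm (x - \<eta>)"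
  have z: "0 \<le> z" "z \<le> 3/4" unfolding z_def x_def using norm_line_pt_diff_le[of b q0] b(2) by auto
  have "z ^ 3 \<le> (3/4) ^ 3" using z by (intro power_mono) auto
  then have z3: "z ^ 3 \<le> 27/64" by (simp add: power3_eq_cube)
  have "norm (aux_num s x - M * saddle_gauss \<eta> x) \<le> norm M * norm (saddle_gauss \<eta> x) * (60 * (z ^ 3 + z) / norm \<eta>)"
    unfolding z_def using z3 big(1) unfolding z_def by (intro aux_num_near) linarith
  \<comment> \<open>With z <= 3/4 the numerator is at most 60 (27/64 + 3/4) < 72. The relative error
    6 gives the factor 7 = 1 + 6 of the statement.\<close>
  also have "60 * (z ^ 3 + z) / norm \<eta> \<le> 72 / 12"
    using z z3 big(1) by (intro frac_le) auto
  finally have "norm (aux_num s x - M * saddle_gauss \<eta> x) \<le> norm M * norm (saddle_gauss \<eta> x) * 6"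
    by (simp add: mult_left_mono)
  then have "norm (aux_num s x) \<le> norm M * norm (saddle_gauss \<eta> x) * 7"
    using norm_triangle_sub[of "aux_num s x" "M * saddle_gauss \<eta> x"] by (simp add: norm_mult)
  also have "norm (saddle_gauss \<eta> x) \<le> exp 4"
    using norm_saddle_gauss_le[OF b(2), of q0] unfolding x_def by simp
  finally show ?thesis unfolding x_def by (simp add: mult_left_mono)
qed

text \<open>Moving from q to q0 costs exp 5, and comparing with \<open>M\<close> at q0 costs 7 exp
  4; hence 7 exp 9.\<close>

lemma aux_num_le_pos:
  assumes b: "b > 0" "\<bar>b - b0\<bar> \<le> 3/4" and q: "q \<ge> 0"
  shows "norm (aux_num s (line_pt b q)) \<le> norm M * (7 * exp 9) * exp (- (pi / 8) * (q - q0)\<^sup>2)"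
proof -
  have "norm (aux_num s (line_pt b q)) \<le> exp (log_modulus (- Re s) (Im s) b q0 + 5 - pi / 8 * (q - q0)\<^sup>2)"
    unfolding norm_aux_num_line[OF b(1)] minus_Re_s Im_s
    using log_modulus_gaussian_bound[OF b0_pos _ q0_ge b q] b0_less by simp
  also have "\<dots> = norm (aux_num s (line_pt b q0)) * exp 5 * exp (- (pi / 8) * (q - q0)\<^sup>2)"
    unfolding norm_aux_num_line[OF b(1)] exp_add[symmetric] by simp
  also have "\<dots> \<le> norm M * (7 * exp 4) * exp 5 * exp (- (pi / 8) * (q - q0)\<^sup>2)"
    by (intro mult_right_mono aux_num_center b) auto
  also have "\<dots> = norm M * (7 * exp 9) * exp (- (pi / 8) * (q - q0)\<^sup>2)"
    by (simp add: exp_add[symmetric])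
  finally show ?thesis .
qed

lemma norm_aux_num_neg:
  assumes "b > 0"
  shows "norm (aux_num s (line_pt b (- q))) = norm (aux_num s (line_pt b q)) * exp (- 2 * Im s * arctan (q / b))"
  unfolding norm_aux_num_line[OF assms] exp_add[symmetric] log_modulus_neg by simp

lemma aux_num_le:
  assumes b: "b > 0" "\<bar>b - b0\<bar> \<le> 3/4" and q: "q \<ge> - q0 / 2"
  shows "norm (aux_num s (line_pt b q)) \<le> norm M * (7 * exp 9) * exp (- (q - q0)\<^sup>2 / 25)"
proof (cases "q \<ge> 0")
  case True
  have "(q - q0)\<^sup>2 / 25 \<le> pi / 8 * (q - q0)\<^sup>2"
    using pi_gt3 mult_right_mono[of "1/25" "pi / 8" "(q - q0)\<^sup>2"] by simp
  then have "exp (- (pi / 8) * (q - q0)\<^sup>2) \<le> exp (- (q - q0)\<^sup>2 / 25)" by simp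
  then have "norm M * (7 * exp 9) * exp (- (pi / 8) * (q - q0)\<^sup>2) \<le> norm M * (7 * exp 9) * exp (- (q - q0)\<^sup>2 / 25)"
    by (intro mult_left_mono) auto
  then show ?thesis using aux_num_le_pos[OF b True] by linarith
next
  case False
  define r where "r = - q"
  have r: "r > 0" "r \<le> q0 / 2" unfolding r_def using False q by auto
  have "norm (aux_num s (line_pt b q)) = norm (aux_num s (line_pt b r)) * exp (- 2 * Im s * arctan (r / b))"
    unfolding r_def using norm_aux_num_neg[OF b(1), of "- q"] by simp
  also have "\<dots> \<le> norm (aux_num s (line_pt b r)) * 1"
    using r b Im_s_pos by (intro mult_left_mono) auto
  also have "norm (aux_num s (line_pt b r)) * 1 \<le> norm M * (7 * exp 9) * exp (- (pi / 8) * (r - q0)\<^sup>2)"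
    using aux_num_le_pos[OF b, of r] r by simp
  also have "\<dots> \<le> norm M * (7 * exp 9) * exp (- (q - q0)\<^sup>2 / 25)"
  proof (intro mult_left_mono)
    \<comment> \<open>For r <= q0 / 2 the reflected point is at most three times as far from q0. The
      rate 1/25 is chosen so that 9/25 <= pi / 8.\<close>
    have "(q0 + r)\<^sup>2 \<le> (3 * (q0 - r))\<^sup>2" using r by (intro power_mono) auto
    then have "(q - q0)\<^sup>2 \<le> 9 * (r - q0)\<^sup>2" unfolding r_def by (simp add: power2_eq_square algebra_simps)
    moreover have "9/25 * (r - q0)\<^sup>2 \<le> pi / 8 * (r - q0)\<^sup>2" using pi_gt3 by (intro mult_right_mono) auto
    ultimately have "(q - q0)\<^sup>2 / 25 \<le> pi / 8 * (r - q0)\<^sup>2" by linarith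
    then show "exp (- (pi / 8) * (r - q0)\<^sup>2) \<le> exp (- (q - q0)\<^sup>2 / 25)" by simp
  qed auto
  finally show ?thesis .
qed

text \<open>The reflected Gaussian peaks at -q0, far from the saddle, but it is damped: here b is at
  most 5/2 times -q, so \<open>arctan_ge_quarter\<close> applies to the reflection factor.\<close>

lemma aux_num_le_far:
  assumes b: "b > 0" "\<bar>b - b0\<bar> \<le> 3/4" and q: "q \<le> - q0 / 2"
  shows "norm (aux_num s (line_pt b q)) \<le> exp (- Im s / 2) * (norm M * (7 * exp 9) * exp (- (q + q0)\<^sup>2 / 25))"
proof -
  define r where "r = - q"
  have r: "r \<ge> q0 / 2" unfolding r_def using q by auto
  then have r0: "r \<ge> 0" using q0_ge by linarith
  have "2/5 * b \<le> r" using b b0_less r q0_ge by linarith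
  then have "2/5 \<le> r / b" using b(1) by (simp add: le_divide_eq)
  then have "1/4 \<le> arctan (r / b)" by (rule arctan_ge_quarter)
  then have "Im s * (1/4) \<le> Im s * arctan (r / b)" using Im_s_pos by (intro mult_left_mono) auto
  then have e: "exp (- 2 * Im s * arctan (r / b)) \<le> exp (- Im s / 2)" by simp
  have "norm (aux_num s (line_pt b q)) = norm (aux_num s (line_pt b r)) * exp (- 2 * Im s * arctan (r / b))"
    unfolding r_def using norm_aux_num_neg[OF b(1), of "- q"] by simp
  also have "\<dots> \<le> (norm M * (7 * exp 9) * exp (- (r - q0)\<^sup>2 / 25)) * exp (- Im s / 2)"
    using aux_num_le[OF b, of r] r0 q0_ge by (intro mult_mono e) auto
  also have "(r - q0)\<^sup>2 = (q + q0)\<^sup>2" unfolding r_def by (simp add: power2_eq_square algebra_simps)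
  finally show ?thesis by (simp only: mult.commute)
qed

text \<open>If 27 |x - eta|^3 <= |eta|, the local comparison applies. Otherwise 27 (1 + |v|)^3 /
  |eta|, with v = q - q0, is at least 1 and the triangle inequality suffices. The constant 300
  covers 120 and 8 * 27 from the two cases.\<close>

lemma aux_num_saddle_diff_le:
  assumes b: "b > 0" "\<bar>b - b0\<bar> \<le> 3/4" and q: "q \<ge> - q0 / 2"
  shows "norm (aux_num s (line_pt b q) - M * saddle_gauss \<eta> (line_pt b q))
    \<le> 300 * exp 9 * norm M * ((1 + \<bar>q - q0\<bar>) ^ 3 / norm \<eta>) * exp (- (q - q0)\<^sup>2 / 25)"
proof -
  define x where "x = line_pt b q"
  define v where "v = q - q0"
  define z where "z = norm (x - \<eta>)"
  define h where "h = norm \<eta>"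
  have h: "h > 0" unfolding h_def using big(1) by linarith
  have z: "0 \<le> z" "z \<le> 1 + \<bar>v\<bar>" unfolding z_def x_def v_def using norm_line_pt_diff_le[of b q] b(2) by auto
  then have z3: "z ^ 3 \<le> (1 + \<bar>v\<bar>) ^ 3" by (intro power_mono) auto
  have g: "norm (saddle_gauss \<eta> x) \<le> exp 4 * exp (- v\<^sup>2 / 25)"
  proof -
    have "v\<^sup>2 / 25 \<le> 2 * pi * v\<^sup>2"
      using pi_gt3 mult_right_mono[of "1/25" "2 * pi" "v\<^sup>2"] by simp
    then have "exp 4 * exp (- 2 * pi * v\<^sup>2) \<le> exp 4 * exp (- v\<^sup>2 / 25)" by simp
    then show ?thesis using norm_saddle_gauss_le[OF b(2), of q] unfolding x_def v_def by linarith
  qed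
  have e49: "exp 4 \<le> (exp 9 :: real)" by simp
  have p0: "0 \<le> norm M * ((1 + \<bar>v\<bar>) ^ 3 / h) * exp (- v\<^sup>2 / 25)" using h by simp
  show ?thesis
  proof (cases "27 * z ^ 3 \<le> h")
    case True
    have "norm (aux_num s x - M * saddle_gauss \<eta> x) \<le> norm M * norm (saddle_gauss \<eta> x) * (60 * (z ^ 3 + z) / h)"
      unfolding z_def h_def using True unfolding z_def h_def by (rule aux_num_near)
    also have "\<dots> \<le> norm M * (exp 4 * exp (- v\<^sup>2 / 25)) * (120 * (1 + \<bar>v\<bar>) ^ 3 / h)"
    proof -
      define u where "u = 1 + \<bar>v\<bar>"
      have "u \<le> u ^ 3" unfolding u_def by (rule self_le_power) auto
      then have "z ^ 3 + z \<le> u ^ 3 + u ^ 3" using z z3 unfolding u_def[symmetric] by (intro add_mono) auto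
      then have "60 * (z ^ 3 + z) \<le> 120 * u ^ 3" by simp
      then have kk: "60 * (z ^ 3 + z) / h \<le> 120 * u ^ 3 / h" using h by (intro divide_right_mono) auto
      show ?thesis
        by (rule mult_mono[OF mult_left_mono[OF g] kk[unfolded u_def]]) (use h z in auto)
    qed
    also have "\<dots> = 120 * exp 4 * (norm M * ((1 + \<bar>v\<bar>) ^ 3 / h) * exp (- v\<^sup>2 / 25))" by simp
    also have "\<dots> \<le> 300 * exp 9 * (norm M * ((1 + \<bar>v\<bar>) ^ 3 / h) * exp (- v\<^sup>2 / 25))"
      by (intro mult_right_mono p0 mult_mono e49) auto
    finally show ?thesis unfolding x_def v_def h_def by (simp only: mult.assoc)
  next
    case False
    then have one: "1 \<le> 27 * ((1 + \<bar>v\<bar>) ^ 3 / h)" using z3 h by (simp add: le_divide_eq)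
    have "norm (aux_num s x - M * saddle_gauss \<eta> x) \<le> norm (aux_num s x) + norm M * norm (saddle_gauss \<eta> x)"
      using norm_triangle_ineq4[of "aux_num s x" "M * saddle_gauss \<eta> x"] by (simp add: norm_mult)
    also have "\<dots> \<le> norm M * (7 * exp 9) * exp (- v\<^sup>2 / 25) + norm M * (exp 9 * exp (- v\<^sup>2 / 25))"
    proof (intro add_mono mult_left_mono)
      show "norm (aux_num s x) \<le> norm M * (7 * exp 9) * exp (- v\<^sup>2 / 25)"
        unfolding x_def v_def by (rule aux_num_le[OF b q])
      have "exp 4 * exp (- v\<^sup>2 / 25) \<le> exp 9 * exp (- v\<^sup>2 / 25)" by (intro mult_right_mono e49) auto
      then show "norm (saddle_gauss \<eta> x) \<le> exp 9 * exp (- v\<^sup>2 / 25)" using g by linarith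
    qed auto
    also have "\<dots> = (8 * exp 9 * norm M * exp (- v\<^sup>2 / 25)) * 1" by simp
    also have "\<dots> \<le> (8 * exp 9 * norm M * exp (- v\<^sup>2 / 25)) * (27 * ((1 + \<bar>v\<bar>) ^ 3 / h))"
      by (intro mult_left_mono one) auto
    also have "\<dots> = 216 * exp 9 * (norm M * ((1 + \<bar>v\<bar>) ^ 3 / h) * exp (- v\<^sup>2 / 25))" by simp
    also have "\<dots> \<le> 300 * exp 9 * (norm M * ((1 + \<bar>v\<bar>) ^ 3 / h) * exp (- v\<^sup>2 / 25))"
      by (intro mult_right_mono p0) auto
    finally show ?thesis unfolding x_def v_def h_def by (simp only: mult.assoc)
  qed
qed

text \<open>The sine grows like exp(pi |q - b| / sqrt 2), and q0 - b0 = sqrt 2 Im eta; this produces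
  the factor exp(-pi Im eta) that matches the size of the main term. The offset v is left free, so
  that the bound serves the Gaussian centred at q0 as well as the mirrored one at -q0.\<close>

lemma inverse_two_i_sin_le:
  assumes "sqrt 2 * b = of_int n + 1/2" "\<bar>q - b\<bar> \<ge> (q0 - b0) - \<bar>v\<bar> - 3/4"
  shows "1 / norm (two_i_sin (line_pt b q)) \<le> 2 * exp 2 * exp (- pi * Im \<eta>) * exp (3 * \<bar>v\<bar>)"
proof -
  let ?t = "norm (two_i_sin (line_pt b q))"
  \<comment> \<open>Since c <= 5/2, the weight of |v| is at most 3 and the loss 3/4 c is at most
    2.\<close>
  define c where "c = pi / sqrt 2"
  have s2: "7/5 \<le> sqrt (2::real)" by (rule real_le_rsqrt) (simp add: power2_eq_square)
  have c: "0 \<le> c" "c \<le> 5/2"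
  proof -
    have "c \<le> pi / (7/5)" unfolding c_def using s2 by (intro divide_left_mono) auto
    also have "\<dots> \<le> 5/2" using pi_approx by simp
    finally show "c \<le> 5/2" .
  qed (simp add: c_def)
  have "c * ((q0 - b0) - \<bar>v\<bar> - 3/4) \<le> c * \<bar>q - b\<bar>" using assms(2) c by (intro mult_left_mono) auto
  moreover have "c * ((q0 - b0) - \<bar>v\<bar> - 3/4) = pi * Im \<eta> - c * \<bar>v\<bar> - c * (3/4)"
  proof -
    have "pi * Im \<eta> = c * (q0 - b0)" unfolding c_def eta2_eq by simp
    then show ?thesis by (simp add: algebra_simps)
  qed
  moreover have "c * \<bar>v\<bar> \<le> 3 * \<bar>v\<bar>" using c by (intro mult_right_mono) auto
  ultimately have "pi * Im \<eta> - 3 * \<bar>v\<bar> - 2 \<le> pi * \<bar>q - b\<bar> / sqrt 2" using c unfolding c_def by simp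
  then have "exp (pi * Im \<eta> - 3 * \<bar>v\<bar> - 2) \<le> exp (pi * \<bar>q - b\<bar> / sqrt 2)" by simp
  also have "\<dots> \<le> 2 * ?t"
    using norm_two_i_sin_half_integer_line[OF assms(1), of q] by simp
  finally have 1: "exp (pi * Im \<eta> - 3 * \<bar>v\<bar> - 2) / 2 \<le> ?t" by simp
  have "1 / ?t \<le> 1 / (exp (pi * Im \<eta> - 3 * \<bar>v\<bar> - 2) / 2)"
    using 1 by (intro divide_left_mono mult_pos_pos less_le_trans[OF _ 1]) auto
  also have "\<dots> = 2 * exp 2 * exp (- pi * Im \<eta>) * exp (3 * \<bar>v\<bar>)"
    by (simp add: exp_diff exp_minus exp_add field_simps)
  finally show ?thesis .
qed

lemma exp_combine_le:
  fixes v k A :: real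
  assumes "0 \<le> k" "k \<le> 6" "A \<ge> 0"
  shows "A * (exp (- v\<^sup>2 / 25) * exp (k * \<bar>v\<bar>)) \<le> A * (exp 450 * exp (- v\<^sup>2 / 50))"
proof (intro mult_left_mono assms(3))
  have "k * \<bar>v\<bar> \<le> 6 * \<bar>v\<bar>" using assms by (intro mult_right_mono) auto
  then have "- v\<^sup>2 / 25 + k * \<bar>v\<bar> \<le> 450 + - v\<^sup>2 / 50" using linear_le_quadratic[of v] by simp
  then show "exp (- v\<^sup>2 / 25) * exp (k * \<bar>v\<bar>) \<le> exp 450 * exp (- v\<^sup>2 / 50)"
    unfolding exp_add[symmetric] by simp
qed

text \<open>To the right of -q0 / 2 the saddle comparison is multiplied by the sine bound. To the
  left numerator and Gaussian are estimated separately, as each is small by itself. The exponent is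
  461 = 9 + 2 + 450.\<close>

lemma integrand_le:
  assumes b: "b > 0" "\<bar>b - b0\<bar> \<le> 3/4" "sqrt 2 * b = of_int n + 1/2"
  shows "norm (aux_num s (line_pt b q) / two_i_sin (line_pt b q) - M * (saddle_gauss \<eta> (line_pt b q) / two_i_sin (line_pt b q)))
    \<le> 600 * exp 461 * norm M * exp (- pi * Im \<eta>)
       * (exp (- (q - q0)\<^sup>2 / 50) / norm \<eta> + exp (- Im s / 2) * exp (- (q + q0)\<^sup>2 / 50))"
proof -
  define F where "F = aux_num s (line_pt b q)"
  define G where "G = saddle_gauss \<eta> (line_pt b q)"
  define T where "T = 1 / norm (two_i_sin (line_pt b q))"
  define h where "h = norm \<eta>"
  have h: "h > 0" unfolding h_def using big(1) by linarith
  define E where "E = exp (- pi * Im \<eta>)"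
  have E0: "E > 0" unfolding E_def by simp
  have T0: "T \<ge> 0" unfolding T_def by simp
  define m where "m = norm M"
  have m0: "m \<ge> 0" unfolding m_def by simp
  let ?K = "600 * exp 461 * m * E"
  have e: "exp 461 = exp 9 * exp 2 * (exp 450 :: real)" by (simp add: exp_add[symmetric])
  have "norm (F / two_i_sin (line_pt b q) - M * (G / two_i_sin (line_pt b q))) = norm (F - M * G) * T"
    unfolding T_def by (simp add: diff_divide_distrib[symmetric] norm_divide)
  also have "\<dots> \<le> ?K * (exp (- (q - q0)\<^sup>2 / 50) / h + exp (- Im s / 2) * exp (- (q + q0)\<^sup>2 / 50))"
  proof (cases "q \<ge> - q0 / 2")
    case True
    define v where "v = q - q0"
    have T: "T \<le> 2 * exp 2 * E * exp (3 * \<bar>v\<bar>)"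
      unfolding T_def E_def v_def by (rule inverse_two_i_sin_le[OF b(3)]) (use b(2) in arith)
    have "norm (F - M * G) \<le> 300 * exp 9 * m * ((1 + \<bar>v\<bar>) ^ 3 / h) * exp (- v\<^sup>2 / 25)"
      unfolding F_def G_def m_def v_def h_def by (rule aux_num_saddle_diff_le[OF b(1,2) True])
    also have "\<dots> \<le> 300 * exp 9 * m * (exp (3 * \<bar>v\<bar>) / h) * exp (- v\<^sup>2 / 25)"
      using h m0 by (intro mult_right_mono mult_left_mono divide_right_mono one_add_abs_cube_le_exp) auto
    finally have "norm (F - M * G) * T \<le> (300 * exp 9 * m * (exp (3 * \<bar>v\<bar>) / h) * exp (- v\<^sup>2 / 25)) * (2 * exp 2 * E * exp (3 * \<bar>v\<bar>))"
      using T T0 m0 h by (intro mult_mono) auto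
    also have "\<dots> = (600 * exp 9 * exp 2 * m * E / h) * (exp (- v\<^sup>2 / 25) * (exp (3 * \<bar>v\<bar>) * exp (3 * \<bar>v\<bar>)))"
      by simp
    also have "exp (3 * \<bar>v\<bar>) * exp (3 * \<bar>v\<bar>) = exp (6 * \<bar>v\<bar>)" by (simp add: exp_add[symmetric])
    also have "(600 * exp 9 * exp 2 * m * E / h) * (exp (- v\<^sup>2 / 25) * exp (6 * \<bar>v\<bar>))
        \<le> (600 * exp 9 * exp 2 * m * E / h) * (exp 450 * exp (- v\<^sup>2 / 50))"
      using m0 h E0 by (intro exp_combine_le) auto
    also have "\<dots> = ?K * (exp (- v\<^sup>2 / 50) / h + 0)" unfolding e by simp
    also have "\<dots> \<le> ?K * (exp (- v\<^sup>2 / 50) / h + exp (- Im s / 2) * exp (- (q + q0)\<^sup>2 / 50))"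
      using m0 E0 by (intro mult_left_mono add_left_mono) auto
    finally show ?thesis unfolding v_def .
  next
    case False
    then have q: "q \<le> - q0 / 2" by simp
    define v where "v = q - q0"
    define w where "w = q + q0"
    have q0p: "q0 > 0" using q0_ge by linarith
    have Tv: "T \<le> 2 * exp 2 * E * exp (3 * \<bar>v\<bar>)"
      unfolding T_def E_def v_def by (rule inverse_two_i_sin_le[OF b(3)]) (use b(2) in arith)
    have Tw: "T \<le> 2 * exp 2 * E * exp (3 * \<bar>w\<bar>)"
      unfolding T_def E_def w_def by (rule inverse_two_i_sin_le[OF b(3)]) (use b(1,2) b0_pos q q0p in arith)
    have "norm F \<le> exp (- Im s / 2) * (m * (7 * exp 9) * exp (- w\<^sup>2 / 25))"
      unfolding F_def m_def w_def by (rule aux_num_le_far[OF b(1,2) q])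
    then have "norm F * T \<le> (exp (- Im s / 2) * (m * (7 * exp 9) * exp (- w\<^sup>2 / 25))) * (2 * exp 2 * E * exp (3 * \<bar>w\<bar>))"
      using Tw T0 m0 by (intro mult_mono) auto
    also have "\<dots> = (14 * exp 9 * exp 2 * m * E * exp (- Im s / 2)) * (exp (- w\<^sup>2 / 25) * exp (3 * \<bar>w\<bar>))"
      by simp
    also have "\<dots> \<le> (14 * exp 9 * exp 2 * m * E * exp (- Im s / 2)) * (exp 450 * exp (- w\<^sup>2 / 50))"
      using m0 E0 by (intro exp_combine_le) auto
    also have "\<dots> = 14 * (exp 461 * m * E * (exp (- Im s / 2) * exp (- w\<^sup>2 / 50)))" unfolding e by simp
    also have "\<dots> \<le> 600 * (exp 461 * m * E * (exp (- Im s / 2) * exp (- w\<^sup>2 / 50)))"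
      using m0 E0 by (intro mult_right_mono) auto
    finally have 1: "norm F * T \<le> ?K * (exp (- Im s / 2) * exp (- w\<^sup>2 / 50))" by simp
    have "norm G \<le> exp 4 * exp (- 2 * pi * v\<^sup>2)"
      unfolding G_def v_def by (rule norm_saddle_gauss_le[OF b(2)])
    also have "\<dots> \<le> exp 9 * exp (- v\<^sup>2 / 25)"
    proof -
      have "v\<^sup>2 / 25 \<le> 2 * pi * v\<^sup>2"
        using pi_gt3 mult_right_mono[of "1/25" "2 * pi" "v\<^sup>2"] by simp
      then show ?thesis by (intro mult_mono) auto
    qed
    finally have G: "norm G \<le> exp 9 * exp (- v\<^sup>2 / 25)" .
    \<comment> \<open>On the left part |v| exceeds q0, which is of the order of |eta|. The missing
      factor 1 / |eta| is bought with one more exp |v|.\<close>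
    have "h \<le> 2 * exp \<bar>v\<bar>"
    proof -
      have "sqrt 2 \<le> 2" by (rule real_le_lsqrt) auto
      then have "sqrt 2 * q0 \<le> 2 * q0" using q0p by (intro mult_right_mono) auto
      moreover have "q0 \<le> \<bar>v\<bar>" unfolding v_def using q q0p by arith
      moreover have "\<bar>v\<bar> \<le> exp \<bar>v\<bar>" using exp_ge_add_one_self[of "\<bar>v\<bar>"] by linarith
      ultimately show ?thesis using norm_eta_le unfolding h_def by linarith
    qed
    then have one: "1 \<le> 2 * exp \<bar>v\<bar> / h" using h by (simp add: le_divide_eq)
    have "(m * norm G) * T \<le> (m * (exp 9 * exp (- v\<^sup>2 / 25))) * (2 * exp 2 * E * exp (3 * \<bar>v\<bar>))"
      using Tv T0 m0 G by (intro mult_mono mult_left_mono) auto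
    also have "\<dots> = (m * (exp 9 * exp (- v\<^sup>2 / 25))) * (2 * exp 2 * E * exp (3 * \<bar>v\<bar>)) * 1" by simp
    also have "\<dots> \<le> (m * (exp 9 * exp (- v\<^sup>2 / 25))) * (2 * exp 2 * E * exp (3 * \<bar>v\<bar>)) * (2 * exp \<bar>v\<bar> / h)"
      using m0 E0 by (intro mult_left_mono one) auto
    also have "\<dots> = (4 * exp 9 * exp 2 * m * E / h) * (exp (- v\<^sup>2 / 25) * (exp (3 * \<bar>v\<bar>) * exp \<bar>v\<bar>))"
      by simp
    also have "exp (3 * \<bar>v\<bar>) * exp \<bar>v\<bar> = exp (4 * \<bar>v\<bar>)" by (simp add: exp_add[symmetric])
    also have "(4 * exp 9 * exp 2 * m * E / h) * (exp (- v\<^sup>2 / 25) * exp (4 * \<bar>v\<bar>))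
        \<le> (4 * exp 9 * exp 2 * m * E / h) * (exp 450 * exp (- v\<^sup>2 / 50))"
      using m0 h E0 by (intro exp_combine_le) auto
    also have "\<dots> = 4 * (exp 461 * m * E * (exp (- v\<^sup>2 / 50) / h))" unfolding e by simp
    also have "\<dots> \<le> 600 * (exp 461 * m * E * (exp (- v\<^sup>2 / 50) / h))"
      using m0 E0 h by (intro mult_right_mono) auto
    finally have 2: "(m * norm G) * T \<le> ?K * (exp (- v\<^sup>2 / 50) / h)" by simp
    have "norm (F - M * G) \<le> norm F + m * norm G"
      unfolding m_def norm_mult[symmetric] by (rule norm_triangle_ineq4)
    then have "norm (F - M * G) * T \<le> norm F * T + (m * norm G) * T"
      using T0 by (simp add: distrib_right[symmetric] mult_right_mono)
    also have "\<dots> \<le> ?K * (exp (- v\<^sup>2 / 50) / h + exp (- Im s / 2) * exp (- w\<^sup>2 / 50))"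
      unfolding distrib_left using 1 2 by linarith
    finally show ?thesis unfolding v_def w_def .
  qed
  finally show ?thesis unfolding F_def G_def m_def E_def h_def .
qed

lemma line_int_diff_le:
  assumes b: "\<bar>(real N + 1/2) / sqrt 2 - b0\<bar> \<le> 3/4"
  shows "norm (line_int (\<lambda>x. aux_num s x / two_i_sin x) ((real N + 1/2) / sqrt 2)
      - M * line_int (\<lambda>x. saddle_gauss \<eta> x / two_i_sin x) ((real N + 1/2) / sqrt 2))
    \<le> 600 * exp 461 * (LINT v|lborel. exp (- v\<^sup>2 / 50)) * norm M * exp (- pi * Im \<eta>) * (1 / norm \<eta> + exp (- Im s / 2))"
proof -
  define b where "b = (real N + 1/2) / sqrt 2"
  have b0': "b > 0" unfolding b_def by (simp add: add_nonneg_pos)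
  have sb: "sqrt 2 * b = of_int (int N) + 1/2" unfolding b_def by simp
  define F where "F q = aux_num s (line_pt b q) / two_i_sin (line_pt b q)" for q
  define G where "G q = saddle_gauss \<eta> (line_pt b q) / two_i_sin (line_pt b q)" for q
  define K where "K = 600 * exp 461 * norm M * exp (- pi * Im \<eta>)"
  have iF: "integrable lborel F" unfolding F_def b_def by (rule integrable_aux_line[OF Re_s_le])
  have iG: "integrable lborel G" unfolding G_def
  proof (rule integrable_line[OF sb])
    show "continuous_on (range (line_pt b)) (saddle_gauss \<eta>)"
      unfolding saddle_gauss_def[abs_def] by (intro continuous_intros)
    show "norm (saddle_gauss \<eta> (line_pt b q)) \<le> exp (2 * ((Re \<eta> + Im \<eta>) / sqrt 2)\<^sup>2 + 2 * pi * (\<bar>b\<bar> + \<bar>(Re \<eta> - Im \<eta>) / sqrt 2\<bar>)\<^sup>2) * exp (- q\<^sup>2)" for q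
      by (rule saddle_gauss_decay) simp
  qed
  have i1: "integrable lborel (\<lambda>q. exp (- (q - q0)\<^sup>2 / 50) / norm \<eta>)"
    using integrable_gaussian50[of "- q0"] by simp
  have i2: "integrable lborel (\<lambda>q. exp (- Im s / 2) * exp (- (q + q0)\<^sup>2 / 50))"
    using integrable_gaussian50[of "q0"] by simp
  have "line_int (\<lambda>x. aux_num s x / two_i_sin x) b - M * line_int (\<lambda>x. saddle_gauss \<eta> x / two_i_sin x) b
     = - exp (\<i> * of_real pi / 4) * ((LINT q|lborel. F q) - M * (LINT q|lborel. G q))"
    unfolding line_int_def F_def G_def by (simp add: algebra_simps)
  also have "(LINT q|lborel. F q) - M * (LINT q|lborel. G q) = (LINT q|lborel. F q - M * G q)"
    using iF iG by simp
  also have "norm (- exp (\<i> * of_real pi / 4) * (LINT q|lborel. F q - M * G q)) = norm (LINT q|lborel. F q - M * G q)"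
    by (simp add: norm_mult)
  also have "\<dots> \<le> (LINT q|lborel. norm (F q - M * G q))" by (rule integral_norm_bound)
  also have "\<dots> \<le> (LINT q|lborel. K * (exp (- (q - q0)\<^sup>2 / 50) / norm \<eta> + exp (- Im s / 2) * exp (- (q + q0)\<^sup>2 / 50)))"
  proof (rule integral_mono)
    show "integrable lborel (\<lambda>q. norm (F q - M * G q))" using iF iG by simp
    show "integrable lborel (\<lambda>q. K * (exp (- (q - q0)\<^sup>2 / 50) / norm \<eta> + exp (- Im s / 2) * exp (- (q + q0)\<^sup>2 / 50)))"
      by (intro integrable_mult_right Bochner_Integration.integrable_add i1 i2)
    show "norm (F q - M * G q) \<le> K * (exp (- (q - q0)\<^sup>2 / 50) / norm \<eta> + exp (- Im s / 2) * exp (- (q + q0)\<^sup>2 / 50))" for q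
      unfolding F_def G_def K_def using b unfolding b_def[symmetric] by (intro integrand_le[OF b0' _ sb])
  qed
  also have "\<dots> = K * ((LINT q|lborel. exp (- (q - q0)\<^sup>2 / 50) / norm \<eta>) + (LINT q|lborel. exp (- Im s / 2) * exp (- (q + q0)\<^sup>2 / 50)))"
    unfolding integral_mult_right_zero by (subst Bochner_Integration.integral_add[OF i1 i2]) simp
  also have "\<dots> = K * (LINT v|lborel. exp (- v\<^sup>2 / 50)) * (1 / norm \<eta> + exp (- Im s / 2))"
    using integral_gaussian50_shift[of q0] integral_gaussian50_shift[of "- q0"] by (simp add: algebra_simps)
  finally show ?thesis unfolding K_def b_def by (simp add: mult_ac)
qed

end

section \<open>The finite sum against a geometric series\<close>

lemma saddle_gauss_of_int_shift:
  "cos (of_real pi * of_int (m - int k)) * saddle_gauss \<eta> (of_int (m - int k))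
   = cos (of_real pi * of_int m) * saddle_gauss \<eta> (of_int m) * (- exp (4 * of_real pi * \<i> * \<eta>)) ^ k"
proof -
  have c: "cos (of_real pi * of_int (m - int k)) = cos (of_real pi * of_int m) * (-1 :: complex) ^ k"
    unfolding cos_pi_of_int by (cases "even m"; cases "even k") auto
  \<comment> \<open>The contributions of k^2 and k m to the exponent are integer multiples of 2 pi
    i. With the sign of the cosine, the Gaussian at the integers is thus a geometric progression of
    ratio -exp(4 pi i eta).\<close>
  have one: "exp (2 * of_int j * of_real pi * \<i>) = 1" for j :: int
    by (auto simp: exp_eq_1)
  have "2 * of_real pi * \<i> * (of_int (m - int k) - \<eta>)\<^sup>2
      = 2 * of_real pi * \<i> * (of_int m - \<eta>)\<^sup>2 + of_nat k * (4 * of_real pi * \<i> * \<eta>)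
        + 2 * of_int (int k * int k - 2 * int k * m) * of_real pi * \<i>"
    by (simp add: power2_eq_square algebra_simps)
  then have "saddle_gauss \<eta> (of_int (m - int k)) = saddle_gauss \<eta> (of_int m) * exp (4 * of_real pi * \<i> * \<eta>) ^ k"
    unfolding saddle_gauss_def by (simp only: exp_add one exp_of_nat_mult mult_1_right)
  then show ?thesis unfolding c by (simp add: power_minus[of "exp _"])
qed

lemma norm_saddle_gauss_of_int: "norm (saddle_gauss \<eta> (of_int n)) = exp (4 * pi * Im \<eta> * (of_int n - Re \<eta>))"
proof -
  have "Re (2 * of_real pi * \<i> * (of_int n - \<eta>)\<^sup>2) = 4 * pi * Im \<eta> * (of_int n - Re \<eta>)"
    by (simp add: power2_eq_square algebra_simps)
  then show ?thesis unfolding saddle_gauss_def by (simp only: norm_exp_eq_Re)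
qed

text \<open>As y may be small, the polynomial weight is charged to (1 + 3 / y)^3, while half of the
  exponential decay is kept for the summation.\<close>

lemma cube_exp_bound:
  fixes y :: real
  assumes "y > 0"
  shows "(1 + real k) ^ 3 * exp (- 2 * y * k) \<le> (1 + 3 / y) ^ 3 * exp (- y) ^ k"
proof -
  have "1 + real k \<le> (1 + 3 / y) * (1 + y * k / 3)"
    using assms by (simp add: field_simps)
  also have "\<dots> \<le> (1 + 3 / y) * exp (y * k / 3)"
    using assms exp_ge_add_one_self[of "y * k / 3"] by (intro mult_left_mono) auto
  finally have "(1 + real k) ^ 3 \<le> ((1 + 3 / y) * exp (y * k / 3)) ^ 3" by (intro power_mono) auto
  also have "\<dots> = (1 + 3 / y) ^ 3 * exp (y * k)"
    using exp_of_nat_mult[of 3 "y * k / 3"] by (simp add: power_mult_distrib)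
  finally have "(1 + real k) ^ 3 * exp (- 2 * y * k) \<le> (1 + 3 / y) ^ 3 * exp (y * k) * exp (- 2 * y * k)"
    by (intro mult_right_mono) auto
  also have "\<dots> = (1 + 3 / y) ^ 3 * exp (of_nat k * - y)"
    unfolding mult.assoc exp_add[symmetric] by (simp add: mult.commute)
  also have "exp (of_nat k * - y) = exp (- y) ^ k" by (rule exp_of_nat_mult)
  finally show ?thesis .
qed

context saddle_setup
begin

text \<open>Here k counts down from N; once N - k <= 0, only the Gaussian term remains. For the
  powers of n, the decay in k comes from the growth of n^(-Re s), and the factor exp(-2 (Im eta)^2 /
  25) from regarding N as a point on a line near the saddle.\<close>

lemma sum_term_le:
  assumes N: "real N \<le> Re \<eta> - Im \<eta>" "Re \<eta> - Im \<eta> < real N + 1"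
  shows "norm ((if k < N then aux_num s (of_nat (N - k)) else 0) - M * saddle_gauss \<eta> (of_int (int N - int k)))
     \<le> 2400 * exp 9 * norm M * exp (- 2 * (Im \<eta>)\<^sup>2 / 25) * (1 + Im \<eta>) ^ 3 / norm \<eta> * ((1 + real k) ^ 3 * exp (- 2 * (pi * Im \<eta>) * k))"
proof -
  define n where "n = int N - int k"
  define y where "y = Im \<eta>"
  have y: "y > 0" unfolding y_def by (rule eta)
  define h where "h = norm \<eta>"
  have h: "h \<ge> 12" unfolding h_def by (rule big)
  define m where "m = norm M"
  have m0: "m \<ge> 0" unfolding m_def by simp
  define z where "z = norm (of_int n - \<eta>)"
  have z0: "z \<ge> 0" unfolding z_def by simp
  define F where "F = (if k < N then aux_num s (of_nat (N - k)) else 0)"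
  define G where "G = saddle_gauss \<eta> (of_int n)"
  define P where "P = exp (- 2 * y\<^sup>2 / 25) * exp (- 2 * (pi * y) * k)"
  have P0: "P > 0" unfolding P_def by simp
  have z1: "1 + z \<le> 2 * ((1 + real k) * (1 + y))"
  proof -
    have "z \<le> \<bar>of_int n - Re \<eta>\<bar> + \<bar>Im \<eta>\<bar>"
      unfolding z_def using cmod_le[of "of_int n - \<eta>"] by simp
    also have "\<dots> \<le> real k + 1 + 2 * y" unfolding n_def y_def using N eta by simp
    finally have "z \<le> real k + 1 + 2 * y" .
    moreover have "2 * ((1 + real k) * (1 + y)) = 2 + 2 * real k + 2 * y + 2 * (real k * y)"
      by (simp add: algebra_simps)
    moreover have "real k * y \<ge> 0" using y by simp
    ultimately show ?thesis by simp
  qed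
  have G: "norm G \<le> P"
  proof -
    have "4 * pi * y * (of_int n - Re \<eta>) \<le> 4 * pi * y * (- y - k)"
      unfolding n_def using N y unfolding y_def by (intro mult_left_mono) auto
    also have "\<dots> = - (4 * pi * y\<^sup>2) - 4 * (pi * y) * k" by (simp add: power2_eq_square algebra_simps)
    also have "\<dots> \<le> - 2 * y\<^sup>2 / 25 + - 2 * (pi * y) * k"
    proof -
      have "2 / 25 * y\<^sup>2 \<le> 4 * pi * y\<^sup>2" using pi_gt3 by (intro mult_right_mono) auto
      moreover have "pi * y * k \<ge> 0" using y by simp
      ultimately show ?thesis by linarith
    qed
    finally show ?thesis unfolding G_def norm_saddle_gauss_of_int P_def exp_add[symmetric] y_def by simp
  qed
  have F: "norm F \<le> 7 * exp 9 * m * P"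
  proof (cases "k < N")
    case True
    have npow: "norm (aux_num s (of_nat j)) = real j powr (- Re s)" if "j > 0" for j :: nat
    proof -
      have "norm ((of_nat j :: complex) powr (- s)) = real j powr (- Re s)"
        using norm_powr_real_powr[of "of_nat j :: complex" "- s"] by simp
      moreover have "norm (exp (of_real pi * \<i> * (of_nat j)\<^sup>2)) = 1"
      proof -
        have "of_real pi * \<i> * (of_nat j)\<^sup>2 = \<i> * complex_of_real (pi * (real j)\<^sup>2)" by simp
        then show ?thesis by (simp only: norm_exp_i_times)
      qed
      ultimately show ?thesis unfolding aux_num_def norm_mult by simp
    qed
    define \<sigma> where "\<sigma> = - Re s"
    have \<sigma>: "\<sigma> \<ge> 0" unfolding \<sigma>_def using Re_s_le by simp
    have Np: "real N > 0" using True by simp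
    \<comment> \<open>This turns (N - k)^sigma into at most N^sigma exp(-sigma k / N), and sigma / N
      >= 2 pi Im eta because N <= Re eta and sigma = 4 pi Re eta Im eta - 1.\<close>
    have "1 - real k / N \<le> exp (- real k / N)" using exp_ge_add_one_self[of "- real k / N"] by simp
    then have "real N * (1 - real k / N) \<le> real N * exp (- real k / N)" using Np by (intro mult_left_mono) auto
    moreover have "real N * (1 - real k / N) = real (N - k)" using True by (simp add: field_simps of_nat_diff)
    ultimately have "real (N - k) powr \<sigma> \<le> (real N * exp (- real k / N)) powr \<sigma>"
      using \<sigma> True by (intro powr_mono2) auto
    also have "\<dots> = real N powr \<sigma> * exp (- (\<sigma> / N * k))"
      by (simp add: powr_mult exp_powr_real mult.commute)
    also have "exp (- (\<sigma> / N * k)) \<le> exp (- 2 * (pi * y) * k)"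
    proof -
      have "2 * (pi * y) * N \<le> \<sigma>"
      proof -
        have "2 * (pi * y) * N \<le> 2 * (pi * y) * Re \<eta>" using N eta y by (intro mult_left_mono) auto
        also have "\<dots> = 2 * pi * (Re \<eta> * Im \<eta>)" unfolding y_def by simp
        also have "\<dots> \<le> 4 * pi * (Re \<eta> * Im \<eta>) - 1"
        proof -
          have "2 * 3 * 1 \<le> 2 * pi * (Re \<eta> * Im \<eta>)" using big(2) pi_gt3 by (intro mult_mono) auto
          then show ?thesis by linarith
        qed
        finally show ?thesis unfolding \<sigma>_def Re_s_eq .
      qed
      then have "2 * (pi * y) \<le> \<sigma> / N" using Np by (simp add: le_divide_eq)
      then have "2 * (pi * y) * k \<le> \<sigma> / N * k" by (intro mult_right_mono) auto
      then show ?thesis by simp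
    qed
    finally have f1: "real (N - k) powr \<sigma> \<le> real N powr \<sigma> * exp (- 2 * (pi * y) * k)" by (simp add: mult_left_mono)
    have f2: "real N powr \<sigma> \<le> m * (7 * exp 9) * exp (- 2 * y\<^sup>2 / 25)"
    proof -
      \<comment> \<open>N is the point \<open>line_pt b b\<close>, on a line within 1 / sqrt 2 of
        the saddle. Its coordinate satisfies q0 - b >= q0 - b0 = sqrt 2 Im eta, so
        \<open>aux_num_le\<close> provides a Gaussian in \<open>Im \<eta>\<close>.\<close>
      define b where "b = real N / sqrt 2"
      have b: "b > 0" unfolding b_def using Np by simp
      have bb: "b \<le> b0" unfolding b_def b0_def using N by (intro divide_right_mono) auto
      have "b0 \<le> (real N + 1) / sqrt 2" unfolding b0_def using N by (intro divide_right_mono) auto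
      also have "\<dots> = b + 1 / sqrt 2" unfolding b_def by (simp add: add_divide_distrib)
      also have "1 / sqrt 2 \<le> 3 / (4::real)"
      proof -
        have "4/3 \<le> sqrt (2::real)" by (rule real_le_rsqrt) (simp add: power2_eq_square)
        then show ?thesis by (simp add: field_simps)
      qed
      finally have b3: "\<bar>b - b0\<bar> \<le> 3/4" using bb by simp
      have "line_pt b b = of_nat N" unfolding b_def by (simp add: complex_eq_iff)
      then have "real N powr \<sigma> = norm (aux_num s (line_pt b b))" using npow[of N] Np unfolding \<sigma>_def by simp
      also have "\<dots> \<le> m * (7 * exp 9) * exp (- (b - q0)\<^sup>2 / 25)"
        unfolding m_def using b q0_ge by (intro aux_num_le b3) auto
      also have "\<dots> \<le> m * (7 * exp 9) * exp (- 2 * y\<^sup>2 / 25)"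
      proof (intro mult_left_mono)
        have "(sqrt 2 * y)\<^sup>2 \<le> (q0 - b)\<^sup>2"
        proof (rule power_mono)
          show "sqrt 2 * y \<le> q0 - b" unfolding y_def eta2_eq using bb by simp
        qed (use y in auto)
        then have "2 * y\<^sup>2 \<le> (b - q0)\<^sup>2" by (simp add: power_mult_distrib power2_commute)
        then show "exp (- (b - q0)\<^sup>2 / 25) \<le> exp (- 2 * y\<^sup>2 / 25)" by simp
      qed (use m0 in auto)
      finally show ?thesis .
    qed
    have "norm F = real (N - k) powr \<sigma>" unfolding F_def \<sigma>_def using True npow[of "N - k"] by simp
    also have "\<dots> \<le> (m * (7 * exp 9) * exp (- 2 * y\<^sup>2 / 25)) * exp (- 2 * (pi * y) * k)"
      using f1 f2 by (meson exp_ge_zero mult_right_mono order_trans)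
    also have "\<dots> = 7 * exp 9 * m * P" unfolding P_def by simp
    finally show ?thesis .
  qed (use m0 P0 in \<open>simp add: F_def\<close>)
  have "norm (F - M * G) \<le> 300 * exp 9 * (m * P * ((1 + z) ^ 3 / h))"
  proof (cases "27 * z ^ 3 \<le> h")
    case True
    \<comment> \<open>Integers n <= 0 are outside the local range: they are at distance at least Re
      eta >= |eta| / 2, which contradicts 27 z^3 <= |eta| when |eta| >= 12.\<close>
    have "k < N"
    proof (rule ccontr)
      assume "\<not> k < N"
      then have "of_int n \<le> (0::real)" unfolding n_def by simp
      then have "Re \<eta> \<le> \<bar>Re (of_int n - \<eta>)\<bar>" using eta by simp
      also have "\<dots> \<le> z" unfolding z_def by (rule abs_Re_le_cmod)
      finally have "Re \<eta> \<le> z" .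
      moreover have "h \<le> \<bar>Re \<eta>\<bar> + \<bar>Im \<eta>\<bar>" unfolding h_def by (rule cmod_le)
      ultimately have hz: "h \<le> 2 * z" using eta by linarith
      then have "6 \<le> z" using h by linarith
      then have "6 * 6 \<le> z * z" by (intro mult_mono) auto
      then have "27 * 36 * z \<le> 27 * (z * z) * z" using z0 by (intro mult_right_mono) auto
      then have "27 * 36 * z \<le> h" using True by (simp add: power3_eq_cube)
      then show False using hz \<open>6 \<le> z\<close> by linarith
    qed
    then have Fe: "F = aux_num s (of_int n)" unfolding F_def n_def by (simp add: of_nat_diff)
    have "norm (F - M * G) \<le> m * norm G * (60 * (z ^ 3 + z) / h)"
      unfolding Fe G_def m_def z_def h_def using True unfolding z_def h_def by (rule aux_num_near)
    also have "\<dots> \<le> m * P * (120 * (1 + z) ^ 3 / h)"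
    proof -
      have "z ^ 3 \<le> (1 + z) ^ 3" using z0 by (intro power_mono) auto
      moreover have "1 + z \<le> (1 + z) ^ 3" using z0 by (intro self_le_power) auto
      ultimately have "z ^ 3 + z \<le> (1 + z) ^ 3 + (1 + z) ^ 3" by (intro add_mono) linarith+
      then have "60 * (z ^ 3 + z) \<le> 120 * (1 + z) ^ 3" by simp
      then have kk: "60 * (z ^ 3 + z) / h \<le> 120 * (1 + z) ^ 3 / h" using h by (intro divide_right_mono) auto
      show ?thesis by (rule mult_mono[OF mult_left_mono[OF G] kk]) (use h z0 m0 P0 in auto)
    qed
    also have "\<dots> = 120 * (m * P * ((1 + z) ^ 3 / h))" by simp
    also have "\<dots> \<le> 300 * exp 9 * (m * P * ((1 + z) ^ 3 / h))"
    proof (rule mult_right_mono)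
      have "(1::real) \<le> exp 9" by simp
      then show "120 \<le> 300 * (exp 9 :: real)" by linarith
    qed (use m0 P0 z0 h in auto)
    finally show ?thesis .
  next
    case False
    moreover have "z ^ 3 \<le> (1 + z) ^ 3" using z0 by (intro power_mono) auto
    ultimately have one: "1 \<le> 27 * ((1 + z) ^ 3 / h)" using h by (simp add: le_divide_eq)
    have "norm (F - M * G) \<le> norm F + m * norm G"
      unfolding m_def norm_mult[symmetric] by (rule norm_triangle_ineq4)
    also have "\<dots> \<le> 7 * exp 9 * m * P + m * (exp 9 * P)"
    proof (intro add_mono F mult_left_mono m0)
      have "1 * P \<le> exp 9 * P" using P0 by (intro mult_right_mono) auto
      then show "norm G \<le> exp 9 * P" using G by simp
    qed
    also have "\<dots> = 8 * exp 9 * (m * P) * 1" by simp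
    also have "\<dots> \<le> 8 * exp 9 * (m * P) * (27 * ((1 + z) ^ 3 / h))"
      using m0 P0 by (intro mult_left_mono one) auto
    also have "\<dots> = 216 * (exp 9 * (m * P * ((1 + z) ^ 3 / h)))" by simp
    also have "\<dots> \<le> 300 * (exp 9 * (m * P * ((1 + z) ^ 3 / h)))"
      using m0 P0 z0 h by (intro mult_right_mono) auto
    finally show ?thesis by simp
  qed
  also have "\<dots> \<le> 300 * exp 9 * (m * P * ((8 * ((1 + real k) ^ 3 * (1 + y) ^ 3)) / h))"
  proof (intro mult_left_mono divide_right_mono)
    have "(1 + z) ^ 3 \<le> (2 * ((1 + real k) * (1 + y))) ^ 3" using z1 z0 by (intro power_mono) auto
    then show "(1 + z) ^ 3 \<le> 8 * ((1 + real k) ^ 3 * (1 + y) ^ 3)" by (simp add: power_mult_distrib)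
  qed (use m0 P0 h in auto)
  also have "\<dots> = 2400 * exp 9 * m * exp (- 2 * y\<^sup>2 / 25) * (1 + y) ^ 3 / h * ((1 + real k) ^ 3 * exp (- 2 * (pi * y) * k))"
    unfolding P_def by simp
  finally show ?thesis unfolding F_def G_def n_def m_def y_def h_def .
qed

text \<open>Exchanges the Gaussian in \<open>Im \<eta>\<close> for the size exp(-pi Im eta) of the
  main term, absorbing the cubic factor on the way. With y = \<open>Im \<eta>\<close>, the constant
  160 comes from 2 y^2 / 25 - 7 y + 160 > 0, where 7 = 3 + 4 and pi < 4.\<close>

lemma eta2_exp_bound: "exp (- 2 * (Im \<eta>)\<^sup>2 / 25) * (1 + Im \<eta>) ^ 3 \<le> exp 160 * exp (- pi * Im \<eta>)"
proof -
  define y where "y = Im \<eta>"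
  have y: "y > 0" unfolding y_def by (rule eta)
  have "(1 + y) ^ 3 \<le> exp (3 * y)" using one_add_abs_cube_le_exp[of y] y by simp
  then have "exp (- 2 * y\<^sup>2 / 25) * (1 + y) ^ 3 \<le> exp (- 2 * y\<^sup>2 / 25) * exp (3 * y)" by (intro mult_left_mono) auto
  also have "\<dots> \<le> exp (160 + - pi * y)"
  proof -
    have "0 \<le> (4 * y - 175)\<^sup>2" by simp
    then have "0 \<le> 16 * y\<^sup>2 - 1400 * y + 30625" by (simp add: power2_eq_square algebra_simps)
    moreover have "pi * y \<le> 4 * y" using pi_less_4 y by (intro mult_right_mono) auto
    ultimately have "- 2 * y\<^sup>2 / 25 + 3 * y \<le> 160 + - pi * y" by simp
    then show ?thesis unfolding exp_add[symmetric] by simp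
  qed
  finally show ?thesis unfolding y_def exp_add .
qed

text \<open>The finite sum is padded with zeros and compared termwise with the geometric series of
  Gaussians. The cubic weight gives three factors 1 + 1 / Im eta and the summation of exp(-y k) the
  fourth; 169 = 9 + 160.\<close>

lemma sum_diff_le:
  assumes N: "real N \<le> Re \<eta> - Im \<eta>" "Re \<eta> - Im \<eta> < real N + 1"
  shows "norm ((\<Sum>n=1..N. cos (of_real pi * of_nat n) * aux_num s (of_nat n))
       - M * (cos (of_real pi * of_nat N) * saddle_gauss \<eta> (of_nat N) / (1 + exp (4 * of_real pi * \<i> * \<eta>))))
     \<le> 2400 * exp 169 * norm M * exp (- pi * Im \<eta>) * ((1 + 1 / Im \<eta>) ^ 4 / norm \<eta>)"
proof -
  define y where "y = pi * Im \<eta>"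
  have y: "y > 0" unfolding y_def using eta by simp
  define h where "h = norm \<eta>"
  have h: "h > 0" unfolding h_def using big by linarith
  let ?S = "(\<Sum>n=1..N. cos (of_real pi * of_nat n) * aux_num s (of_nat n))"
  define X where "X = - exp (4 * of_real pi * \<i> * \<eta>)"
  have nX: "norm X < 1" unfolding X_def using eta by simp
  define c where "c k = (cos (of_real pi * of_int (int N - int k)) :: complex)" for k
  have nc: "norm (c k) = 1" for k unfolding c_def cos_pi_of_int by simp
  define F where "F k = (if k < N then aux_num s (of_nat (N - k)) else 0)" for k
  define G where "G k = saddle_gauss \<eta> (of_int (int N - int k))" for k
  define r where "r = cos (of_real pi * of_nat N) * saddle_gauss \<eta> (of_nat N)"
  define B where "B = 2400 * exp 9 * norm M * exp (- 2 * (Im \<eta>)\<^sup>2 / 25) * (1 + Im \<eta>) ^ 3 / h"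
  have B0: "B \<ge> 0" unfolding B_def using h eta by simp
  have Gs: "(\<lambda>k. c k * G k) sums (r / (1 - X))"
  proof -
    have "c k * G k = r * X ^ k" for k
      unfolding c_def G_def saddle_gauss_of_int_shift r_def X_def by simp
    moreover have "(\<lambda>k. r * X ^ k) sums (r * (1 / (1 - X)))" by (intro sums_mult geometric_sums nX)
    ultimately show ?thesis by simp
  qed
  have Fs: "(\<lambda>k. c k * F k) sums ?S"
  proof -
    have "(\<lambda>k. c k * F k) sums (\<Sum>k<N. c k * F k)"
      by (rule sums_finite) (auto simp: F_def)
    also have "(\<Sum>k<N. c k * F k) = ?S"
    proof (rule sum.reindex_bij_witness[of _ "\<lambda>n. N - n" "\<lambda>k. N - k"])
      fix k assume "k \<in> {..<N}"
      then show "cos (of_real pi * of_nat (N - k)) * aux_num s (of_nat (N - k)) = c k * F k"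
        unfolding c_def F_def by (simp add: of_nat_diff)
    qed auto
    finally show ?thesis .
  qed
  have D: "(\<lambda>k. c k * (F k - M * G k)) sums (?S - M * (r / (1 - X)))"
    using sums_diff[OF Fs sums_mult[OF Gs, of M]] by (simp add: algebra_simps)
  have ey: "norm (exp (- y)) < 1" using y by simp
  have maj: "(\<lambda>k. B * ((1 + 3 / y) ^ 3 * exp (- y) ^ k)) sums (B * ((1 + 3 / y) ^ 3 * (1 / (1 - exp (- y)))))"
    by (intro sums_mult geometric_sums ey)
  have le: "norm (c k * (F k - M * G k)) \<le> B * ((1 + 3 / y) ^ 3 * exp (- y) ^ k)" for k
  proof -
    have "norm (c k * (F k - M * G k)) = norm (F k - M * G k)" unfolding norm_mult nc by simp
    also have "\<dots> \<le> B * ((1 + real k) ^ 3 * exp (- 2 * y * k))"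
      unfolding F_def G_def B_def y_def h_def by (rule sum_term_le[OF N])
    also have "\<dots> \<le> B * ((1 + 3 / y) ^ 3 * exp (- y) ^ k)"
      by (intro mult_left_mono cube_exp_bound y B0)
    finally show ?thesis .
  qed
  have "norm (?S - M * (r / (1 - X)))
     \<le> B * ((1 + 3 / y) ^ 3 * (1 / (1 - exp (- y))))"
    unfolding sums_unique[OF D] sums_unique[OF maj]
    by (rule norm_suminf_le[OF le sums_summable[OF maj]])
  also have "\<dots> \<le> B * ((1 + 1 / Im \<eta>) ^ 3 * (1 + 1 / Im \<eta>))"
  proof (intro mult_left_mono mult_mono power_mono B0)
    show "1 + 3 / y \<le> 1 + 1 / Im \<eta>" unfolding y_def using eta pi_gt3 by (simp add: field_simps)
    have "exp (- y) \<le> 1 / (1 + y)"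
      using exp_ge_add_one_self[of y] y by (simp add: exp_minus field_simps)
    then have "1 / (1 - exp (- y)) \<le> 1 / (1 - 1 / (1 + y))"
      using y by (intro divide_left_mono mult_pos_pos) (auto simp: field_simps)
    also have "\<dots> = 1 + 1 / y" using y by (simp add: field_simps)
    also have "\<dots> \<le> 1 + 1 / Im \<eta>" unfolding y_def using eta pi_gt3 by (simp add: field_simps)
    finally show "1 / (1 - exp (- y)) \<le> 1 + 1 / Im \<eta>" .
  qed (use y eta in auto)
  also have "\<dots> = (2400 * exp 9 * norm M / h * (1 + 1 / Im \<eta>) ^ 4) * (exp (- 2 * (Im \<eta>)\<^sup>2 / 25) * (1 + Im \<eta>) ^ 3)"
    unfolding B_def by (simp add: power4_eq_xxxx power3_eq_cube)
  also have "\<dots> \<le> (2400 * exp 9 * norm M / h * (1 + 1 / Im \<eta>) ^ 4) * (exp 160 * exp (- pi * Im \<eta>))"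
    using h eta by (intro mult_left_mono eta2_exp_bound) auto
  also have "\<dots> = 2400 * (exp 9 * exp 160) * norm M * exp (- pi * Im \<eta>) * ((1 + 1 / Im \<eta>) ^ 4 / h)"
    by simp
  also have "exp 9 * exp 160 = (exp 169 :: real)" by (simp add: exp_add[symmetric])
  finally show ?thesis unfolding r_def X_def h_def by simp
qed

text \<open>Mordell's integral on the line at N + 1/2 contains the Gaussian r at N + 1 in the form r
  u^2 / (1 + u^2), with u = exp(2 pi i eta). The geometric series over n <= N sums to exactly minus
  this, so only the closed quotient survives.\<close>

lemma saddle_gauss_total:
  fixes N :: nat
  shows "line_int (\<lambda>x. saddle_gauss \<eta> x / two_i_sin x) ((real N + 1/2) / sqrt 2)
      + cos (of_real pi * of_nat N) * saddle_gauss \<eta> (of_nat N) / (1 + exp (4 * of_real pi * \<i> * \<eta>))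
    = - (of_real (sqrt 2) * exp (5 * of_real pi * \<i> / 8) * sin (of_real pi * \<eta>) / (2 * cos (2 * of_real pi * \<eta>)))"
proof -
  define J where "J = line_int (\<lambda>x. saddle_gauss \<eta> x / two_i_sin x) ((real N + 1/2) / sqrt 2)"
  define u where "u = exp (2 * of_real pi * \<i> * \<eta>)"
  have u0: "u \<noteq> 0" unfolding u_def by simp
  have E4: "exp (4 * of_real pi * \<i> * \<eta>) = u\<^sup>2" unfolding u_def exp_double[symmetric] by (simp add: mult.assoc)
  have E4': "exp (- (4 * of_real pi * \<i> * \<eta>)) = 1 / u\<^sup>2" unfolding exp_minus E4 by (simp add: inverse_eq_divide)
  have E2': "exp (- (2 * of_real pi * \<i> * \<eta>)) = 1 / u" unfolding exp_minus u_def by (simp add: inverse_eq_divide)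
  have "norm (u\<^sup>2) < 1" unfolding E4[symmetric] using eta by simp
  have u1: "1 + u\<^sup>2 \<noteq> 0"
  proof
    assume "1 + u\<^sup>2 = 0"
    then have "u\<^sup>2 = -1" by (simp add: add_eq_0_iff)
    then show False using \<open>norm (u\<^sup>2) < 1\<close> by simp
  qed
  define A where "A = of_real (sqrt 2) * exp (5 * of_real pi * \<i> / 8) * sin (of_real pi * \<eta>)"
  define r where "r = cos (of_real pi * of_int (int N + 1)) * saddle_gauss \<eta> (of_int (int N + 1))"
  have idx: "of_int (int N + 1) - 1/2 = real N + 1/2" by simp
  have J: "J * (1 + 1 / u\<^sup>2) = - (A * (1 / u)) + r"
    using mordell_integral[OF eta(1), of "int N + 1"] unfolding idx E4' E2' J_def A_def r_def .
  have R: "cos (of_real pi * of_nat N) * saddle_gauss \<eta> (of_nat N) = r * (- (u\<^sup>2))"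
    using saddle_gauss_of_int_shift[of "int N + 1" 1 \<eta>] unfolding r_def E4 by simp
  have cos2: "2 * cos (2 * of_real pi * \<eta>) = u + 1 / u"
    unfolding cos_exp_eq u_def by (simp add: exp_minus inverse_eq_divide mult_ac)
  have "J * (1 + u\<^sup>2) = J * (1 + 1 / u\<^sup>2) * u\<^sup>2" using u0 by (simp add: field_simps)
  also have "\<dots> = - (A * u) + r * u\<^sup>2" unfolding J using u0 by (simp add: field_simps power2_eq_square)
  finally have "J = (- (A * u) + r * u\<^sup>2) / (1 + u\<^sup>2)" using u1 by (simp only: eq_divide_eq) simp
  then have "J + r * (- (u\<^sup>2)) / (1 + u\<^sup>2) = - (A * u) / (1 + u\<^sup>2)" by (simp add: add_divide_distrib diff_divide_distrib)
  also have "\<dots> = - (A / (u + 1 / u))"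
  proof -
    have "u + 1 / u = (1 + u\<^sup>2) / u" using u0 by (simp add: field_simps power2_eq_square)
    then show ?thesis by simp
  qed
  finally show ?thesis unfolding R E4 cos2 J_def[symmetric] A_def .
qed

end

section \<open>Size of the main factor and the relative error\<close>

context saddle_setup
begin

definition main_factor :: complex where
  "main_factor = - (of_real (sqrt 2) * exp (5 * of_real pi * \<i> / 8) * sin (of_real pi * \<eta>) / (2 * cos (2 * of_real pi * \<eta>)))"

text \<open>With a = exp(pi Im eta), |sin pi eta| is at least sinh(pi Im eta) and |2 cos 2 pi eta|
  at most 2 a^2. The loss 1 + 1 / Im eta reflects the zeros of the sine on the real axis, which eta
  may approach.\<close>

lemma norm_main_factor_ge: "norm main_factor \<ge> exp (- pi * Im \<eta>) / (4 * (1 + 1 / Im \<eta>))"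
proof -
  define y where "y = pi * Im \<eta>"
  have y: "y > 0" unfolding y_def using eta by simp
  let ?c = "norm (2 * cos (2 * of_real pi * \<eta>))"
  let ?s = "norm (sin (of_real pi * \<eta>))"
  let ?e = "exp (\<i> * (2 * of_real pi * \<eta>))"
  let ?e' = "exp (- (\<i> * (2 * of_real pi * \<eta>)))"
  define a where "a = exp y"
  have a: "a > 1" unfolding a_def using y by simp
  have sinh_sq: "exp (2 * y) + inverse (exp (2 * y)) = (a - 1 / a)\<^sup>2 + 2"
    unfolding exp_double a_def[symmetric] using a by (simp add: field_simps power2_eq_square)
  have a1: "0 < a - 1 / a" using a by (simp add: field_simps less_1_mult)
  have sn: "?s \<ge> (a - 1 / a) / 2"
  proof (rule power2_le_imp_le)
    have "(?s)\<^sup>2 = ((a - 1 / a)\<^sup>2 + 2 - 2 * cos (2 * (pi * Re \<eta>))) / 4"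
      unfolding norm_sin_squared sinh_sq[symmetric] y_def by simp
    moreover have "cos (2 * (pi * Re \<eta>)) \<le> 1" by simp
    ultimately show "((a - 1 / a) / 2)\<^sup>2 \<le> (?s)\<^sup>2" by (simp add: power_divide)
  qed simp
  have cos_eq: "2 * cos (2 * of_real pi * \<eta>) = ?e + ?e'"
    unfolding cos_exp_eq by simp
  have n1: "norm (?e) = 1 / a\<^sup>2" "norm (?e') = a\<^sup>2"
    unfolding a_def exp_double[symmetric] y_def norm_exp_eq_Re by (simp_all add: exp_minus inverse_eq_divide mult_ac)
  have a2: "1 < a\<^sup>2" using a by simp
  then have inv: "1 / a\<^sup>2 < 1" by (subst divide_less_eq_1_pos) auto
  have cn: "?c \<le> 2 * a\<^sup>2"
    unfolding cos_eq using norm_triangle_ineq[of "?e" "?e'"] a2 inv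
    unfolding n1 by linarith
  have cpos: "?c > 0"
  proof -
    have "a\<^sup>2 - 1 / a\<^sup>2 \<le> ?c"
      unfolding cos_eq using norm_diff_ineq[of "?e'" "?e"]
      unfolding n1 by (simp add: add.commute)
    then show ?thesis using a2 inv by linarith
  qed
  have "exp (- pi * Im \<eta>) / (4 * (1 + 1 / Im \<eta>)) \<le> (1 / a) * (1 - 1 / a) / 4"
  proof -
    have "1 / (1 + 1 / Im \<eta>) \<le> 1 / (1 + 1 / y)"
      using eta y pi_gt3 unfolding y_def by (intro divide_left_mono mult_pos_pos add_pos_pos) (auto simp: field_simps)
    also have "\<dots> = 1 - 1 / (1 + y)" using y by (simp add: field_simps)
    also have "\<dots> \<le> 1 - 1 / a"
    proof -
      have "1 + y \<le> a" unfolding a_def by (rule exp_ge_add_one_self)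
      then have "1 / a \<le> 1 / (1 + y)" using y by (intro divide_left_mono mult_pos_pos) auto
      then show ?thesis by simp
    qed
    finally have "(1 / a) * (1 / (1 + 1 / Im \<eta>)) \<le> (1 / a) * (1 - 1 / a)" using a by (intro mult_left_mono) auto
    moreover have "exp (- pi * Im \<eta>) = 1 / a" unfolding a_def y_def by (simp add: exp_minus inverse_eq_divide)
    moreover have "x / (4 * X) = x * (1 / X) / 4" for x X :: real by simp
    ultimately show ?thesis by (simp only: divide_right_mono zero_le_numeral)
  qed
  also have "\<dots> \<le> ((a - 1 / a) / 2) / (2 * a\<^sup>2)"
  proof -
    have "(1 / a) * (1 - 1 / a) \<le> (1 / a) * (1 - (1 / a)\<^sup>2)"
      using a by (intro mult_left_mono diff_left_mono) (auto simp: power2_eq_square divide_simps)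
    also have "\<dots> = (a - 1 / a) / a\<^sup>2" using a by (simp add: field_simps power2_eq_square)
    finally have "(1 / a) * (1 - 1 / a) / 4 \<le> (a - 1 / a) / a\<^sup>2 / 4" by (rule divide_right_mono) simp
    also have "x / z / 4 = (x / 2) / (2 * z)" for x z :: real by simp
    finally show ?thesis .
  qed
  also have "\<dots> \<le> ?s / ?c"
    using a1 sn cn cpos by (intro frac_le) auto
  also have "\<dots> \<le> sqrt 2 * (?s / ?c)"
    using mult_right_mono[of 1 "sqrt 2" "?s / ?c"] by simp
  also have "\<dots> = norm main_factor" unfolding main_factor_def by (simp add: norm_mult norm_divide)
  finally show ?thesis .
qed

text \<open>The factor exp(-pi Im eta) of both errors cancels against the main factor. Dividing by
  the latter costs 4 (1 + 1 / Im eta), which raises the fourth power of the sum estimate to the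
  fifth.\<close>

lemma riemann_aux_saddle:
  defines "C \<equiv> 8 * (2400 * exp 169 + 600 * exp 461 * (LINT v|lborel. exp (- v\<^sup>2 / 50)))"
  shows "\<exists>W. riemann_aux s = M * main_factor * (1 + W)
     \<and> norm W \<le> C * ((1 + 1 / Im \<eta>) ^ 5 / norm \<eta> + (1 + 1 / Im \<eta>) * exp (- Im s / 2))"
proof -
  define N where "N = nat \<lfloor>Re \<eta> - Im \<eta>\<rfloor>"
  have N: "real N \<le> Re \<eta> - Im \<eta>" "Re \<eta> - Im \<eta> < real N + 1"
    unfolding N_def using eta by linarith+
  define g where "g = 1 + 1 / Im \<eta>"
  have g1: "g \<ge> 1" unfolding g_def using eta by simp
  define h where "h = norm \<eta>"
  have h: "h > 0" unfolding h_def using big by linarith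
  define m where "m = norm M"
  have M0: "M \<noteq> 0" unfolding M_def using eta by auto
  then have m0: "m > 0" unfolding m_def by simp
  define E where "E = exp (- pi * Im \<eta>)"
  define T where "T = exp (- Im s / 2)"
  define K1 where "K1 = (2400 * exp 169 :: real)"
  define K2 where "K2 = 600 * exp 461 * (LINT v|lborel. exp (- v\<^sup>2 / 50 :: real))"
  have K: "K1 \<ge> 0" "K2 \<ge> 0" unfolding K1_def K2_def by (auto intro!: mult_nonneg_nonneg Bochner_Integration.integral_nonneg)
  \<comment> \<open>Re eta - Im eta lies in [N, N + 1), so the half-integer line is within 1 / (2
    sqrt 2) of the saddle. The tolerance 3/4 is shared with the sum estimate, where the line through
    N can be almost 1 / sqrt 2 away.\<close>
  have b: "\<bar>(real N + 1/2) / sqrt 2 - b0\<bar> \<le> 3/4"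
  proof -
    have "(real N + 1/2) / sqrt 2 - b0 = (real N + 1/2 - (Re \<eta> - Im \<eta>)) / sqrt 2"
      unfolding b0_def by (simp add: diff_divide_distrib)
    then have "\<bar>(real N + 1/2) / sqrt 2 - b0\<bar> = \<bar>real N + 1/2 - (Re \<eta> - Im \<eta>)\<bar> / sqrt 2" by simp
    also have "\<dots> \<le> (1/2) / 1"
    proof (intro frac_le)
      show "\<bar>real N + 1/2 - (Re \<eta> - Im \<eta>)\<bar> \<le> 1/2" using N unfolding abs_le_iff by (intro conjI; linarith)
    qed auto
    finally show ?thesis by simp
  qed
  define S1 where "S1 = (\<Sum>n=1..N. cos (of_real pi * of_nat n) * aux_num s (of_nat n))"
  define S2 where "S2 = cos (of_real pi * of_nat N) * saddle_gauss \<eta> (of_nat N) / (1 + exp (4 * of_real pi * \<i> * \<eta>))"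
  define J1 where "J1 = line_int (\<lambda>x. aux_num s x / two_i_sin x) ((real N + 1/2) / sqrt 2)"
  define J2 where "J2 = line_int (\<lambda>x. saddle_gauss \<eta> x / two_i_sin x) ((real N + 1/2) / sqrt 2)"
  have R: "riemann_aux s = S1 + J1" unfolding S1_def J1_def by (rule riemann_aux_eq_sum_line_int[OF Re_s_le])
  have G: "J2 + S2 = main_factor" unfolding J2_def S2_def main_factor_def by (rule saddle_gauss_total)
  have e1: "norm (S1 - M * S2) \<le> K1 * m * E * (g ^ 4 / h)"
    unfolding S1_def S2_def K1_def m_def E_def g_def h_def by (rule sum_diff_le[OF N])
  have e2: "norm (J1 - M * J2) \<le> K2 * m * E * (1 / h + T)"
    unfolding J1_def J2_def K2_def m_def E_def h_def T_def by (rule line_int_diff_le[OF b])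
  have lower: "E / (4 * g) \<le> norm main_factor" unfolding E_def g_def by (rule norm_main_factor_ge)
  have E0: "E > 0" and T0: "T > 0" unfolding E_def T_def by auto
  have "E / (4 * g) > 0" using E0 g1 by simp
  then have mf0: "main_factor \<noteq> 0" using lower by auto
  define W where "W = (riemann_aux s - M * main_factor) / (M * main_factor)"
  have eq: "riemann_aux s = M * main_factor * (1 + W)"
    unfolding W_def using M0 mf0 by (simp add: distrib_left)
  have g4: "1 \<le> g ^ 4" using g1 by (rule one_le_power)
  have "norm (riemann_aux s - M * main_factor) \<le> (K1 + K2) * m * E * (g ^ 4 / h + T)"
  proof -
    have "riemann_aux s - M * main_factor = (S1 - M * S2) + (J1 - M * J2)"
      unfolding R G[symmetric] by (simp add: algebra_simps)
    then have "norm (riemann_aux s - M * main_factor) \<le> norm (S1 - M * S2) + norm (J1 - M * J2)"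
      by (simp only: norm_triangle_ineq)
    also have "\<dots> \<le> K1 * m * E * (g ^ 4 / h + T) + K2 * m * E * (g ^ 4 / h + T)"
    proof (rule add_mono)
      have "K1 * m * E * (g ^ 4 / h) \<le> K1 * m * E * (g ^ 4 / h + T)"
        using K m0 E0 T0 by (intro mult_left_mono) auto
      then show "norm (S1 - M * S2) \<le> K1 * m * E * (g ^ 4 / h + T)" using e1 by linarith
      have "1 / h \<le> g ^ 4 / h" using g4 h by (intro divide_right_mono) auto
      then have "K2 * m * E * (1 / h + T) \<le> K2 * m * E * (g ^ 4 / h + T)"
        using K m0 E0 by (intro mult_left_mono add_right_mono) auto
      then show "norm (J1 - M * J2) \<le> K2 * m * E * (g ^ 4 / h + T)" using e2 by linarith
    qed
    finally show ?thesis by (simp add: algebra_simps)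
  qed
  then have "norm W \<le> ((K1 + K2) * m * E * (g ^ 4 / h + T)) / (m * (E / (4 * g)))"
    unfolding W_def norm_divide norm_mult m_def[symmetric] using lower m0 E0 g1 K h T0
    by (intro frac_le mult_left_mono mult_nonneg_nonneg) auto
  also have "\<dots> = 4 * (K1 + K2) * (g ^ 5 / h + g * T)"
    using m0 E0 g1 h by (simp add: field_simps power_numeral_reduce)
  also have "\<dots> \<le> C * (g ^ 5 / h + g * T)"
    unfolding C_def K1_def[symmetric] K2_def[symmetric] using K g1 h T0
    by (intro mult_right_mono) auto
  finally have "norm W \<le> C * (g ^ 5 / h + g * T)" .
  with eq show ?thesis unfolding g_def h_def T_def by (intro exI[of _ W] conjI)
qed

end

section \<open>Powers of t and the theorem\<close>

lemma powr_3_7_ge_50: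
  assumes "t \<ge> (10000::real)"
  shows "t powr (3/7) \<ge> 50"
proof -
  \<comment> \<open>The point is 50^7 <= 10000^3 = 10^12. The value 50 makes 1 - Re s exceed 4 pi
    and keeps the error of chi below 1/2.\<close>
  have "(50::real) = (50 powr 7) powr (1/7)" by (simp only: powr_powr) simp
  also have "\<dots> \<le> (10000 powr 3) powr (1/7)" by (intro powr_mono2) auto
  also have "\<dots> = 10000 powr (3/7)" by (simp only: powr_powr) simp
  also have "\<dots> \<le> t powr (3/7)" using assms by (intro powr_mono2) auto
  finally show ?thesis .
qed

theorem theorem9:
  "\<exists>A t0 :: real. t0 > 1 \<and>
     (\<forall>s::complex. Im s \<ge> t0 \<and> 1 - Re s \<ge> Im s powr (3 / 7) \<longrightarrow>
       (\<exists>U::complex.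
          riemann_aux s =
            - riemann_chi s * riemann_eta s powr (s - 1)
              * exp (- (of_real pi * \<i> * (riemann_eta s)\<^sup>2))
              * (of_real (sqrt 2) * exp (3 * of_real pi * \<i> / 8) * sin (of_real pi * riemann_eta s)
                 / (2 * cos (2 * of_real pi * riemann_eta s)))
              * (1 + U)
          \<and> norm U \<le> A * Im s powr (- (1 / 21))))"
proof -
  define C :: real where "C = 8 * (2400 * exp 169 + 600 * exp 461 * (LINT v|lborel. exp (- v\<^sup>2 / 50)))"
  have C0: "C \<ge> 0" unfolding C_def
    by (auto intro!: mult_nonneg_nonneg add_nonneg_nonneg Bochner_Integration.integral_nonneg)
  \<comment> \<open>The 2 comes from |1 + V| >= 1/2; 3 * 14^5 and 28 are the two parts of the bound
    on W, and 16 = 12 + 4 bounds V.\<close>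
  define A where "A = 2 * (C * (3 * 14 ^ 5 + 28) + 16)"
  show ?thesis
  proof (rule exI[of _ A], rule exI[of _ 10000], intro conjI allI impI)
    fix s :: complex
    assume "Im s \<ge> 10000 \<and> 1 - Re s \<ge> Im s powr (3 / 7)"
    then have t: "Im s \<ge> 10000" and sig: "1 - Re s \<ge> Im s powr (3/7)" by auto
    define t where "t = Im s"
    note t = t[folded t_def] and sig = sig[folded t_def]
    have big50: "t powr (3/7) \<ge> 50" by (rule powr_3_7_ge_50[OF t])
    have Res: "Re s < 1" using sig big50 by linarith
    define \<eta> where "\<eta> = riemann_eta s"
    have eta_sq: "\<eta>\<^sup>2 = (s - 1) / (2 * of_real pi * \<i>)"
      unfolding \<eta>_def using riemann_eta_eq_csqrt(1)[of s] t Res unfolding t_def by simp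
    have w: "(s - 1) / (2 * of_real pi * \<i>) = Complex (t / (2 * pi)) ((1 - Re s) / (2 * pi))"
      unfolding t_def by (simp add: complex_eq_iff Re_divide Im_divide power2_eq_square field_simps)
    have re: "(Re \<eta>)\<^sup>2 - (Im \<eta>)\<^sup>2 = t / (2 * pi)" and im: "2 * (Re \<eta> * Im \<eta>) = (1 - Re s) / (2 * pi)"
      using arg_cong[OF eta_sq[unfolded w], of Re] arg_cong[OF eta_sq[unfolded w], of Im]
      by (simp_all add: power2_eq_square mult.commute)
    have i0: "Im \<eta> > 0"
    proof -
      have "0 < Arg \<eta> \<and> Arg \<eta> < pi"
        using riemann_eta_eq_csqrt(2,3)[of s] t Res pi_gt_zero unfolding \<eta>_def t_def by auto
      then show ?thesis by (simp add: Arg_lt_pi)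
    qed
    have r0: "Re \<eta> > 0"
    proof -
      have "Re \<eta> * Im \<eta> > 0" using im Res by (smt (verit) divide_pos_pos pi_gt_zero)
      then show ?thesis using i0 by (simp add: zero_less_mult_iff)
    qed
    have ri: "Im \<eta> < Re \<eta>"
    proof -
      have "(Im \<eta>)\<^sup>2 < (Re \<eta>)\<^sup>2" using re t by (smt (verit) divide_pos_pos pi_gt_zero)
      then show ?thesis using r0 by (rule_tac power2_less_imp_less) auto
    qed
    have seq: "s = 1 + 2 * of_real pi * \<i> * \<eta>\<^sup>2" unfolding eta_sq by simp
    have prod: "Re \<eta> * Im \<eta> = (1 - Re s) / (4 * pi)" using im by simp
    have prod1: "Re \<eta> * Im \<eta> \<ge> 1"
    proof -
      have "4 * pi \<le> 1 - Re s" using sig big50 pi_less_4 by linarith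
      then show ?thesis unfolding prod by (simp add: le_divide_eq)
    qed
    have nsq: "(norm \<eta>)\<^sup>2 \<ge> t / 9"
    proof -
      have "t / 9 \<le> t / (2 * pi)" using t pi_less_4 by (intro divide_left_mono) auto
      also have "\<dots> \<le> (norm \<eta>)\<^sup>2" unfolding re[symmetric] cmod_power2 by simp
      finally show ?thesis .
    qed
    have nlow: "norm \<eta> \<ge> sqrt t / 3"
    proof (rule power2_le_imp_le)
      have "(sqrt t / 3)\<^sup>2 = t / 9" using t by (simp add: power_divide)
      then show "(sqrt t / 3)\<^sup>2 \<le> (norm \<eta>)\<^sup>2" using nsq by simp
    qed simp
    have "sqrt t \<ge> 100" using t by (intro real_le_rsqrt) (simp add: power2_eq_square)
    then have n12: "norm \<eta> \<ge> 12" using nlow by linarith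
    interpret saddle_setup \<eta> s
      by unfold_locales (use i0 ri seq n12 prod1 in auto)
    obtain W where W: "riemann_aux s = M * main_factor * (1 + W)"
      "norm W \<le> C * ((1 + 1 / Im \<eta>) ^ 5 / norm \<eta> + (1 + 1 / Im \<eta>) * exp (- Im s / 2))"
      using riemann_aux_saddle unfolding C_def by blast
    have "4 \<le> 1 - Re s" using sig big50 by linarith
    from riemann_chi_asymptotic[OF i0 ri seq this]
    obtain V where V: "riemann_chi s * \<eta> powr (s - 1) * exp (- (of_real pi * \<i> * \<eta>\<^sup>2))
       = exp (\<i> * of_real pi / 4) * M * (1 + V)" "norm V \<le> 12 / (1 - Re s) + 4 * exp (- pi * t)"
      unfolding M_def t_def by blast
    have expt: "exp (- c * t) \<le> 1 / t" if "c \<ge> 1" for c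
    proof -
      have "t \<le> c * t" using that t by simp
      also have "\<dots> \<le> exp (c * t)" using exp_ge_add_one_self[of "c * t"] by linarith
      finally show ?thesis using t by (simp add: exp_minus field_simps)
    qed
    define p where "p = t powr (- (1/21))"
    have p0: "p > 0" unfolding p_def using t by simp
    have powle: "t powr a \<le> p" if "a \<le> - (1/21)" for a unfolding p_def using that t by (intro powr_mono) auto
    have tinv: "1 / t = t powr (-1)" using t by (simp add: powr_minus_divide)
    have V1: "norm V \<le> 12 * t powr (- (3/7)) + 4 * t powr (-1)"
    proof -
      have "12 / (1 - Re s) \<le> 12 / t powr (3/7)"
        using sig big50 by (intro divide_left_mono mult_pos_pos) linarith+
      also have "\<dots> = 12 * t powr (- (3/7))" by (simp add: powr_minus_divide)
      finally have "12 / (1 - Re s) \<le> 12 * t powr (- (3/7))" .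
      moreover have "exp (- pi * t) \<le> t powr (-1)" unfolding tinv[symmetric] using pi_gt3 by (intro expt) auto
      ultimately show ?thesis using V(2) by linarith
    qed
    have Vhalf: "norm V \<le> 1/2"
    proof -
      have "12 * t powr (- (3/7)) \<le> 12 / 50"
        using big50 by (simp add: powr_minus_divide) (simp add: divide_le_eq)
      moreover have "4 * t powr (-1) \<le> 4 / 10000" unfolding tinv[symmetric] using t by (simp add: divide_le_eq)
      ultimately show ?thesis using V1 by linarith
    qed
    have Vp: "norm V \<le> 16 * p" using V1 powle[of "- (3/7)"] powle[of "-1"] by simp
    \<comment> \<open>If \<open>Im \<eta>\<close> < 1, then Re eta <= t^(1/2), and Re eta Im eta >=
      t^(3/7) / (4 pi) gives 1 / Im eta <= 4 pi t^(1/2 - 3/7) = 4 pi t^(1/14). The constant is 14 =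
      1 + 13, with 4 pi < 13.\<close>
    have g: "1 + 1 / Im \<eta> \<le> 14 * t powr (1/14)"
    proof -
      have t14: "t powr (1/14) \<ge> 1" using t by (intro ge_one_powr_ge_zero) auto
      show ?thesis
      proof (cases "Im \<eta> \<ge> 1")
        case True
        then have "1 / Im \<eta> \<le> 1" by simp
        then show ?thesis using t14 by linarith
      next
        case False
        have "(Im \<eta>)\<^sup>2 \<le> 1\<^sup>2" using i0 False by (intro power_mono) auto
        moreover have "t / (2 * pi) \<le> t / 2" using t pi_gt3 by (intro divide_left_mono) auto
        ultimately have "(Re \<eta>)\<^sup>2 \<le> t" using re t by simp
        then have "Re \<eta> \<le> sqrt t" by (rule real_le_rsqrt)
        also have "sqrt t = t powr (1/2)" using t by (simp add: powr_half_sqrt)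
        finally have reta: "Re \<eta> \<le> t powr (1/2)" .
        have "t powr (3/7) \<le> 4 * pi * (Re \<eta> * Im \<eta>)" unfolding prod using sig by simp
        also have "\<dots> \<le> 4 * pi * (t powr (1/2) * Im \<eta>)" using reta i0 by (intro mult_left_mono mult_right_mono) auto
        finally have "t powr (3/7) \<le> 4 * pi * (t powr (1/2) * Im \<eta>)" .
        then have "t powr (3/7) * (1 / Im \<eta>) \<le> 4 * pi * t powr (1/2)" using i0 by (simp add: divide_le_eq mult_ac)
        then have "t powr (- (3/7)) * (t powr (3/7) * (1 / Im \<eta>)) \<le> t powr (- (3/7)) * (4 * pi * t powr (1/2))"
          by (intro mult_left_mono) auto
        moreover have "t powr (- (3/7)) * (t powr (3/7) * (1 / Im \<eta>)) = 1 / Im \<eta>"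
          using t by (simp add: mult.assoc[symmetric] powr_add[symmetric])
        moreover have "t powr (- (3/7)) * (4 * pi * t powr (1/2)) = 4 * pi * t powr (1/14)"
          using t by (simp add: mult.left_commute powr_add[symmetric])
        ultimately have "1 / Im \<eta> \<le> 4 * pi * t powr (1/14)" by (simp only:)
        also have "\<dots> \<le> 13 * t powr (1/14)" using pi_approx by (intro mult_right_mono) auto
        finally show ?thesis using t14 by linarith
      qed
    qed
    have g0: "1 + 1 / Im \<eta> \<ge> 0" using i0 by simp
    \<comment> \<open>The slowest of all error terms: 5/14 from the fifth power against 1/2 from
      |eta| leaves t^(-1/7).\<close>
    have T1: "(1 + 1 / Im \<eta>) ^ 5 / norm \<eta> \<le> 3 * 14 ^ 5 * p"
    proof -
      have "(1 + 1 / Im \<eta>) ^ 5 \<le> (14 * t powr (1/14)) ^ 5" using g g0 by (intro power_mono) auto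
      also have "\<dots> = 14 ^ 5 * t powr (5/14)"
        using t by (simp add: power_mult_distrib powr_powr flip: powr_realpow)
      finally have "(1 + 1 / Im \<eta>) ^ 5 / norm \<eta> \<le> (14 ^ 5 * t powr (5/14)) / (sqrt t / 3)"
        using nlow t g0 by (intro frac_le) auto
      also have "\<dots> = 3 * 14 ^ 5 * (t powr (5/14) / t powr (1/2))" using t by (simp add: powr_half_sqrt)
      also have "t powr (5/14) / t powr (1/2) = t powr (- (1/7))" using t by (simp add: powr_diff[symmetric])
      also have "\<dots> \<le> p" by (rule powle) simp
      finally show ?thesis by simp
    qed
    have T2: "(1 + 1 / Im \<eta>) * exp (- Im s / 2) \<le> 28 * p"
    proof -
      have e2: "exp (- Im s / 2) \<le> 2 * t powr (-1)"
      proof -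
        have "t / 2 \<le> exp (t / 2)" using exp_ge_add_one_self[of "t / 2"] by linarith
        then have "exp (- (t / 2)) \<le> 2 / t" using t by (simp add: exp_minus field_simps)
        then show ?thesis unfolding tinv[symmetric] t_def[symmetric] by simp
      qed
      have "(1 + 1 / Im \<eta>) * exp (- Im s / 2) \<le> (14 * t powr (1/14)) * (2 * t powr (-1))"
        using g g0 e2 by (intro mult_mono) auto
      also have "\<dots> = 28 * (t powr (1/14) * t powr (-1))" 
      proof -
        have "(14 * a) * (2 * b) = 28 * (a * b)" for a b :: real by simp
        then show ?thesis .
      qed
      also have "t powr (1/14) * t powr (-1) = t powr (- (13/14))" by (simp only: powr_add[symmetric]) simp
      also have "28 * t powr (- (13/14)) \<le> 28 * p" by (intro mult_left_mono powle) auto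
      finally show ?thesis .
    qed
    have Wp: "norm W \<le> C * ((3 * 14 ^ 5 + 28) * p)"
    proof -
      have "norm W \<le> C * (3 * 14 ^ 5 * p + 28 * p)"
        using W(2) T1 T2 C0 by (meson add_mono mult_left_mono order_trans)
      then show ?thesis by (simp only: distrib_right)
    qed
    \<comment> \<open>Chosen so that (1 + V) (1 + U) = 1 + W: the error V of chi is divided out of
      the error W of the saddle approximation.\<close>
    define U where "U = (W - V) / (1 + V)"
    have V1n: "norm (1 + V) \<ge> 1/2" using norm_diff_ineq[of 1 V] Vhalf by simp
    then have V10: "1 + V \<noteq> 0" by auto
    have U1: "(1 + V) * (1 + U) = 1 + W" unfolding U_def using V10 by (simp add: field_simps)
    have "norm U \<le> norm (W - V) / (1/2)"
      unfolding U_def norm_divide using V1n by (intro divide_left_mono) auto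
    also have "\<dots> \<le> 2 * (norm W + norm V)" using norm_triangle_ineq4[of W V] by simp
    also have "\<dots> \<le> 2 * (C * ((3 * 14 ^ 5 + 28) * p) + 16 * p)" using Wp Vp by simp
    also have "\<dots> = A * p" unfolding A_def by (simp add: algebra_simps)
    finally have Ub: "norm U \<le> A * p" .
    \<comment> \<open>The phase 5 pi / 8 of the Mordell integral is the 3 pi / 8 of the statement
      plus the pi / 4 from the asymptotics of chi.\<close>
    have ph: "exp (\<i> * of_real pi / 4) * exp (3 * of_real pi * \<i> / 8) = exp (5 * of_real pi * \<i> / 8)"
      unfolding exp_add[symmetric] by (rule arg_cong[where f = exp]) (simp add: field_simps)
    define sc where "sc = sin (of_real pi * \<eta>) / (2 * cos (2 * of_real pi * \<eta>))"
    have mf: "main_factor = - (of_real (sqrt 2) * (exp (\<i> * of_real pi / 4) * exp (3 * of_real pi * \<i> / 8)) * sc)"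
      unfolding main_factor_def ph sc_def by simp
    have "- riemann_chi s * \<eta> powr (s - 1) * exp (- (of_real pi * \<i> * \<eta>\<^sup>2))
        * (of_real (sqrt 2) * exp (3 * of_real pi * \<i> / 8) * sin (of_real pi * \<eta>) / (2 * cos (2 * of_real pi * \<eta>))) * (1 + U)
      = - (riemann_chi s * \<eta> powr (s - 1) * exp (- (of_real pi * \<i> * \<eta>\<^sup>2)))
        * (of_real (sqrt 2) * exp (3 * of_real pi * \<i> / 8) * sc) * (1 + U)" (is "?lhs = _")
      unfolding sc_def by simp
    also have "\<dots> = M * main_factor * ((1 + V) * (1 + U))"
      unfolding V(1) mf by (simp add: mult_ac)
    also have "\<dots> = riemann_aux s" unfolding U1 W(1) ..
    finally have eq: "?lhs = riemann_aux s" .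
    show "\<exists>U::complex.
          riemann_aux s =
            - riemann_chi s * riemann_eta s powr (s - 1)
              * exp (- (of_real pi * \<i> * (riemann_eta s)\<^sup>2))
              * (of_real (sqrt 2) * exp (3 * of_real pi * \<i> / 8) * sin (of_real pi * riemann_eta s)
                 / (2 * cos (2 * of_real pi * riemann_eta s)))
              * (1 + U)
          \<and> norm U \<le> A * Im s powr (- (1 / 21))"
      using eq[symmetric] Ub unfolding \<eta>_def p_def t_def by (intro exI[of _ U] conjI)
  qed simp
qed

end
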